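(* Let $(X,d,\sigma)$ be a compatible metric-topological space with $(X,d)$ complete, let $\phi:X\to(-\infty,\infty]$ be proper and satisfy the LSCC assumptions, with coercivity constant $\mathsf B$, and let $\varepsilon>0$ satisfy $\frac1{16\varepsilon}\ge\mathsf B$. Then the integral defining $\mathcal I_\varepsilon[u]$ is well defined (possibly taking the value $\infty$) for every $\bar u\in X$ and every $u\in\mathscr C_\varepsilon(\bar u)$. Moreover, if the problem of minimizing $\mathcal I_\varepsilon$ over $\mathscr C_\varepsilon(\bar u)$ is feasible, i.e. there exists $u\in\mathscr C_\varepsilon(\bar u)$ with $\mathcal I_\varepsilon[u]<\infty$ (in particular when $\bar u\in D(\phi)$), then it admits at least one solution. In this case all the sets $\mathcal M_{\varepsilon,T}(\bar u)$, $T\in(0,\infty]$, are compact in $\mathscr C_\varepsilon(\bar u)$ endowed with the compact-open topology induced by $\sigma$.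
   Context: **Setting.** $(X,d)$ is a complete metric space and $\sigma$ is a Hausdorff topology on $X$; $(X,d,\sigma)$ is called compatible if (MT1) $u_n\to u$ and $v_n\to v$ in $\sigma$ imply $\liminf_n d(u_n,v_n)\ge d(u,v)$; (MT2) for every $\sigma$-open set $U$ and $x\in U$ there exist a $\sigma$-open neighborhood $V$ of $x$ and $\delta>0$ such that $d(y,V)<\delta$ implies $y\in U$, where $d(y,V)=\inf_{v\in V}d(y,v)$. For an interval $I\subset\mathbb R$ and $p\in[1,\infty]$, $AC^p(I;X)$ is the set of curves $u:I\to X$ for which there is $m\in L^p(I)$ with $d(u(s),u(t))\le\int_s^t m(r)\,dr$ for all $s\le t$ in $I$; $AC^p_{\rm loc}(I;X)$ is the set of curves belonging to $AC^p(J;X)$ for every compact interval $J\subset I$. The metric derivative $|u'|(t)=\lim_{s\to t}\frac{d(u(s),u(t))}{|t-s|}$ exists for a.e. $t\in I$. **LSCC assumptions.** $\phi:X\to(-\infty,\infty]$ is proper, $D(\phi)=\{\phi<\infty\}$, and: (Lower semicontinuity) if $\sup_{n,m}d(u_n,u_m)<\infty$ and $u_n\to u$ in $\sigma$, then $\liminf_n\phi(u_n)\ge\phi(u)$; (Compactness) every sequence with $\sup_n\phi(u_n)<\infty$ and $\sup_{n,m}d(u_n,u_m)<\infty$ has a $\sigma$-convergent subsequence; (Coercivity) there are $u_*\in X$ and constants $\mathsf A,\mathsf B\ge0$ such that $\phi(u)\ge-\mathsf B\,d^2(u,v)-\mathsf Q(v)$ for all $u,v\in X$, where $\mathsf Q(v)=\mathsf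 B\,d^2(v,u_* )+\mathsf A$. **WED functional.** For $\varepsilon>0$, $\mu_\varepsilon$ is the probability measure on $(0,\infty)$ with density $\frac1\varepsilon e^{-t/\varepsilon}$, and $\mathcal I_\varepsilon[u]=\int_0^\infty\big(\frac\varepsilon2|u'|^2(t)+\phi(u(t))\big)\,d\mu_\varepsilon(t)$. The admissible classes are $\mathscr C_\varepsilon(\bar u)=\{u\in AC^2_{\rm loc}([0,\infty);X): u(0)=\bar u,\ \int_0^\infty|u'|^2\,d\mu_\varepsilon<\infty\}$ and, for $T\in(0,\infty)$, $\mathscr C_{\varepsilon,T}(\bar u)=\{u\in AC^2_{\rm loc}([0,\infty);X): u(0)=\bar u,\ u(t)=u(T)\text{ for all }t\ge T\}$; $\mathscr C_{\varepsilon,\infty}(\bar u)=\mathscr C_\varepsilon(\bar u)$. For $T\in(0,\infty]$, $\mathcal M_{\varepsilon,T}(\bar u)$ is the set of minimizers of $\mathcal I_\varepsilon$ in $\mathscr C_{\varepsilon,T}(\bar u)$.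
   Formalization: "Compact" is proved as sequential compactness: every sequence of minimizers has a subsequence converging in the compact-open topology to a minimizer; open-cover compactness can fail, e.g. on a hedgehog with spines indexed by the first uncountable ordinal and potential minus the radius. *)

theory Defs
  imports "HOL-Analysis.Analysis"
begin

text \<open>The metric space \<open>(X, d)\<close> is a type of class \<^class>\<open>complete_space\<close> with its \<open>dist\<close>;
  \<open>\<sigma>\<close> is a second topology on the same type.\<close>

definition compatible :: "'a::metric_space topology \<Rightarrow> bool" where
  "compatible \<sigma> \<longleftrightarrow>
     topspace \<sigma> = UNIV \<and> Hausdorff_space \<sigma> \<and>
     (\<forall>(u :: nat \<Rightarrow> 'a) v a b. limitin \<sigma> u a sequentially \<longrightarrow> limitin \<sigma> v b sequentially \<longrightarrow>
        ereal (dist a b) \<le> liminf (\<lambda>n. ereal (dist (u n) (v n)))) \<and>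
     (\<forall>U x. openin \<sigma> U \<longrightarrow> x \<in> U \<longrightarrow>
        (\<exists>V \<delta>. openin \<sigma> V \<and> x \<in> V \<and> \<delta> > 0 \<and> (\<forall>y. infdist y V < \<delta> \<longrightarrow> y \<in> U)))"

definition eff_dom :: "('a \<Rightarrow> ereal) \<Rightarrow> 'a set" where
  "eff_dom \<phi> = {x. \<phi> x < \<infinity>}"

definition proper :: "('a \<Rightarrow> ereal) \<Rightarrow> bool" where
  "proper \<phi> \<longleftrightarrow> (\<forall>x. \<phi> x \<noteq> -\<infinity>) \<and> eff_dom \<phi> \<noteq> {}"

definition LSCC :: "'a::metric_space topology \<Rightarrow> ('a \<Rightarrow> ereal) \<Rightarrow> 'a \<Rightarrow> real \<Rightarrow> real \<Rightarrow> bool" where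
  "LSCC \<sigma> \<phi> ustar A B \<longleftrightarrow>
     (\<forall>(u :: nat \<Rightarrow> 'a) l. bounded (range u) \<longrightarrow> limitin \<sigma> u l sequentially \<longrightarrow>
        \<phi> l \<le> liminf (\<lambda>n. \<phi> (u n))) \<and>
     (\<forall>u :: nat \<Rightarrow> 'a. (SUP n. \<phi> (u n)) < \<infinity> \<longrightarrow> bounded (range u) \<longrightarrow>
        (\<exists>l r. strict_mono r \<and> limitin \<sigma> (u \<circ> r) l sequentially)) \<and>
     A \<ge> 0 \<and> B \<ge> 0 \<and>
     (\<forall>u v. ereal (- B * (dist u v)\<^sup>2 - (B * (dist v ustar)\<^sup>2 + A)) \<le> \<phi> u)"

definition AC2_on :: "real set \<Rightarrow> (real \<Rightarrow> 'a::metric_space) \<Rightarrow> bool" where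
  "AC2_on I u \<longleftrightarrow>
     (\<exists>m :: real \<Rightarrow> real. m \<in> borel_measurable (lebesgue_on I) \<and>
        integrable (lebesgue_on I) (\<lambda>r. (m r)\<^sup>2) \<and>
        (\<forall>s\<in>I. \<forall>t\<in>I. s \<le> t \<longrightarrow> dist (u s) (u t) \<le> (LINT r|lebesgue_on {s..t}. m r)))"

definition AC2_loc :: "real set \<Rightarrow> (real \<Rightarrow> 'a::metric_space) \<Rightarrow> bool" where
  "AC2_loc I u \<longleftrightarrow> (\<forall>a b. {a..b} \<subseteq> I \<longrightarrow> AC2_on {a..b} u)"

definition has_metric_deriv :: "real set \<Rightarrow> (real \<Rightarrow> 'a::metric_space) \<Rightarrow> real \<Rightarrow> real \<Rightarrow> bool" where
  "has_metric_deriv I u l t \<longleftrightarrow>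
     ((\<lambda>s. dist (u s) (u t) / \<bar>t - s\<bar>) \<longlongrightarrow> l) (at t within I)"

text \<open>Arbitrary where the limit does not exist.\<close>
definition metric_deriv :: "real set \<Rightarrow> (real \<Rightarrow> 'a::metric_space) \<Rightarrow> real \<Rightarrow> real" where
  "metric_deriv I u t = (THE l. has_metric_deriv I u l t)"

definition wed_measure :: "real \<Rightarrow> real measure" where
  "wed_measure \<epsilon> = density (lebesgue_on {0<..}) (\<lambda>t. ennreal (exp (- t / \<epsilon>) / \<epsilon>))"

text \<open>Extended-real integrals: \<open>e2ennreal\<close> sends negative values to 0, so the two nonnegative
  integrals below are those of the positive and of the negative part. An integral is regarded
  as well defined, with a value in \<open>(-\<infinity>, \<infinity>]\<close>, when the integrand is measurable and its negative
  part has finite integral.\<close>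

definition ereal_integral :: "'b measure \<Rightarrow> ('b \<Rightarrow> ereal) \<Rightarrow> ereal" where
  "ereal_integral M f =
     enn2ereal (\<integral>\<^sup>+ x. e2ennreal (f x) \<partial>M) - enn2ereal (\<integral>\<^sup>+ x. e2ennreal (- f x) \<partial>M)"

definition ereal_integral_well_defined :: "'b measure \<Rightarrow> ('b \<Rightarrow> ereal) \<Rightarrow> bool" where
  "ereal_integral_well_defined M f \<longleftrightarrow>
     f \<in> borel_measurable M \<and> (\<integral>\<^sup>+ x. e2ennreal (- f x) \<partial>M) < \<infinity>"

definition wed_integrand :: "('a::metric_space \<Rightarrow> ereal) \<Rightarrow> real \<Rightarrow> (real \<Rightarrow> 'a) \<Rightarrow> real \<Rightarrow> ereal" where
  "wed_integrand \<phi> \<epsilon> u t = ereal (\<epsilon> / 2 * (metric_deriv {0..} u t)\<^sup>2) + \<phi> (u t)"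

definition wed :: "('a::metric_space \<Rightarrow> ereal) \<Rightarrow> real \<Rightarrow> (real \<Rightarrow> 'a) \<Rightarrow> ereal" where
  "wed \<phi> \<epsilon> u = ereal_integral (wed_measure \<epsilon>) (wed_integrand \<phi> \<epsilon> u)"

text \<open>Curves on \<open>[0, \<infinity>)\<close> are total functions, made unique by \<open>extensional\<close>.\<close>

definition curves :: "real \<Rightarrow> 'a::metric_space \<Rightarrow> (real \<Rightarrow> 'a) set" where
  "curves \<epsilon> u\<^sub>0 =
     {u \<in> extensional {0..}. AC2_loc {0..} u \<and> u 0 = u\<^sub>0 \<and>
        (\<integral>\<^sup>+ t. ennreal ((metric_deriv {0..} u t)\<^sup>2) \<partial>wed_measure \<epsilon>) < \<infinity>}"

definition curves_upto :: "real \<Rightarrow> ereal \<Rightarrow> 'a::metric_space \<Rightarrow> (real \<Rightarrow> 'a) set" where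
  "curves_upto \<epsilon> T u\<^sub>0 =
     (if T = \<infinity> then curves \<epsilon> u\<^sub>0
      else {u \<in> extensional {0..}. AC2_loc {0..} u \<and> u 0 = u\<^sub>0 \<and>
              (\<forall>t. T \<le> ereal t \<longrightarrow> u t = u (real_of_ereal T))})"

definition wed_minimizers ::
    "('a::metric_space \<Rightarrow> ereal) \<Rightarrow> real \<Rightarrow> ereal \<Rightarrow> 'a \<Rightarrow> (real \<Rightarrow> 'a) set" where
  "wed_minimizers \<phi> \<epsilon> T u\<^sub>0 =
     {u \<in> curves_upto \<epsilon> T u\<^sub>0. \<forall>v\<in>curves_upto \<epsilon> T u\<^sub>0. wed \<phi> \<epsilon> u \<le> wed \<phi> \<epsilon> v}"

definition compact_open_topology :: "'b topology \<Rightarrow> 'a topology \<Rightarrow> ('b \<Rightarrow> 'a) topology" where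
  "compact_open_topology X Y =
     subtopology
       (topology_generated_by {{f. f ` K \<subseteq> U} | K U. compactin X K \<and> openin Y U})
       {f \<in> extensional (topspace X). continuous_map X Y f}"

text \<open>Compactness of sets of minimizers is meant sequentially, like every other topological
  hypothesis on \<open>\<sigma>\<close>. The covering property can fail: on the hedgehog with spines indexed by the
  first uncountable ordinal, with \<open>\<sigma>\<close> the product topology away from the centre, metric
  neighbourhoods at the centre, and \<open>\<phi>\<close> minus the distance from the centre, the minimizers
  starting at the centre form a copy of that ordinal.\<close>
definition sequentially_compactin :: "'a topology \<Rightarrow> 'a set \<Rightarrow> bool" where
  "sequentially_compactin X S \<longleftrightarrow>
     S \<subseteq> topspace X \<and>
     (\<forall>f :: nat \<Rightarrow> 'a. range f \<subseteq> S \<longrightarrow>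
        (\<exists>l\<in>S. \<exists>r. strict_mono r \<and> limitin X (f \<circ> r) l sequentially))"

end

theory Submission
  imports Defs "HOL-Library.Diagonal_Subsequence"
begin

text \<open>
  Existence and compactness of minimizers follow from the direct method. The three ingredients are
  not routine here, because \<open>\<phi>\<close> may be unbounded below and \<open>\<sigma>\<close> is weak.

  \<^item> Coercivity. The lower bound on \<open>\<phi>\<close> with base point \<open>u 0\<close> loses \<open>B * (dist (u t) (u 0))\<^sup>2\<close>.
    A Cauchy-Schwarz inequality with weight \<open>exp (s / (2 * \<epsilon>))\<close> bounds this squared distance by
    \<open>hardy u t\<close>, an integral of \<open>|u'|\<^sup>2\<close> over the times before \<open>t\<close>, and Tonelli's theorem evaluates the
    mean of \<open>hardy u\<close> to exactly \<open>4 * \<epsilon>\<^sup>2\<close> times the action \<open>\<integral>|u'|\<^sup>2 d\<mu>\<close>. Since \<open>16 * \<epsilon> * B \<le> 1\<close>, this costs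
    at most half of the dissipation term. Hence the functional is, up to the additive constant
    \<open>Q (u 0)\<close>, the integral of a nonnegative function plus a positive multiple of the action
    (\<open>wed_eq_energy\<close>). This proves that the functional is well defined, and a bound on it is a
    bound on the action.

  \<^item> Lower semicontinuity. Curves with bounded action can lose mass of the squared distance at
    infinity, so the lower bound on \<open>\<phi>\<close> alone gives no integrable minorant for Fatou's lemma.
    Keeping \<open>B * hardy u t\<close> inside the integrand makes it nonnegative, and for each \<open>t\<close> this term is a
    weighted action, which is lower semicontinuous by itself (\<open>weighted_action_lsc\<close>): the metric
    derivatives of the approximating curves have a weak cluster point \<open>m\<close> in \<open>L\<^sup>2(\<mu>)\<close>, the limit
    curve satisfies \<open>dist (u s) (u t) \<le> \<integral>m\<close> over \<open>[s, t]\<close>, and its metric derivative is the least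
    function with this property.

  \<^item> Compactness. A bound on the functional bounds \<open>\<phi> (v n t)\<close> at no given time \<open>t\<close>. However, every
    interval contains, for each \<open>n\<close>, a time at which \<open>\<phi> (v n _)\<close> is below a constant that depends on
    the interval only (\<open>good_time\<close>). A diagonal argument over rational intervals, equicontinuity,
    the absorption property of \<open>\<sigma>\<close>-neighbourhoods and completeness turn this into locally uniform
    \<open>\<sigma>\<close>-convergence at all times (\<open>curve_compactness\<close>).

  For finite \<open>T\<close> the minimal value is finite because a curve of finite energy can be stopped no
  later than \<open>T\<close>, at a time at which \<open>\<phi>\<close> is finite (\<open>feasible_upto\<close>).

  The theory of metric derivatives is developed first. Lebesgue's differentiation theorem is
  obtained from Henstock's lemma and the Vitali covering lemma; weak compactness in \<open>L\<^sup>2\<close> is replaced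
  by iterated midpoints of tails with almost minimal norm. Applied to difference quotients, this
  device also yields the fundamental theorem of calculus for absolutely continuous functions.
\<close>

section \<open>Lebesgue's differentiation theorem on an interval\<close>

text \<open>
  Henstock's lemma makes the total defect over disjoint fine intervals as small as desired. On the
  intervals collected here the defect is at least \<open>\<eta>\<close> times the length, so the lengths of a disjoint
  subfamily are summable with a small sum, and the fivefold enlargements of the Vitali covering
  lemma still cover the set. The intervals only have to contain \<open>x\<close>: below, \<open>x\<close> is an endpoint.
\<close>
lemma Lebesgue_differentiation_aux:
  fixes f :: "real \<Rightarrow> real"
  assumes f: "f integrable_on {a..b}" and \<eta>: "\<eta> > 0"
  shows "negligible {x. \<forall>\<delta>>0. \<exists>c d. a \<le> c \<and> c < d \<and> d \<le> b \<and> x \<in> {c..d} \<and> d - c < \<delta> \<and>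
            \<bar>(d - c) * f x - integral {c..d} f\<bar> \<ge> \<eta> * (d - c)}" (is "negligible ?E")
  unfolding negligible_outer_le
proof (intro allI impI)
  fix e :: real assume e: "e > 0"
  have pos: "e * \<eta> / 5 > 0" using e \<eta> by simp
  have f': "f integrable_on cbox a b" using f by simp
  obtain \<gamma> where \<gamma>: "gauge \<gamma>"
    and hen: "\<And>p. \<lbrakk>p tagged_partial_division_of (cbox a b); \<gamma> fine p\<rbrakk> \<Longrightarrow>
            (\<Sum>(x,k) \<in> p. norm (Henstock_Kurzweil_Integration.content k *\<^sub>R f x - integral k f)) < e * \<eta> / 5"
    by (rule Henstock_lemma[OF f' pos], rule that)
  define K where "K = {(x, c, d). a \<le> c \<and> c < d \<and> d \<le> b \<and> x \<in> {c..d} \<and> {c..d} \<subseteq> \<gamma> x \<and>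
            \<bar>(d - c) * f x - integral {c..d} f\<bar> \<ge> \<eta> * (d - c)}"
  define ctr :: "real \<times> real \<times> real \<Rightarrow> real" where "ctr = (\<lambda>(x,c,d). (c + d) / 2)"
  define rad :: "real \<times> real \<times> real \<Rightarrow> real" where "rad = (\<lambda>(x,c,d). (d - c) / 2)"
  have cb: "cball (ctr (x,c,d)) (rad (x,c,d)) = {c..d}" for x c d
    by (auto simp: ctr_def rad_def cball_eq_atLeastAtMost field_simps)
  have cov: "?E \<subseteq> (\<Union>i\<in>K. cball (ctr i) (rad i))"
  proof
    fix x assume x: "x \<in> ?E"
    from \<gamma> have "open (\<gamma> x)" "x \<in> \<gamma> x" by (auto simp: gauge_def)
    then obtain \<delta> where "\<delta> > 0" "ball x \<delta> \<subseteq> \<gamma> x" by (meson open_contains_ball)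
    with x obtain c d where cd: "a \<le> c" "c < d" "d \<le> b" "x \<in> {c..d}" "d - c < \<delta>"
         "\<bar>(d - c) * f x - integral {c..d} f\<bar> \<ge> \<eta> * (d - c)" by blast
    have "{c..d} \<subseteq> ball x \<delta>" using cd by (auto simp: dist_real_def)
    with \<open>ball x \<delta> \<subseteq> \<gamma> x\<close> cd have "(x,c,d) \<in> K" by (auto simp: K_def)
    moreover have "x \<in> cball (ctr (x,c,d)) (rad (x,c,d))" using cb cd by auto
    ultimately show "x \<in> (\<Union>i\<in>K. cball (ctr i) (rad i))" by blast
  qed
  have r: "0 < rad i \<and> rad i \<le> (b - a) / 2" if "i \<in> K" for i
    using that by (auto simp: K_def rad_def)
  obtain C where C: "countable C" "C \<subseteq> K"
     "pairwise (\<lambda>i j. disjnt (cball (ctr i) (rad i)) (cball (ctr j) (rad j))) C"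
     "?E \<subseteq> (\<Union>i\<in>C. cball (ctr i) (5 * rad i))"
    by (rule Vitali_covering_lemma_cballs[OF cov r], assumption, rule that)
  \<comment> \<open>\<open>10 * rad i\<close> is the length of the fivefold enlarged interval.\<close>
  have fin: "(\<Sum>i\<in>F. 10 * rad i) \<le> e" if F: "finite F" "F \<subseteq> C" for F
  proof -
    define p where "p = (\<lambda>i. (fst i, cball (ctr i) (rad i))) ` F"
    have inj: "inj_on (\<lambda>i. (fst i, cball (ctr i) (rad i))) F"
    proof (rule inj_onI)
      fix i j assume ij: "i \<in> F" "j \<in> F" "(fst i, cball (ctr i) (rad i)) = (fst j, cball (ctr j) (rad j))"
      then have "i \<in> K" "j \<in> K" using F C by auto
      with ij(3) show "i = j" by (cases i; cases j) (auto simp: K_def cb Icc_eq_Icc)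
    qed
    have mem: "\<exists>c d. (x,c,d) \<in> F \<and> k = {c..d}" if "(x,k) \<in> p" for x k
    proof -
      from that obtain i where i: "i \<in> F" "x = fst i" "k = cball (ctr i) (rad i)"
        by (auto simp: p_def)
      obtain c d where "i = (x,c,d)" using i(2) by (cases i) auto
      with i cb show ?thesis by metis
    qed
    have tpd: "p tagged_partial_division_of (cbox a b)"
      unfolding tagged_partial_division_of_def
    proof (intro conjI allI impI)
      show "finite p" using F by (simp add: p_def)
      fix x k assume "(x,k) \<in> p"
      then obtain c d where i: "(x,c,d) \<in> F" "k = {c..d}" using mem by blast
      then have "(x,c,d) \<in> K" using F C by auto
      with i show "x \<in> k" "k \<subseteq> cbox a b" by (auto simp: K_def)
      show "\<exists>a b. k = cbox a b" using i(2) box_real(2) by metis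
    next
      fix x k x' k' assume A: "(x,k) \<in> p \<and> (x',k') \<in> p \<and> (x,k) \<noteq> (x',k')"
      then have ne: "(x,k) \<noteq> (x',k')" by blast
      from A obtain c d where i: "(x,c,d) \<in> F" "k = {c..d}" using mem by blast
      from A obtain c' d' where j: "(x',c',d') \<in> F" "k' = {c'..d'}" using mem by blast
      have "(x,c,d) \<noteq> (x',c',d')" using ne i j by auto
      then have "disjnt (cball (ctr (x,c,d)) (rad (x,c,d))) (cball (ctr (x',c',d')) (rad (x',c',d')))"
        using C(3) i j F(2) by (meson pairwiseD subsetD)
      then have "k \<inter> k' = {}" using i j by (simp add: cb disjnt_def)
      then show "interior k \<inter> interior k' = {}" using interior_subset by blast
    qed
    have fine: "\<gamma> fine p"
      using F C by (force simp: fine_def p_def K_def cb)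
    have "(\<Sum>i\<in>F. 2 * \<eta> * rad i) \<le> (\<Sum>(x,k) \<in> p. norm (Henstock_Kurzweil_Integration.content k *\<^sub>R f x - integral k f))"
      unfolding p_def
    proof (subst sum.reindex[OF inj], rule sum_mono)
      fix i assume "i \<in> F"
      then have "i \<in> K" using F C by auto
      then show "2 * \<eta> * rad i \<le> ((\<lambda>(x,k). norm (Henstock_Kurzweil_Integration.content k *\<^sub>R f x - integral k f)) \<circ>
            (\<lambda>i. (fst i, cball (ctr i) (rad i)))) i"
        by (cases i) (auto simp: K_def cb, auto simp: rad_def)
    qed
    also have "\<dots> < e * \<eta> / 5" by (rule hen[OF tpd fine])
    finally have "2 * \<eta> * (\<Sum>i\<in>F. rad i) < e * \<eta> / 5" by (simp add: sum_distrib_left)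
    then have "\<eta> * (10 * (\<Sum>i\<in>F. rad i)) < \<eta> * e" by (simp add: field_simps)
    then have "10 * (\<Sum>i\<in>F. rad i) < e" using \<eta> by simp
    then show ?thesis by (simp add: sum_distrib_left)
  qed
  let ?T = "\<Union>i\<in>C. cball (ctr i) (5 * rad i)"
  have rad: "rad i > 0" if "i \<in> C" for i using that C by (auto simp: K_def rad_def)
  have "?T \<in> lmeasurable \<and> measure lebesgue ?T \<le> e"
  proof (rule conjI)
    have le: "measure lebesgue (\<Union>i\<in>F. cball (ctr i) (5 * rad i)) \<le> e" if F: "finite F" "F \<subseteq> C" for F
    proof -
      have "measure lebesgue (\<Union>i\<in>F. cball (ctr i) (5 * rad i)) \<le> (\<Sum>i\<in>F. measure lebesgue (cball (ctr i) (5 * rad i)))"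
        using F by (intro measure_UNION_le) auto
      also have "\<dots> = (\<Sum>i\<in>F. 10 * rad i)"
        using F rad by (intro sum.cong) (auto simp: cball_eq_atLeastAtMost dest!: subsetD less_imp_le)
      finally show ?thesis using fin[OF F] by simp
    qed
    show "?T \<in> lmeasurable" 
      by (rule fmeasurable_UN_bound[OF C(1) _ le]) auto
    show "measure lebesgue ?T \<le> e"
      by (rule measure_UN_bound[OF C(1) _ le]) auto
  qed
  with C(4) show "\<exists>T. ?E \<subseteq> T \<and> T \<in> lmeasurable \<and> measure lebesgue T \<le> e" by blast
qed

theorem Lebesgue_differentiation:
  fixes f :: "real \<Rightarrow> real"
  assumes f: "f integrable_on {a..b}"
  shows "negligible {x \<in> {a..b}. \<not> ((\<lambda>t. integral {a..t} f) has_real_derivative f x) (at x within {a..b})}"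
proof -
  define E where "E = (\<lambda>\<eta>. {x. \<forall>\<delta>>0. \<exists>c d. a \<le> c \<and> c < d \<and> d \<le> b \<and> x \<in> {c..d} \<and> d - c < \<delta> \<and>
            \<bar>(d - c) * f x - integral {c..d} f\<bar> \<ge> \<eta> * (d - c)})"
  have "negligible (\<Union>n. E (1 / Suc n))"
    unfolding E_def by (intro negligible_Union_nat Lebesgue_differentiation_aux[OF f]) auto
  moreover have "{x \<in> {a..b}. \<not> ((\<lambda>t. integral {a..t} f) has_real_derivative f x) (at x within {a..b})}
      \<subseteq> (\<Union>n. E (1 / Suc n))"
  proof (clarsimp, rule ccontr)
    fix x assume x: "a \<le> x" "x \<le> b"
      and nd: "\<not> ((\<lambda>t. integral {a..t} f) has_real_derivative f x) (at x within {a..b})"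
      and nE: "\<not> (\<exists>n. x \<in> E (1 / (1 + real n)))"
    have "((\<lambda>t. integral {a..t} f) has_vector_derivative f x) (at x within {a..b})"
      unfolding has_vector_derivative_def has_derivative_within_alt
    proof (intro conjI allI impI bounded_linear_scaleR_left)
      fix e :: real assume "e > 0"
      then obtain n where n: "1 / (1 + real n) < e" using nat_approx_posE by (metis of_nat_Suc add.commute)
      from nE have "x \<notin> E (1 / (1 + real n))" by blast
      then obtain \<delta> where \<delta>: "\<delta> > 0"
        "\<And>c d. a \<le> c \<Longrightarrow> c < d \<Longrightarrow> d \<le> b \<Longrightarrow> x \<in> {c..d} \<Longrightarrow> d - c < \<delta> \<Longrightarrow>
            \<bar>(d - c) * f x - integral {c..d} f\<bar> < 1 / (1 + real n) * (d - c)"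
        unfolding E_def mem_Collect_eq not_all not_ex not_imp by (meson not_le)
      show "\<exists>d>0. \<forall>y\<in>{a..b}. norm (y - x) < d \<longrightarrow>
           norm (integral {a..y} f - integral {a..x} f - (y - x) *\<^sub>R f x) \<le> e * norm (y - x)"
      proof (intro exI[of _ \<delta>] conjI ballI impI \<delta>(1))
        fix y assume y: "y \<in> {a..b}" "norm (y - x) < \<delta>"
        have int: "f integrable_on {c..d}" if "a \<le> c" "d \<le> b" for c d
          using f that integrable_on_subinterval by (metis atLeastatMost_subset_iff)
        have *: "1 / (1 + real n) * \<bar>y - x\<bar> \<le> e * \<bar>y - x\<bar>" using n by (intro mult_right_mono) auto
        consider "y = x" | "x < y" | "y < x" by linarith
        then show "norm (integral {a..y} f - integral {a..x} f - (y - x) *\<^sub>R f x) \<le> e * norm (y - x)"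
        proof cases
          case 2
          have "integral {a..x} f + integral {x..y} f = integral {a..y} f"
            using x y 2 by (intro Henstock_Kurzweil_Integration.integral_combine int) auto
          with \<delta>(2)[of x y] x y 2 * show ?thesis by (auto simp: algebra_simps abs_minus_commute)
        next
          case 3
          have "integral {a..y} f + integral {y..x} f = integral {a..x} f"
            using x y 3 by (intro Henstock_Kurzweil_Integration.integral_combine int) auto
          with \<delta>(2)[of y x] x y 3 * show ?thesis by (auto simp: algebra_simps abs_minus_commute)
        qed auto
      qed
    qed
    with nd show False by (simp add: has_real_derivative_iff_has_vector_derivative)
  qed
  ultimately show ?thesis by (rule negligible_subset)
qed

section \<open>Square integrable functions and weak cluster points\<close>

definition square_integrable :: "'b measure \<Rightarrow> ('b \<Rightarrow> real) \<Rightarrow> bool" where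
  "square_integrable M f \<longleftrightarrow> f \<in> borel_measurable M \<and> integrable M (\<lambda>x. (f x)\<^sup>2)"

lemma square_integrable_measurable [measurable_dest]:
  "square_integrable M f \<Longrightarrow> f \<in> borel_measurable M"
  by (simp add: square_integrable_def)

lemma square_integrable_power2: "square_integrable M f \<Longrightarrow> integrable M (\<lambda>x. (f x)\<^sup>2)"
  by (simp add: square_integrable_def)

lemma square_integrable_bound:
  assumes "square_integrable M f" "g \<in> borel_measurable M" "AE x in M. \<bar>g x\<bar> \<le> \<bar>f x\<bar>"
  shows "square_integrable M g"
  unfolding square_integrable_def
proof
  show "integrable M (\<lambda>x. (g x)\<^sup>2)"
    by (rule Bochner_Integration.integrable_bound[OF square_integrable_power2[OF assms(1)]])
       (use assms in \<open>auto simp: power_mono_even abs_le_square_iff\<close>)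
qed fact

lemma two_mult_le_squares: "2 * \<bar>a * b\<bar> \<le> a\<^sup>2 + (b::real)\<^sup>2"
  using zero_le_power2[of "\<bar>a\<bar> - \<bar>b\<bar>"] by (simp add: power2_diff abs_mult)

lemma square_integrable_mult:
  assumes "square_integrable M f" "square_integrable M g"
  shows "integrable M (\<lambda>x. f x * g x)"
proof (rule Bochner_Integration.integrable_bound)
  show "integrable M (\<lambda>x. (f x)\<^sup>2 + (g x)\<^sup>2)"
    using assms by (auto simp: square_integrable_def)
  show "AE x in M. norm (f x * g x) \<le> norm ((f x)\<^sup>2 + (g x)\<^sup>2)"
  proof (rule AE_I2)
    fix x show "norm (f x * g x) \<le> norm ((f x)\<^sup>2 + (g x)\<^sup>2)"
      using two_mult_le_squares[of "f x" "g x"] abs_ge_zero[of "f x * g x"] by (simp add: abs_of_nonneg)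
  qed
qed (use assms in measurable)

lemma square_integrable_add:
  assumes "square_integrable M f" "square_integrable M g"
  shows "square_integrable M (\<lambda>x. f x + g x)"
proof -
  have "(f x + g x)\<^sup>2 = (f x)\<^sup>2 + 2 * (f x * g x) + (g x)\<^sup>2" for x by (simp add: power2_sum)
  with assms square_integrable_mult[OF assms] show ?thesis
    by (simp add: square_integrable_def borel_measurable_add)
qed

lemma square_integrable_cmult:
  "square_integrable M f \<Longrightarrow> square_integrable M (\<lambda>x. c * f x)"
  by (auto simp: square_integrable_def power_mult_distrib)

lemma square_integrable_diff:
  assumes "square_integrable M f" "square_integrable M g"
  shows "square_integrable M (\<lambda>x. f x - g x)"
  using square_integrable_add[OF assms(1) square_integrable_cmult[OF assms(2), of "-1"]] by simp

lemma (in finite_measure) square_integrable_integrable: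
  assumes "square_integrable M f" shows "integrable M f"
  using square_integrable_mult[OF assms, of "\<lambda>_. 1"] by (simp add: square_integrable_def)

lemma (in finite_measure) square_integrable_bounded:
  assumes "g \<in> borel_measurable M" "\<And>x. \<bar>g x\<bar> \<le> K"
  shows "square_integrable M g"
proof (rule square_integrable_bound[of M "\<lambda>_. K"])
  show "AE x in M. \<bar>g x\<bar> \<le> \<bar>K\<bar>"
    using assms(2) by (intro AE_I2) (auto intro: order_trans[OF _ abs_ge_self])
qed (use assms(1) in \<open>simp_all add: square_integrable_def\<close>)

lemma integral_mult_le_Young:
  assumes "square_integrable M f" "square_integrable M g" "c > (0::real)"
  shows "\<bar>\<integral>x. f x * g x \<partial>M\<bar> \<le> (c * (\<integral>x. (f x)\<^sup>2 \<partial>M) + (\<integral>x. (g x)\<^sup>2 \<partial>M) / c) / 2"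
proof -
  have "\<bar>\<integral>x. f x * g x \<partial>M\<bar> \<le> (\<integral>x. \<bar>f x * g x\<bar> \<partial>M)" by (rule integral_abs_bound)
  also have "\<dots> \<le> (\<integral>x. (c * (f x)\<^sup>2 + (g x)\<^sup>2 / c) / 2 \<partial>M)"
  proof (rule integral_mono)
    show "integrable M (\<lambda>x. \<bar>f x * g x\<bar>)"
      using square_integrable_mult[OF assms(1,2)] by simp
    show "integrable M (\<lambda>x. (c * (f x)\<^sup>2 + (g x)\<^sup>2 / c) / 2)"
      using assms by (auto simp: square_integrable_def)
    fix x
    have "2 * \<bar>(sqrt c * f x) * (g x / sqrt c)\<bar> \<le> (sqrt c * f x)\<^sup>2 + (g x / sqrt c)\<^sup>2"
      by (rule two_mult_le_squares)
    then show "\<bar>f x * g x\<bar> \<le> (c * (f x)\<^sup>2 + (g x)\<^sup>2 / c) / 2"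
      using assms(3) by (simp add: power_mult_distrib power_divide)
  qed
  also have "\<dots> = (c * (\<integral>x. (f x)\<^sup>2 \<partial>M) + (\<integral>x. (g x)\<^sup>2 \<partial>M) / c) / 2"
    using assms by (simp add: square_integrable_def)
  finally show ?thesis .
qed

text \<open>
  A subsequence with rapidly decreasing increments converges almost everywhere, and Fatou's lemma
  transfers the Cauchy estimate to the limit.
\<close>
proposition (in finite_measure) square_integrable_complete:
  fixes x :: "nat \<Rightarrow> 'a \<Rightarrow> real"
  assumes x: "\<And>k. square_integrable M (x k)"
    and cauchy: "\<And>e. e > 0 \<Longrightarrow> \<exists>N. \<forall>k\<ge>N. \<forall>j\<ge>k. (\<integral>t. (x j t - x k t)\<^sup>2 \<partial>M) \<le> e"
  obtains f where "square_integrable M f" "(\<lambda>k. \<integral>t. (x k t - f t)\<^sup>2 \<partial>M) \<longlonglongrightarrow> 0"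
proof -
  have [measurable]: "x k \<in> borel_measurable M" for k using x by (simp add: square_integrable_def)
  have "\<exists>N. \<forall>k\<ge>N. \<forall>j\<ge>k. (\<integral>t. (x j t - x k t)\<^sup>2 \<partial>M) \<le> (1/4)^i" for i
    by (rule cauchy) simp
  then obtain N where N: "\<And>i k j. k \<ge> N i \<Longrightarrow> j \<ge> k \<Longrightarrow> (\<integral>t. (x j t - x k t)\<^sup>2 \<partial>M) \<le> (1/4)^i"
    by metis
  define r where "r i = (\<Sum>l\<le>i. N l) + i" for i
  have rS: "r i < r (Suc i)" for i by (simp add: r_def)
  then have r: "strict_mono r" by (simp add: strict_mono_Suc_iff)
  have rN: "r i \<ge> N i" for i
    unfolding r_def by (meson atMost_iff finite_atMost le_add1 le_trans member_le_sum order_refl zero_le)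
  define y where "y i = x (r i)" for i
  have y: "square_integrable M (y i)" for i using x by (simp add: y_def)
  have [measurable]: "y i \<in> borel_measurable M" for i by (simp add: y_def)
  define \<mu> where "\<mu> = measure M (space M)"
  have yint: "integrable M (\<lambda>t. \<bar>y (Suc i) t - y i t\<bar>)" for i
    by (intro integrable_abs square_integrable_integrable square_integrable_diff y)
  have step: "(\<integral>\<^sup>+t. ennreal \<bar>y (Suc i) t - y i t\<bar> \<partial>M) \<le> ennreal ((1 + \<mu>) * (1/2)^i)" for i
  proof -
    \<comment> \<open>Young's inequality with weight \<open>2^i\<close> balances the squared norm, at most \<open>(1/4)^i\<close>, against a constant.\<close>
    have "(\<integral>t. \<bar>y (Suc i) t - y i t\<bar> \<partial>M) \<le> (\<integral>t. 2^i * (y (Suc i) t - y i t)\<^sup>2 + (1/2)^i \<partial>M)"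
    proof (rule integral_mono)
      show "integrable M (\<lambda>t. 2^i * (y (Suc i) t - y i t)\<^sup>2 + (1/2)^i)"
        using square_integrable_power2[OF square_integrable_diff[OF y y]] by simp
      fix t 
      let ?d = "\<bar>y (Suc i) t - y i t\<bar>"
      have "2 * \<bar>(2^i * ?d) * 1\<bar> \<le> (2^i * ?d)\<^sup>2 + 1\<^sup>2" by (rule two_mult_le_squares)
      moreover have "0 \<le> 2^i * ?d" by simp
      ultimately have "2^i * ?d \<le> (2^i * ?d)\<^sup>2 + 1" by (simp only: mult_1_right abs_of_nonneg one_power2)
      also have "\<dots> = 2^i * (2^i * ?d\<^sup>2 + (1/2)^i)"
        by (simp add: power_mult_distrib power2_eq_square algebra_simps power_one_over)
      finally show "?d \<le> 2^i * (y (Suc i) t - y i t)\<^sup>2 + (1/2)^i" by simp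
    qed (rule yint)
    also have "\<dots> = 2^i * (\<integral>t. (y (Suc i) t - y i t)\<^sup>2 \<partial>M) + \<mu> * (1/2)^i"
      using square_integrable_power2[OF square_integrable_diff[OF y y]] by (simp add: \<mu>_def)
    also have "\<dots> \<le> 2^i * (1/4)^i + \<mu> * (1/2)^i"
      using N[OF rN[of i], of "r (Suc i)"] rS[of i] by (simp add: y_def)
    also have "\<dots> = (1 + \<mu>) * (1/2)^i"
      by (simp add: algebra_simps flip: power_mult_distrib)
    finally have "(\<integral>t. \<bar>y (Suc i) t - y i t\<bar> \<partial>M) \<le> (1 + \<mu>) * (1/2)^i" .
    then show ?thesis
      by (subst nn_integral_eq_integral[OF yint]) (auto intro: ennreal_leI)
  qed
  have sm: "(\<lambda>i. (1 + \<mu>) * (1/2)^i) sums ((1 + \<mu>) * 2)"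
    using sums_mult[OF geometric_sums[of "1/2::real"], of "1 + \<mu>"] by simp
  have "(\<integral>\<^sup>+t. (\<Sum>i. ennreal \<bar>y (Suc i) t - y i t\<bar>) \<partial>M) = (\<Sum>i. \<integral>\<^sup>+t. ennreal \<bar>y (Suc i) t - y i t\<bar> \<partial>M)"
    by (rule nn_integral_suminf) measurable
  also have "\<dots> \<le> (\<Sum>i. ennreal ((1 + \<mu>) * (1/2)^i))" by (intro suminf_le step) auto
  also have "\<dots> = ennreal ((1 + \<mu>) * 2)"
    by (rule suminf_ennreal_eq[OF _ sm]) (simp add: \<mu>_def)
  also have "\<dots> < \<infinity>" by simp
  finally have "AE t in M. (\<Sum>i. ennreal \<bar>y (Suc i) t - y i t\<bar>) \<noteq> \<infinity>"
    by (intro nn_integral_PInf_AE) auto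
  then have AEc: "AE t in M. convergent (\<lambda>i. y i t)"
  proof (rule AE_mp, intro AE_I2 impI)
    fix t assume "(\<Sum>i. ennreal \<bar>y (Suc i) t - y i t\<bar>) \<noteq> \<infinity>"
    then have "summable (\<lambda>i. \<bar>y (Suc i) t - y i t\<bar>)"
      by (intro summable_suminf_not_top) (auto simp: infinity_ennreal_def)
    then have "summable (\<lambda>i. y (Suc i) t - y i t)" by (rule summable_rabs_cancel)
    then have "convergent (\<lambda>n. \<Sum>i<n. (y (Suc i) t - y i t))" by (simp add: summable_iff_convergent)
    then have "convergent (\<lambda>n. y n t - y 0 t)" by (simp add: sum_lessThan_telescope[of "\<lambda>i. y i t"])
    then show "convergent (\<lambda>i. y i t)" by (simp add: convergent_diff_const_right_iff)
  qed
  define f where "f t = lim (\<lambda>i. y i t)" for t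
  have [measurable]: "f \<in> borel_measurable M" unfolding f_def by measurable
  have AEl: "AE t in M. (\<lambda>i. y i t) \<longlonglongrightarrow> f t"
    using AEc by eventually_elim (simp add: f_def convergent_LIMSEQ_iff)
  have dist: "(\<integral>\<^sup>+t. ennreal ((x k t - f t)\<^sup>2) \<partial>M) \<le> ennreal e"
    if k: "\<forall>j\<ge>k. (\<integral>t. (x j t - x k t)\<^sup>2 \<partial>M) \<le> e" for k e
  proof -
    have "(\<integral>\<^sup>+t. ennreal ((x k t - f t)\<^sup>2) \<partial>M) = (\<integral>\<^sup>+t. liminf (\<lambda>j. ennreal ((y j t - x k t)\<^sup>2)) \<partial>M)"
    proof (rule nn_integral_cong_AE)
      show "AE t in M. ennreal ((x k t - f t)\<^sup>2) = liminf (\<lambda>j. ennreal ((y j t - x k t)\<^sup>2))"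
        using AEl
      proof eventually_elim
        case (elim t)
        then have "(\<lambda>j. ennreal ((y j t - x k t)\<^sup>2)) \<longlonglongrightarrow> ennreal ((f t - x k t)\<^sup>2)"
          by (intro tendsto_ennrealI tendsto_intros)
        from lim_imp_Liminf[OF _ this] show ?case by (simp add: power2_commute)
      qed
    qed
    also have "\<dots> \<le> liminf (\<lambda>j. \<integral>\<^sup>+t. ennreal ((y j t - x k t)\<^sup>2) \<partial>M)"
      by (rule nn_integral_liminf) measurable
    also have "\<dots> \<le> ennreal e"
    proof (rule order_trans[OF Liminf_le_Limsup Limsup_bounded], simp, rule eventually_mono[OF eventually_ge_at_top[of k]])
      fix j assume "j \<ge> k"
      then have "r j \<ge> k" using seq_suble[OF r, of j] by linarith
      then show "(\<integral>\<^sup>+t. ennreal ((y j t - x k t)\<^sup>2) \<partial>M) \<le> ennreal e"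
        unfolding y_def using k
        by (subst nn_integral_eq_integral[OF square_integrable_power2[OF square_integrable_diff[OF x x]]])
           (auto intro: ennreal_leI)
    qed
    finally show ?thesis .
  qed
  have f: "square_integrable M f"
  proof -
    obtain k where "\<forall>j\<ge>k. (\<integral>t. (x j t - x k t)\<^sup>2 \<partial>M) \<le> 1" using cauchy[of 1] by auto
    from dist[OF this] have "integrable M (\<lambda>t. (x k t - f t)\<^sup>2)"
      by (intro integrableI_bounded) (auto simp: le_less_trans[OF _ ennreal_one_less_top])
    then have "square_integrable M (\<lambda>t. x k t - f t)" by (simp add: square_integrable_def)
    from square_integrable_diff[OF x[of k] this] show ?thesis by simp
  qed
  moreover have "(\<lambda>k. \<integral>t. (x k t - f t)\<^sup>2 \<partial>M) \<longlonglongrightarrow> 0"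
  proof (rule LIMSEQ_I)
    fix e :: real assume "e > 0"
    then obtain K where K: "\<forall>k\<ge>K. \<forall>j\<ge>k. (\<integral>t. (x j t - x k t)\<^sup>2 \<partial>M) \<le> e / 2"
      using cauchy[of "e / 2"] by auto
    have "norm ((\<integral>t. (x k t - f t)\<^sup>2 \<partial>M) - 0) < e" if "k \<ge> K" for k
    proof -
      from K that have "(\<integral>\<^sup>+t. ennreal ((x k t - f t)\<^sup>2) \<partial>M) \<le> ennreal (e / 2)"
        by (intro dist) auto
      then have "(\<integral>t. (x k t - f t)\<^sup>2 \<partial>M) \<le> e / 2"
        using \<open>e > 0\<close>
        by (subst (asm) nn_integral_eq_integral[OF square_integrable_power2[OF square_integrable_diff[OF x f]]]) auto
      with \<open>e > 0\<close> show ?thesis by simp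
    qed
    then show "\<exists>K. \<forall>k\<ge>K. norm ((\<integral>t. (x k t - f t)\<^sup>2 \<partial>M) - 0) < e" by blast
  qed
  ultimately show ?thesis by (rule that)
qed


text \<open>
  Closure under midpoints replaces the convex hull of the tail: it suffices for the parallelogram
  identity.
\<close>
inductive_set midpoint_hull :: "(nat \<Rightarrow> 'b \<Rightarrow> real) \<Rightarrow> nat \<Rightarrow> ('b \<Rightarrow> real) set"
  for f k where
  member: "n \<ge> k \<Longrightarrow> f n \<in> midpoint_hull f k"
| midpoint: "x \<in> midpoint_hull f k \<Longrightarrow> y \<in> midpoint_hull f k \<Longrightarrow>
    (\<lambda>t. (x t + y t) / 2) \<in> midpoint_hull f k"

lemma midpoint_hull_antimono:
  assumes "k \<le> l" shows "midpoint_hull f l \<subseteq> midpoint_hull f k"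
proof
  fix x assume "x \<in> midpoint_hull f l"
  then show "x \<in> midpoint_hull f k"
    by induction (use assms in \<open>auto intro: midpoint_hull.intros\<close>)
qed

lemma square_integrable_midpoint:
  "square_integrable M x \<Longrightarrow> square_integrable M y \<Longrightarrow> square_integrable M (\<lambda>t. (x t + y t) / 2)"
  using square_integrable_cmult[OF square_integrable_add, of M x y "1/2"] by simp

lemma parallelogram_integral:
  assumes "square_integrable M x" "square_integrable M y"
  shows "(\<integral>t. ((x t + y t) / 2)\<^sup>2 \<partial>M) =
    ((\<integral>t. (x t)\<^sup>2 \<partial>M) + (\<integral>t. (y t)\<^sup>2 \<partial>M)) / 2 - (\<integral>t. (y t - x t)\<^sup>2 \<partial>M) / 4"
proof -
  have "((x t + y t) / 2)\<^sup>2 = ((x t)\<^sup>2 + (y t)\<^sup>2) / 2 - (y t - x t)\<^sup>2 / 4" for t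
    by (simp add: field_simps power2_eq_square)
  then show ?thesis
    using assms square_integrable_diff[OF assms(2,1)] by (simp add: square_integrable_def)
qed

text \<open>
  The infima of the norms on the midpoint hulls of the tails increase and are bounded. By the parallelogram
  identity, elements \<open>x k\<close> of almost minimal norm form a Cauchy sequence, and \<open>m\<close> is its limit. An
  eventual lower bound on the pairings with \<open>g\<close> holds for the midpoints of a tail and hence for \<open>m\<close>.
  Lower bounds for all \<open>g\<close> include upper bounds, by passing to \<open>-g\<close>. In this form the convex
  combinations do not show in applications.
\<close>
theorem (in finite_measure) square_integrable_weak_cluster:
  fixes f :: "nat \<Rightarrow> 'a \<Rightarrow> real"
  assumes f: "\<And>n. square_integrable M (f n)" and bd: "\<And>n. (\<integral>t. (f n t)\<^sup>2 \<partial>M) \<le> C"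
  obtains m where "square_integrable M m"
    "\<And>g c. square_integrable M g \<Longrightarrow> \<forall>\<^sub>F n in sequentially. c \<le> (\<integral>t. f n t * g t \<partial>M) \<Longrightarrow>
        c \<le> (\<integral>t. m t * g t \<partial>M)"
proof -
  define N where "N x = (\<integral>t. (x t)\<^sup>2 \<partial>M)" for x :: "'a \<Rightarrow> real"
  have N0: "N x \<ge> 0" for x unfolding N_def by simp
  have hull: "square_integrable M x \<and> N x \<le> C" if "x \<in> midpoint_hull f k" for x k
    using that
  proof induction
    case (member n) then show ?case using f bd by (simp add: N_def)
  next
    case (midpoint x y)
    then have "N (\<lambda>t. (x t + y t) / 2) = (N x + N y) / 2 - N (\<lambda>t. y t - x t) / 4"
      unfolding N_def by (intro parallelogram_integral) auto
    with N0[of "\<lambda>t. y t - x t"] have "N (\<lambda>t. (x t + y t) / 2) \<le> (N x + N y) / 2" by linarith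
    with midpoint show ?case by (auto intro: square_integrable_midpoint)
  qed
  have below: "bdd_below (N ` midpoint_hull f k)" for k
    using N0 by (intro bdd_belowI[of _ 0]) auto
  have ne: "midpoint_hull f k \<noteq> {}" for k using midpoint_hull.member[of k k f] by auto
  define I where "I k = Inf (N ` midpoint_hull f k)" for k
  have Ile: "I k \<le> N x" if "x \<in> midpoint_hull f k" for k x
    unfolding I_def using that below by (auto intro: cInf_lower)
  have "mono I" unfolding I_def
    by (intro monoI cInf_superset_mono image_mono midpoint_hull_antimono below) (use ne in auto)
  have IC: "I k \<le> C" for k
    using Ile[OF midpoint_hull.member[of k k f]] hull[OF midpoint_hull.member[of k k f]] by auto
  obtain J where J: "I \<longlonglongrightarrow> J" and IJ: "\<And>k. I k \<le> J"
    using incseq_convergent[OF \<open>mono I\<close>, of C] IC by blast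
  have "\<exists>x\<in>midpoint_hull f k. N x < I k + 1 / Suc k" for k
    using cInf_lessD[of "N ` midpoint_hull f k" "I k + 1 / Suc k"] ne by (auto simp: I_def)
  then obtain x where x: "\<And>k. x k \<in> midpoint_hull f k" "\<And>k. N (x k) < I k + 1 / Suc k" by metis
  have sx: "square_integrable M (x k)" for k using hull x(1) by blast
  have gap: "N (\<lambda>t. x j t - x k t) \<le> 2 * (J - I k) + 4 / Suc k" if "k \<le> j" for j k
  proof -
    have "x j \<in> midpoint_hull f k" using x(1)[of j] midpoint_hull_antimono[OF that, of f] by auto
    then have "I k \<le> N (\<lambda>t. (x k t + x j t) / 2)" by (intro Ile midpoint_hull.midpoint x(1))
    also have "\<dots> = (N (x k) + N (x j)) / 2 - N (\<lambda>t. x j t - x k t) / 4"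
      unfolding N_def by (rule parallelogram_integral[OF sx sx])
    finally have "N (\<lambda>t. x j t - x k t) \<le> 2 * (N (x k) + N (x j)) - 4 * I k" by argo
    moreover have "1 / real (Suc j) \<le> 1 / Suc k" using that by (simp add: frac_le)
    ultimately show ?thesis using x(2)[of k] x(2)[of j] IJ[of j] by simp
  qed
  have "(\<lambda>k. 2 * (J - I k) + 4 / Suc k) \<longlonglongrightarrow> 2 * (J - J) + 0"
    by (intro tendsto_intros J LIMSEQ_Suc[OF lim_const_over_n])
  then have lim0: "(\<lambda>k. 2 * (J - I k) + 4 / Suc k) \<longlonglongrightarrow> 0" by simp
  obtain m where m: "square_integrable M m" "(\<lambda>k. \<integral>t. (x k t - m t)\<^sup>2 \<partial>M) \<longlonglongrightarrow> 0"
  proof (rule square_integrable_complete[OF sx])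
    fix e :: real assume "e > 0"
    with order_tendstoD(2)[OF lim0] obtain K where "\<And>k. k \<ge> K \<Longrightarrow> 2 * (J - I k) + 4 / Suc k < e"
      by (auto simp: eventually_sequentially)
    with gap show "\<exists>N. \<forall>k\<ge>N. \<forall>j\<ge>k. (\<integral>t. (x j t - x k t)\<^sup>2 \<partial>M) \<le> e"
      unfolding N_def by (meson less_imp_le order_trans)
  qed
  show ?thesis
  proof (rule that[OF m(1)])
    fix g c assume g: "square_integrable M g" and ev: "\<forall>\<^sub>F n in sequentially. c \<le> (\<integral>t. f n t * g t \<partial>M)"
    then obtain K where K: "\<And>n. n \<ge> K \<Longrightarrow> c \<le> (\<integral>t. f n t * g t \<partial>M)"
      by (auto simp: eventually_sequentially)
    have ge: "c \<le> (\<integral>t. z t * g t \<partial>M)" if "z \<in> midpoint_hull f K" for z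
      using that
    proof induction
      case (member n) then show ?case by (rule K)
    next
      case (midpoint z y)
      then have "integrable M (\<lambda>t. z t * g t)" "integrable M (\<lambda>t. y t * g t)"
        using hull g by (blast intro: square_integrable_mult)+
      moreover have "(z t + y t) / 2 * g t = (z t * g t + y t * g t) / 2" for t
        by (simp add: field_simps)
      ultimately show ?case using midpoint by simp
    qed
    define G where "G = (\<integral>t. (g t)\<^sup>2 \<partial>M)"
    have G0: "G \<ge> 0" by (simp add: G_def)
    have "c \<le> (\<integral>t. m t * g t \<partial>M) + e" if e: "e > 0" for e
    proof -
      define b where "b = (G + 1) / e"
      have b: "b > 0" "G / b \<le> e" using e G0 by (auto simp: b_def field_simps)
      have "(\<lambda>k. (\<integral>t. m t * g t \<partial>M) + (b * (\<integral>t. (x k t - m t)\<^sup>2 \<partial>M) + G / b) / 2)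
          \<longlonglongrightarrow> (\<integral>t. m t * g t \<partial>M) + (b * 0 + G / b) / 2"
        by (intro tendsto_intros m) simp
      moreover have "c \<le> (\<integral>t. m t * g t \<partial>M) + (b * (\<integral>t. (x k t - m t)\<^sup>2 \<partial>M) + G / b) / 2"
        if "k \<ge> K" for k
      proof -
        have "c \<le> (\<integral>t. x k t * g t \<partial>M)"
          using x(1)[of k] midpoint_hull_antimono[OF that, of f] by (intro ge) auto
        also have "\<dots> = (\<integral>t. m t * g t \<partial>M) + (\<integral>t. (x k t - m t) * g t \<partial>M)"
          using square_integrable_mult[OF sx g] square_integrable_mult[OF m(1) g]
          by (simp add: left_diff_distrib)
        also have "\<dots> \<le> (\<integral>t. m t * g t \<partial>M) + (b * (\<integral>t. (x k t - m t)\<^sup>2 \<partial>M) + G / b) / 2"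
          using integral_mult_le_Young[OF square_integrable_diff[OF sx m(1)] g b(1), of k]
          by (simp add: G_def)
        finally show ?thesis by simp
      qed
      ultimately have "c \<le> (\<integral>t. m t * g t \<partial>M) + (b * 0 + G / b) / 2"
        by (meson LIMSEQ_le_const)
      moreover have "G / b / 2 \<le> e" using b e G0 by simp
      ultimately show ?thesis by simp
    qed
    then show "c \<le> (\<integral>t. m t * g t \<partial>M)" by (rule field_le_epsilon)
  qed
qed

section \<open>Absolutely continuous real functions\<close>

lemma integrable_lebesgue_on_subinterval:
  fixes f :: "real \<Rightarrow> real"
  assumes f: "integrable (lebesgue_on {a..b}) f" and st: "a \<le> s" "t \<le> b"
  shows "integrable (lebesgue_on {s..t}) f" "f integrable_on {s..t}"
    "(LINT x|lebesgue_on {s..t}. f x) = integral {s..t} f"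
    "(LINT x|lebesgue_on {a..b}. f x * indicator {s..t} x) = integral {s..t} f"
proof -
  have "set_integrable lebesgue {a..b} f"
    using f by (simp add: set_integrable_def integrable_restrict_space)
  then have "set_integrable lebesgue {s..t} f"
    by (rule set_integrable_subset) (use st in auto)
  then show 1: "integrable (lebesgue_on {s..t}) f"
    by (simp add: set_integrable_def integrable_restrict_space)
  then show "f integrable_on {s..t}" by (rule integrable_on_lebesgue_on) simp
  show 2: "(LINT x|lebesgue_on {s..t}. f x) = integral {s..t} f"
    by (rule lebesgue_integral_eq_integral[OF 1]) simp
  have "(LINT x|lebesgue_on {a..b}. f x * indicator {s..t} x) = (LINT x|lebesgue. indicator {s..t} x *\<^sub>R f x)"
    by (subst integral_restrict_space)
       (use st in \<open>auto intro!: Bochner_Integration.integral_cong simp: indicator_def\<close>)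
  also have "\<dots> = (LINT x|lebesgue_on {s..t}. f x)" by (simp add: integral_restrict_space)
  finally show "(LINT x|lebesgue_on {a..b}. f x * indicator {s..t} x) = integral {s..t} f"
    using 2 by simp
qed

lemma finite_measure_interval: "finite_measure (lebesgue_on {a..b::real})"
  by (rule finite_measure_lebesgue_on) simp

lemmas square_integrable_interval_integrable =
  finite_measure.square_integrable_integrable[OF finite_measure_interval]

lemma square_integrable_subinterval:
  fixes f :: "real \<Rightarrow> real"
  assumes "square_integrable (lebesgue_on {a..b}) f" "a \<le> s" "t \<le> b"
  shows "square_integrable (lebesgue_on {s..t}) f"
proof -
  have "integrable (lebesgue_on {s..t}) f"
    using assms square_integrable_interval_integrable integrable_lebesgue_on_subinterval(1) by blast
  moreover have "integrable (lebesgue_on {s..t}) (\<lambda>x. (f x)\<^sup>2)"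
    using assms square_integrable_power2 integrable_lebesgue_on_subinterval(1) by blast
  ultimately show ?thesis by (simp add: square_integrable_def)
qed

lemma integral_interval_Cauchy_Schwarz:
  fixes m :: "real \<Rightarrow> real"
  assumes m: "square_integrable (lebesgue_on {s..t}) m"
  shows "(integral {s..t} m)\<^sup>2 \<le> (t - s) * integral {s..t} (\<lambda>x. (m x)\<^sup>2)"
proof (cases "s < t")
  case True
  have i: "m integrable_on {s..t}" "(\<lambda>x. (m x)\<^sup>2) integrable_on {s..t}"
    using integrable_lebesgue_on_subinterval(2)[OF square_integrable_interval_integrable[OF m]]
      integrable_lebesgue_on_subinterval(2)[OF square_integrable_power2[OF m]] by auto
  define k where "k = integral {s..t} m / (t - s)"
  have i3: "(\<lambda>x. 2 * k * m x) integrable_on {s..t}" using integrable_cmul[OF i(1), of "2 * k"] by simp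
  have "0 \<le> integral {s..t} (\<lambda>x. ((m x)\<^sup>2 - 2 * k * m x) + k\<^sup>2)"
  proof (rule integral_nonneg)
    show "(\<lambda>x. ((m x)\<^sup>2 - 2 * k * m x) + k\<^sup>2) integrable_on {s..t}"
      using i i3 by (intro integrable_add integrable_diff) auto
    show "0 \<le> ((m x)\<^sup>2 - 2 * k * m x) + k\<^sup>2" for x
      using zero_le_power2[of "m x - k"] by (simp add: power2_diff algebra_simps)
  qed
  also have "\<dots> = integral {s..t} (\<lambda>x. (m x)\<^sup>2) - 2 * k * integral {s..t} m + k\<^sup>2 * (t - s)"
    using i i3 True
    by (subst Henstock_Kurzweil_Integration.integral_add)
       (auto simp: Henstock_Kurzweil_Integration.integral_diff integrable_diff)
  also have "\<dots> = integral {s..t} (\<lambda>x. (m x)\<^sup>2) - (integral {s..t} m)\<^sup>2 / (t - s)"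
  proof -
    have "k\<^sup>2 * (t - s) = k * integral {s..t} m" "(integral {s..t} m)\<^sup>2 / (t - s) = k * integral {s..t} m"
      using True by (simp_all add: k_def power2_eq_square)
    then show ?thesis by simp
  qed
  finally show ?thesis using True by (simp add: field_simps)
next
  case False
  then have "integral {s..t} f = 0" for f :: "real \<Rightarrow> real"
    by (cases "s = t") auto
  then show ?thesis by simp
qed

lemma integral_shift_difference:
  fixes f :: "real \<Rightarrow> real"
  assumes f: "continuous_on {a..b + 1} f" and st: "a \<le> s" "s \<le> t" "t \<le> b" and h: "0 \<le> h" "h \<le> 1"
  shows "integral {s..t} (\<lambda>x. f (x + h) - f x) = integral {t..t + h} f - integral {s..s + h} f"
proof -
  have fi: "f integrable_on {c..d}" if "a \<le> c" "d \<le> b + 1" for c d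
    using f that by (intro integrable_continuous_real continuous_on_subset[OF f]) auto
  have "continuous_on {s..t} (\<lambda>x. f (x + h))"
    using st h by (intro continuous_on_compose2[OF f] continuous_intros) auto
  then have "integral {s..t} (\<lambda>x. f (x + h) - f x) = integral {s..t} (f \<circ> (\<lambda>x. x + h)) - integral {s..t} f"
    unfolding o_def by (intro integral_diff fi integrable_continuous_real) (use st in auto)
  also have "integral {s..t} (f \<circ> (\<lambda>x. x + h)) = integral {s + h..t + h} f"
    by (rule integral_shift) (use st h in \<open>auto intro: continuous_on_subset[OF f]\<close>)
  finally have 1: "integral {s..t} (\<lambda>x. f (x + h) - f x) = integral {s + h..t + h} f - integral {s..t} f" .
  have "integral {s..s + h} f + integral {s + h..t + h} f = integral {s..t + h} f"
    "integral {s..t} f + integral {t..t + h} f = integral {s..t + h} f"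
    using st h by (auto intro!: Henstock_Kurzweil_Integration.integral_combine fi)
  with 1 show ?thesis by simp
qed

lemma averages_tendsto:
  fixes f :: "real \<Rightarrow> real"
  assumes f: "continuous_on {t..t + 1} f"
  shows "(\<lambda>n. integral {t..t + 1 / Suc n} f / (1 / Suc n)) \<longlonglongrightarrow> f t"
proof -
  have "((\<lambda>x. integral {t..x} f) has_real_derivative f t) (at t within {t..t + 1})"
    by (rule integral_has_real_derivative[OF f]) simp
  then have "((\<lambda>y. (integral {t..y} f - integral {t..t} f) / (y - t)) \<longlongrightarrow> f t) (at t within {t..t + 1})"
    by (simp add: has_field_derivative_iff)
  moreover have "filterlim (\<lambda>n. t + 1 / Suc n) (at t within {t..t + 1}) sequentially"
    unfolding filterlim_at
  proof (intro conjI)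
    show "\<forall>\<^sub>F n in sequentially. t + 1 / Suc n \<in> {t..t + 1} \<and> t + 1 / Suc n \<noteq> t"
      by (auto simp: field_simps)
    have "(\<lambda>n. t + 1 / Suc n) \<longlonglongrightarrow> t + 0"
      by (intro tendsto_intros LIMSEQ_Suc[OF lim_const_over_n])
    then show "(\<lambda>n. t + 1 / Suc n) \<longlonglongrightarrow> t" by simp
  qed
  ultimately have "(\<lambda>n. (integral {t..t + 1 / Suc n} f - integral {t..t} f) / (t + 1 / Suc n - t)) \<longlonglongrightarrow> f t"
    by (rule filterlim_compose)
  then show ?thesis by simp
qed

text \<open>
  The squares of the difference quotients of \<open>\<psi>\<close> with step \<open>h\<close> are at most the difference quotients of
  \<open>G t = \<integral>m\<^sup>2\<close>, whose integrals telescope, so they are bounded in \<open>L\<^sup>2\<close>. Their integrals over \<open>{s..t}\<close> are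
  differences of averages of \<open>\<psi>\<close> near \<open>t\<close> and \<open>s\<close> and tend to \<open>\<psi> t - \<psi> s\<close>. A weak cluster point is
  therefore a density of \<open>\<psi>\<close>.
\<close>
theorem absolutely_continuous_eq_integral:
  fixes \<psi> m :: "real \<Rightarrow> real"
  assumes m: "square_integrable (lebesgue_on {a..b}) m"
    and bd: "\<And>s t. a \<le> s \<Longrightarrow> s \<le> t \<Longrightarrow> t \<le> b \<Longrightarrow> \<bar>\<psi> t - \<psi> s\<bar> \<le> integral {s..t} m"
  obtains q where "square_integrable (lebesgue_on {a..b}) q"
    "\<And>s t. a \<le> s \<Longrightarrow> s \<le> t \<Longrightarrow> t \<le> b \<Longrightarrow> \<psi> t - \<psi> s = integral {s..t} q"
proof -
  interpret finite_measure "lebesgue_on {a..b}" by (rule finite_measure_interval)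
  have mi: "m integrable_on {s..t}" and m2i: "(\<lambda>x. (m x)\<^sup>2) integrable_on {s..t}"
    if "a \<le> s" "t \<le> b" for s t
    using integrable_lebesgue_on_subinterval(2)[OF square_integrable_integrable[OF m] that]
      integrable_lebesgue_on_subinterval(2)[OF square_integrable_power2[OF m] that] by auto
  define G where "G t = integral {a..t} (\<lambda>x. (m x)\<^sup>2)" for t
  have G: "integral {s..t} (\<lambda>x. (m x)\<^sup>2) = G t - G s" if "a \<le> s" "s \<le> t" "t \<le> b" for s t
    using Henstock_Kurzweil_Integration.integral_combine[OF that(1,2) m2i[OF _ that(3)]] by (simp add: G_def)
  have Gmono: "G s \<le> G t" if "a \<le> s" "s \<le> t" "t \<le> b" for s t
    using G[OF that] Henstock_Kurzweil_Integration.integral_nonneg[OF m2i[of s t]] that by auto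
  have G0: "G t \<ge> 0" if "a \<le> t" "t \<le> b" for t
    using Gmono[of a t] that by (simp add: G_def)
  have Gc: "continuous_on {a..b} G"
    unfolding G_def by (rule indefinite_integral_continuous_1[OF m2i]) auto
  have Ic: "continuous_on {a..b} (\<lambda>t. integral {a..t} m)"
    by (rule indefinite_integral_continuous_1[OF mi]) auto
  have \<psi>I: "\<bar>\<psi> t - \<psi> s\<bar> \<le> \<bar>integral {a..t} m - integral {a..s} m\<bar>" if "s \<in> {a..b}" "t \<in> {a..b}" for s t
    using that
  proof (induction s t rule: linorder_wlog)
    case (le s t)
    then have "integral {a..s} m + integral {s..t} m = integral {a..t} m"
      by (intro Henstock_Kurzweil_Integration.integral_combine mi) auto
    then show ?case using bd[of s t] le by auto
  qed (simp add: abs_minus_commute)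
  have \<psi>c: "continuous_on {a..b} \<psi>"
    unfolding continuous_on_iff
  proof (intro ballI allI impI)
    fix x e :: real assume "x \<in> {a..b}" "e > 0"
    with Ic obtain d where "d > 0" and d: "\<And>y. y \<in> {a..b} \<Longrightarrow> dist y x < d \<Longrightarrow>
        dist (integral {a..y} m) (integral {a..x} m) < e"
      unfolding continuous_on_iff by meson
    then show "\<exists>d>0. \<forall>y\<in>{a..b}. dist y x < d \<longrightarrow> dist (\<psi> y) (\<psi> x) < e"
      using \<psi>I[OF \<open>x \<in> {a..b}\<close>] unfolding dist_real_def by (meson le_less_trans)
  qed
  show ?thesis
  proof (cases "a \<le> b")
    case False
    show ?thesis by (rule that[of m]) (use m False in auto)
  next
    case ab: True
    \<comment> \<open>Composition with \<open>min b\<close> extends a function by its value at \<open>b\<close>, so that steps beyond \<open>b\<close> make sense.\<close>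
    have clamp: "continuous_on {a..b + 1} (\<lambda>t. f (min b t))" if "continuous_on {a..b} f" for f :: "real \<Rightarrow> real"
      using ab by (intro continuous_on_compose2[OF that] continuous_intros) auto
    have shift: "continuous_on {a..b} (\<lambda>x. f (min b (x + c)))"
      if "continuous_on {a..b} f" "0 \<le> c" "c \<le> 1" for f :: "real \<Rightarrow> real" and c
      by (rule continuous_on_compose2[OF clamp[OF that(1)], of _ "\<lambda>x. x + c"])
         (use that in \<open>auto intro!: continuous_intros\<close>)
    define q where "q n x = (\<psi> (min b (x + 1 / Suc n)) - \<psi> (min b x)) / (1 / Suc n)" for n x
    have qc: "continuous_on {a..b} (q n)" for n
    proof -
      have "continuous_on {a..b} (\<lambda>x. \<psi> (min b (x + 1 / Suc n)))"
        "continuous_on {a..b} (\<lambda>x. \<psi> (min b x))"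
        using shift[OF \<psi>c, of "1 / Suc n"] shift[OF \<psi>c, of 0] by (auto simp: field_simps)
      then show ?thesis unfolding q_def by (intro continuous_intros) auto
    qed
    have q: "square_integrable (lebesgue_on {a..b}) (q n)" for n
      unfolding square_integrable_def
      by (intro conjI continuous_imp_measurable_on_sets_lebesgue continuous_imp_integrable_real
            continuous_intros qc) auto
    have qbd: "(\<integral>x. (q n x)\<^sup>2 \<partial>lebesgue_on {a..b}) \<le> G b" for n
    proof -
      define h where "h = 1 / real (Suc n)"
      have h: "0 < h" "h \<le> 1" by (auto simp: h_def field_simps)
      have hc: "continuous_on {a..b} (\<lambda>x. (G (min b (x + h)) - G (min b x)) / h)"
      proof -
        have "continuous_on {a..b} (\<lambda>x. G (min b (x + h)))" "continuous_on {a..b} (\<lambda>x. G (min b x))"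
          using shift[OF Gc, of h] shift[OF Gc, of 0] h by auto
        then show ?thesis using h by (intro continuous_intros) auto
      qed
      have "(\<integral>x. (q n x)\<^sup>2 \<partial>lebesgue_on {a..b}) \<le> (\<integral>x. (G (min b (x + h)) - G (min b x)) / h \<partial>lebesgue_on {a..b})"
      proof (rule integral_mono)
        fix x assume "x \<in> space (lebesgue_on {a..b})"
        then have x: "a \<le> x" "x \<le> b" by auto
        define y where "y = min b (x + h)"
        have y: "x \<le> y" "y \<le> b" "y - x \<le> h" using x h by (auto simp: y_def)
        have "(\<psi> y - \<psi> x)\<^sup>2 \<le> (integral {x..y} m)\<^sup>2"
          using bd[of x y] x y by (intro power2_le_iff_abs_le[THEN iffD2]) auto
        also have "\<dots> \<le> (y - x) * integral {x..y} (\<lambda>x. (m x)\<^sup>2)"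
          by (intro integral_interval_Cauchy_Schwarz square_integrable_subinterval[OF m] x y)
        also have "\<dots> \<le> h * (G y - G x)"
          using x y G[of x y] Gmono[of x y] by (auto intro!: mult_right_mono)
        finally have "(\<psi> y - \<psi> x)\<^sup>2 / h\<^sup>2 \<le> h * (G y - G x) / h\<^sup>2"
          by (rule divide_right_mono) simp
        also have "\<dots> = (G y - G x) / h" using h by (simp add: power2_eq_square)
        finally have "(\<psi> y - \<psi> x)\<^sup>2 / h\<^sup>2 \<le> (G y - G x) / h" .
        moreover have "q n x = (\<psi> y - \<psi> x) / h" unfolding q_def h_def y_def using x by simp
        ultimately show "(q n x)\<^sup>2 \<le> (G (min b (x + h)) - G (min b x)) / h"
          using x by (simp add: power_divide y_def)
      qed (use hc square_integrable_power2[OF q] in \<open>auto intro: continuous_imp_integrable_real\<close>)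
      also have "\<dots> = integral {a..b} (\<lambda>x. (G (min b (x + h)) - G (min b x)) / h)"
        by (intro lebesgue_integral_eq_integral continuous_imp_integrable_real hc) auto
      also have "\<dots> = (integral {b..b + h} (\<lambda>x. G (min b x)) - integral {a..a + h} (\<lambda>x. G (min b x))) / h"
        using integral_shift_difference[OF clamp[OF Gc], of a b h] ab h by simp
      also have "\<dots> \<le> (h * G b) / h"
      proof (rule divide_right_mono)
        have "integral {b..b + h} (\<lambda>x. G (min b x)) = integral {b..b + h} (\<lambda>x. G b)"
          by (rule integral_cong) auto
        also have "\<dots> = h * G b" using h by simp
        finally have 1: "integral {b..b + h} (\<lambda>x. G (min b x)) = h * G b" .
        have "0 \<le> integral {a..a + h} (\<lambda>x. G (min b x))"
          using ab h by (intro Henstock_Kurzweil_Integration.integral_nonneg G0 integrable_continuous_real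
              continuous_on_subset[OF clamp[OF Gc]]) auto
        with 1 show "integral {b..b + h} (\<lambda>x. G (min b x)) - integral {a..a + h} (\<lambda>x. G (min b x)) \<le> h * G b"
          by simp
      qed (use h in simp)
      finally show ?thesis using h by simp
    qed
    obtain p where p: "square_integrable (lebesgue_on {a..b}) p"
      "\<And>g c. square_integrable (lebesgue_on {a..b}) g \<Longrightarrow>
        \<forall>\<^sub>F n in sequentially. c \<le> (\<integral>t. q n t * g t \<partial>lebesgue_on {a..b}) \<Longrightarrow>
        c \<le> (\<integral>t. p t * g t \<partial>lebesgue_on {a..b})"
      by (rule square_integrable_weak_cluster[OF q qbd], rule that)
    show ?thesis
    proof (rule that[OF p(1)])
      fix s t assume st: "a \<le> s" "s \<le> t" "t \<le> b"
      have ind: "square_integrable (lebesgue_on {a..b}) (\<lambda>x. c * indicator {s..t} x)" for c :: real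
      proof (rule square_integrable_bounded)
        show "\<bar>c * indicator {s..t} x\<bar> \<le> \<bar>c\<bar>" for x by (simp add: indicator_def)
      qed (intro borel_measurable_times measurable_restrict_space1 borel_measurable_indicator; simp)
      have "integral {s..t} (q n) = integral {t..t + 1 / Suc n} (\<lambda>x. \<psi> (min b x)) / (1 / Suc n)
           - integral {s..s + 1 / Suc n} (\<lambda>x. \<psi> (min b x)) / (1 / Suc n)" for n
      proof -
        have "integral {s..t} (q n) =
            integral {s..t} (\<lambda>x. \<psi> (min b (x + 1 / Suc n)) - \<psi> (min b x)) / (1 / Suc n)"
          unfolding q_def[abs_def] by (rule Henstock_Kurzweil_Integration.integral_divide)
        then show ?thesis
          by (subst (asm) integral_shift_difference[OF clamp[OF \<psi>c] st])
             (simp_all only: diff_divide_distrib, simp_all)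
      qed
      moreover have "(\<lambda>n. integral {t..t + 1 / Suc n} (\<lambda>x. \<psi> (min b x)) / (1 / Suc n)
           - integral {s..s + 1 / Suc n} (\<lambda>x. \<psi> (min b x)) / (1 / Suc n)) \<longlonglongrightarrow> \<psi> (min b t) - \<psi> (min b s)"
        using st by (intro tendsto_diff averages_tendsto continuous_on_subset[OF clamp[OF \<psi>c]]) auto
      ultimately have lim: "(\<lambda>n. integral {s..t} (q n)) \<longlonglongrightarrow> \<psi> t - \<psi> s" using st by simp
      have qi: "(\<integral>x. q n x * (c * indicator {s..t} x) \<partial>lebesgue_on {a..b}) = c * integral {s..t} (q n)" for n c
        using integrable_lebesgue_on_subinterval(4)[OF square_integrable_integrable[OF q] st(1,3)]
        by (simp add: mult.left_commute)
      have pi: "(\<integral>x. p x * (c * indicator {s..t} x) \<partial>lebesgue_on {a..b}) = c * integral {s..t} p" for c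
        using integrable_lebesgue_on_subinterval(4)[OF square_integrable_integrable[OF p(1)] st(1,3)]
        by (simp add: mult.left_commute)
      have ge: "c * (\<psi> t - \<psi> s) - e \<le> c * integral {s..t} p" if "e > 0" for c e
      proof -
        have "(\<lambda>n. c * integral {s..t} (q n)) \<longlonglongrightarrow> c * (\<psi> t - \<psi> s)" by (intro tendsto_intros lim)
        then have "\<forall>\<^sub>F n in sequentially. c * (\<psi> t - \<psi> s) - e < c * integral {s..t} (q n)"
          by (rule order_tendstoD) (use that in auto)
        then have "\<forall>\<^sub>F n in sequentially. c * (\<psi> t - \<psi> s) - e \<le>
            (\<integral>x. q n x * (c * indicator {s..t} x) \<partial>lebesgue_on {a..b})"
          unfolding qi by eventually_elim simp
        from p(2)[OF ind this] show ?thesis by (simp only: pi)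
      qed
      have "c * (\<psi> t - \<psi> s) \<le> c * integral {s..t} p" for c
        by (rule field_le_epsilon) (use ge[of _ c] in \<open>auto simp: algebra_simps\<close>)
      from this[of 1] this[of "-1"] show "\<psi> t - \<psi> s = integral {s..t} p" by simp
    qed
  qed
qed


theorem absolutely_continuous_FTC:
  fixes \<psi> m :: "real \<Rightarrow> real"
  assumes m: "square_integrable (lebesgue_on {a..b}) m"
    and bd: "\<And>s t. a \<le> s \<Longrightarrow> s \<le> t \<Longrightarrow> t \<le> b \<Longrightarrow> \<bar>\<psi> t - \<psi> s\<bar> \<le> integral {s..t} m"
  obtains q where "square_integrable (lebesgue_on {a..b}) q"
    "\<And>s t. a \<le> s \<Longrightarrow> s \<le> t \<Longrightarrow> t \<le> b \<Longrightarrow> \<psi> t - \<psi> s = integral {s..t} q"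
    "negligible {t \<in> {a..b}. \<not> (\<psi> has_real_derivative q t) (at t within {a..b})}"
proof -
  obtain q where q: "square_integrable (lebesgue_on {a..b}) q"
    "\<And>s t. a \<le> s \<Longrightarrow> s \<le> t \<Longrightarrow> t \<le> b \<Longrightarrow> \<psi> t - \<psi> s = integral {s..t} q"
    by (rule absolutely_continuous_eq_integral[OF m bd], assumption, assumption, assumption, rule that)
  have "q integrable_on {a..b}"
    using integrable_lebesgue_on_subinterval(2)[OF square_integrable_interval_integrable[OF q(1)]] by simp
  note Lebesgue_differentiation[OF this]
  moreover have "(\<psi> has_real_derivative D) (at t within {a..b})"
    if "((\<lambda>t. integral {a..t} q) has_real_derivative D) (at t within {a..b})" "t \<in> {a..b}" for D t
  proof -
    have "((\<lambda>t. integral {a..t} q + \<psi> a) has_real_derivative D + 0) (at t within {a..b})"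
      by (intro derivative_intros that)
    then show ?thesis
      using that q(2)[of a] has_field_derivative_transform_within[of "\<lambda>t. integral {a..t} q + \<psi> a" "D + 0" t "{a..b}" 1 \<psi>]
      by (simp flip: q(2))
  qed
  ultimately have "negligible {t \<in> {a..b}. \<not> (\<psi> has_real_derivative q t) (at t within {a..b})}"
    by (auto elim!: negligible_subset)
  with q show ?thesis by (rule that)
qed

lemma has_real_derivative_abs_quotient:
  fixes f :: "real \<Rightarrow> real"
  assumes "(f has_real_derivative D) (at t within S)"
  shows "((\<lambda>s. \<bar>f s - f t\<bar> / \<bar>t - s\<bar>) \<longlongrightarrow> \<bar>D\<bar>) (at t within S)"
  using tendsto_rabs[OF assms[unfolded has_field_derivative_iff]]
  by (simp add: abs_divide abs_minus_commute)

section \<open>The metric derivative on a compact interval\<close>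

lemma at_within_Icc_nontrivial:
  assumes "a < b" "t \<in> {a..b::real}" shows "at t within {a..b} \<noteq> bot"
  using assms by (simp add: trivial_limit_within islimpt_Icc)

lemma abs_integral_le_indefinite:
  fixes m :: "real \<Rightarrow> real"
  assumes "m integrable_on {a..b}" "s \<in> {a..b}" "t \<in> {a..b}"
    and bd: "\<And>s t. a \<le> s \<Longrightarrow> s \<le> t \<Longrightarrow> t \<le> b \<Longrightarrow> dist (u s) (u t) \<le> integral {s..t} m"
  shows "dist (u s) (u t) \<le> \<bar>integral {a..s} m - integral {a..t} m\<bar>"
  using assms(2,3)
proof (induction s t rule: linorder_wlog)
  case (le s t)
  then have "integral {a..s} m + integral {s..t} m = integral {a..t} m"
    by (intro Henstock_Kurzweil_Integration.integral_combine integrable_on_subinterval[OF assms(1)]) auto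
  then show ?case using bd[of s t] le by auto
qed (simp add: abs_minus_commute dist_commute)

text \<open>
  For every rational \<open>y\<close> the function \<open>dist (u _) (u y)\<close> is absolutely continuous, with density \<open>p y\<close>, and
  \<open>g\<close> is the supremum of the functions \<open>|p y|\<close>. Integrating \<open>p y\<close> from \<open>y\<close> bounds distances by integrals of
  \<open>g\<close>, so Lebesgue's theorem bounds the metric difference quotients from above by \<open>g\<close> in the limit. The
  reverse triangle inequality bounds them from below by those of \<open>dist (u _) (u y)\<close>.
\<close>
theorem metric_derivative_interval:
  fixes u :: "real \<Rightarrow> 'a::metric_space"
  assumes ab: "a < b" and m: "square_integrable (lebesgue_on {a..b}) m"
    and bd: "\<And>s t. a \<le> s \<Longrightarrow> s \<le> t \<Longrightarrow> t \<le> b \<Longrightarrow> dist (u s) (u t) \<le> integral {s..t} m"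
  obtains g where "square_integrable (lebesgue_on {a..b}) g" "\<And>x. 0 \<le> g x"
    "\<And>s t. a \<le> s \<Longrightarrow> s \<le> t \<Longrightarrow> t \<le> b \<Longrightarrow> dist (u s) (u t) \<le> integral {s..t} g"
    "negligible {t \<in> {a..b}. \<not> has_metric_deriv {a..b} u (g t) t}"
proof -
  have int: "f integrable_on {s..t}" if "square_integrable (lebesgue_on {a..b}) f" "a \<le> s" "t \<le> b" for f s t
    using integrable_lebesgue_on_subinterval(2)[OF square_integrable_interval_integrable[OF that(1)] that(2,3)] .
  define D where "D = \<rat> \<inter> {a..b}"
  have Dc: "countable D" unfolding D_def by (intro countable_Int1 countable_rat)
  have dense: "\<exists>y\<in>D. c < y \<and> y < d" if "a \<le> c" "c < d" "d \<le> b" for c d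
    using Rats_dense_in_real[OF that(2)] that by (fastforce simp: D_def)
  obtain y0 where y0: "y0 \<in> D" using dense[of a b] ab by auto
  define R where "R y q \<longleftrightarrow> square_integrable (lebesgue_on {a..b}) q \<and>
      (\<forall>s t. a \<le> s \<longrightarrow> s \<le> t \<longrightarrow> t \<le> b \<longrightarrow> dist (u t) (u y) - dist (u s) (u y) = integral {s..t} q) \<and>
      negligible {t \<in> {a..b}. \<not> ((\<lambda>t. dist (u t) (u y)) has_real_derivative q t) (at t within {a..b})}" for y q
  have "\<exists>q. R y q" for y
  proof -
    have b: "\<bar>dist (u t) (u y) - dist (u s) (u y)\<bar> \<le> integral {s..t} m" if "a \<le> s" "s \<le> t" "t \<le> b" for s t
      using bd[OF that] dist_triangle[of "u t" "u y" "u s"] dist_triangle[of "u s" "u y" "u t"]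
      by (auto simp: dist_commute abs_le_iff)
    show ?thesis
      by (rule absolutely_continuous_FTC[OF m b]) (auto simp: R_def)
  qed
  then obtain p where pR: "\<And>y. R y (p y)" by metis
  have p: "\<And>y. square_integrable (lebesgue_on {a..b}) (p y)"
    "\<And>y s t. a \<le> s \<Longrightarrow> s \<le> t \<Longrightarrow> t \<le> b \<Longrightarrow> dist (u t) (u y) - dist (u s) (u y) = integral {s..t} (p y)"
    "\<And>y. negligible {t \<in> {a..b}. \<not> ((\<lambda>t. dist (u t) (u y)) has_real_derivative p y t) (at t within {a..b})}"
    using pR unfolding R_def by blast+
  define N where "N = {t \<in> {a..b}. \<not> ((\<lambda>t. integral {a..t} m) has_real_derivative m t) (at t within {a..b})} \<union>
     (\<Union>y\<in>D. {t \<in> {a..b}. \<not> ((\<lambda>t. dist (u t) (u y)) has_real_derivative p y t) (at t within {a..b})})"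
  have N: "negligible N" unfolding N_def
    using Dc by (intro negligible_Un Lebesgue_differentiation int[OF m] negligible_countable_Union)
      (auto simp del: atLeastAtMost_iff intro: p(3))
  have pd: "((\<lambda>s. \<bar>dist (u s) (u y) - dist (u t) (u y)\<bar> / \<bar>t - s\<bar>) \<longlongrightarrow> \<bar>p y t\<bar>) (at t within {a..b})"
    if "t \<in> {a..b}" "t \<notin> N" "y \<in> D" for t y
    by (rule has_real_derivative_abs_quotient[of "\<lambda>t. dist (u t) (u y)"]) (use that in \<open>auto simp: N_def\<close>)
  have tri: "\<bar>dist (u s) z - dist (u t) z\<bar> \<le> dist (u s) (u t)" for s t z
    using dist_triangle[of "u s" z "u t"] dist_triangle[of "u t" z "u s"] by (auto simp: dist_commute abs_le_iff)
  have pm: "\<bar>p y t\<bar> \<le> \<bar>m t\<bar>" if "t \<in> {a..b}" "t \<notin> N" "y \<in> D" for t y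
  proof (rule tendsto_le[OF at_within_Icc_nontrivial[OF ab that(1)] _ pd[OF that]])
    show "((\<lambda>s. \<bar>integral {a..s} m - integral {a..t} m\<bar> / \<bar>t - s\<bar>) \<longlongrightarrow> \<bar>m t\<bar>) (at t within {a..b})"
      by (rule has_real_derivative_abs_quotient[of "\<lambda>t. integral {a..t} m"]) (use that in \<open>auto simp: N_def\<close>)
    show "\<forall>\<^sub>F s in at t within {a..b}. \<bar>dist (u s) (u y) - dist (u t) (u y)\<bar> / \<bar>t - s\<bar> \<le>
        \<bar>integral {a..s} m - integral {a..t} m\<bar> / \<bar>t - s\<bar>"
      unfolding eventually_at_filter
    proof (intro always_eventually allI impI divide_right_mono)
      fix s assume "s \<in> {a..b}"
      from abs_integral_le_indefinite[OF int[OF m order_refl order_refl] this that(1) bd] tri[of s "u y" t]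
      show "\<bar>dist (u s) (u y) - dist (u t) (u y)\<bar> \<le> \<bar>integral {a..s} m - integral {a..t} m\<bar>" by linarith
    qed auto
  qed
  \<comment> \<open>Off \<open>N\<close> all \<open>|p y|\<close> are bounded by \<open>|m|\<close>; the value 0 on \<open>N\<close> keeps the supremum bounded everywhere.\<close>
  define P where "P y t = (if t \<in> {a..b} - N then \<bar>p y t\<bar> else 0)" for y t
  have P0: "0 \<le> P y t" and Pm: "y \<in> D \<Longrightarrow> P y t \<le> \<bar>m t\<bar>" for y t
    using pm by (auto simp: P_def)
  have Pmeas: "P y \<in> borel_measurable (lebesgue_on {a..b})" for y
  proof -
    have "N \<in> sets lebesgue" using N by (rule negligible_imp_sets)
    then have "{a..b} - N \<in> sets (lebesgue_on {a..b})"
      by (subst sets_restrict_space_iff) auto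
    then show ?thesis unfolding P_def[abs_def]
      using p(1)[of y] by (intro measurable_If_set borel_measurable_abs) auto
  qed
  define g where "g t = (SUP y\<in>D. P y t)" for t
  have bdd: "bdd_above ((\<lambda>y. P y t) ` D)" for t
    using Pm by (intro bdd_aboveI[of _ "\<bar>m t\<bar>"]) auto
  have Pg: "P y t \<le> g t" if "y \<in> D" for y t
    unfolding g_def by (rule cSUP_upper[OF that bdd])
  have gm: "g t \<le> \<bar>m t\<bar>" for t
    unfolding g_def using y0 Pm by (intro cSUP_least) auto
  have g0: "0 \<le> g t" for t using order_trans[OF P0 Pg[OF y0]] .
  have gmeas: "g \<in> borel_measurable (lebesgue_on {a..b})"
    unfolding g_def[abs_def] by (intro borel_measurable_cSUP Dc Pmeas bdd)
  have g: "square_integrable (lebesgue_on {a..b}) g"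
    by (rule square_integrable_bound[OF m gmeas]) (use gm g0 in auto)
  have gD: "dist (u y) (u t) \<le> integral {y..t} g" if "y \<in> D" "y \<le> t" "t \<le> b" for y t
  proof -
    have ay: "a \<le> y" using that by (simp add: D_def)
    have "dist (u y) (u t) = integral {y..t} (p y)"
      using p(2)[of y t y] that ay by (simp add: dist_commute)
    also have "\<dots> = integral {y..t} (\<lambda>x. if x \<in> N then 0 else p y x)"
      by (rule integral_spike[OF N]) auto
    also have "\<dots> \<le> integral {y..t} g"
    proof (rule integral_le)
      show "(\<lambda>x. if x \<in> N then 0 else p y x) integrable_on {y..t}"
        by (rule integrable_spike[OF int[OF p(1)[of y] ay that(3)] N]) auto
      show "g integrable_on {y..t}" by (rule int[OF g ay that(3)])
      fix x assume "x \<in> {y..t}"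
      then show "(if x \<in> N then 0 else p y x) \<le> g x"
        using Pg[OF that(1), of x] g0[of x] ay that by (auto simp: P_def)
    qed
    finally show ?thesis .
  qed
  have gall: "dist (u s) (u t) \<le> integral {s..t} g" if st: "a \<le> s" "s \<le> t" "t \<le> b" for s t
  proof (cases "s = t")
    case False
    then have "s < t" using st by simp
    show ?thesis
    proof (rule field_le_epsilon)
      fix e :: real assume "e > 0"
      have "continuous_on {s..t} (\<lambda>x. integral {s..x} m)"
        by (rule indefinite_integral_continuous_1[OF int[OF m st(1,3)]])
      then obtain d where "d > 0" and d: "\<And>x. x \<in> {s..t} \<Longrightarrow> dist x s < d \<Longrightarrow> dist (integral {s..x} m) (integral {s..s} m) < e"
        using \<open>e > 0\<close> st(2) unfolding continuous_on_iff by (metis atLeastAtMost_iff order_refl)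
      obtain y where y: "y \<in> D" "s < y" "y < min t (s + d)"
        using dense[of s "min t (s + d)"] \<open>s < t\<close> \<open>d > 0\<close> st by (auto simp: min_le_iff_disj)
      have "dist (u s) (u y) < e"
        using bd[of s y] d[of y] y st by (auto simp: dist_real_def)
      moreover have "integral {s..y} g + integral {y..t} g = integral {s..t} g"
        by (intro Henstock_Kurzweil_Integration.integral_combine int[OF g]) (use y st in auto)
      moreover have "0 \<le> integral {s..y} g"
        by (intro Henstock_Kurzweil_Integration.integral_nonneg int[OF g] g0) (use y st in auto)
      ultimately show "dist (u s) (u t) \<le> integral {s..t} g + e"
        using gD[of y t] y st dist_triangle[of "u s" "u t" "u y"] by auto
    qed
  qed simp
  define N' where "N' = N \<union> {t \<in> {a..b}. \<not> ((\<lambda>t. integral {a..t} g) has_real_derivative g t) (at t within {a..b})}"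
  have N': "negligible N'" unfolding N'_def
    by (intro negligible_Un N Lebesgue_differentiation int[OF g]) auto
  have "has_metric_deriv {a..b} u (g t) t" if t: "t \<in> {a..b}" "t \<notin> N'" for t
    unfolding has_metric_deriv_def
  proof (rule order_tendstoI)
    fix c assume "c < g t"
    then obtain y where y: "y \<in> D" "c < P y t"
      unfolding g_def using less_cSUP_iff[OF _ bdd] y0 by blast
    then have "c < \<bar>p y t\<bar>" using t by (auto simp: P_def N'_def)
    then have "\<forall>\<^sub>F s in at t within {a..b}. c < \<bar>dist (u s) (u y) - dist (u t) (u y)\<bar> / \<bar>t - s\<bar>"
      using t y by (intro order_tendstoD(1)[OF pd]) (auto simp: N'_def)
    then show "\<forall>\<^sub>F s in at t within {a..b}. c < dist (u s) (u t) / \<bar>t - s\<bar>"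
      by eventually_elim (rule less_le_trans, assumption, intro divide_right_mono tri, simp)
  next
    fix c assume "g t < c"
    have "((\<lambda>s. \<bar>integral {a..s} g - integral {a..t} g\<bar> / \<bar>t - s\<bar>) \<longlongrightarrow> \<bar>g t\<bar>) (at t within {a..b})"
      by (rule has_real_derivative_abs_quotient[of "\<lambda>t. integral {a..t} g"]) (use t in \<open>auto simp: N'_def\<close>)
    then have "\<forall>\<^sub>F s in at t within {a..b}. \<bar>integral {a..s} g - integral {a..t} g\<bar> / \<bar>t - s\<bar> < c"
      by (rule order_tendstoD) (use g0 \<open>g t < c\<close> in simp)
    moreover have "\<forall>\<^sub>F s in at t within {a..b}. s \<in> {a..b}"
      by (simp add: eventually_at_filter)
    ultimately show "\<forall>\<^sub>F s in at t within {a..b}. dist (u s) (u t) / \<bar>t - s\<bar> < c"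
    proof eventually_elim
      case (elim s)
      have "dist (u s) (u t) / \<bar>t - s\<bar> \<le> \<bar>integral {a..s} g - integral {a..t} g\<bar> / \<bar>t - s\<bar>"
        by (intro divide_right_mono abs_integral_le_indefinite[OF int[OF g] elim(2) t(1) gall]) auto
      with elim show ?case by linarith
    qed
  qed
  then have "negligible {t \<in> {a..b}. \<not> has_metric_deriv {a..b} u (g t) t}"
    using N' by (auto elim!: negligible_subset)
  with g g0 gall show ?thesis by (rule that)
qed

lemma metric_derivative_minimal:
  fixes u :: "real \<Rightarrow> 'a::metric_space"
  assumes ab: "a < b" and m: "m integrable_on {a..b}"
    and bd: "\<And>s t. a \<le> s \<Longrightarrow> s \<le> t \<Longrightarrow> t \<le> b \<Longrightarrow> dist (u s) (u t) \<le> integral {s..t} m"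
  shows "negligible {t \<in> {a..b}. \<exists>l. has_metric_deriv {a..b} u l t \<and> \<bar>m t\<bar> < l}"
proof (rule negligible_subset[OF Lebesgue_differentiation[OF m]], clarsimp)
  fix t l assume t: "a \<le> t" "t \<le> b" and l: "has_metric_deriv {a..b} u l t" "\<bar>m t\<bar> < l"
    and d: "((\<lambda>t. integral {a..t} m) has_real_derivative m t) (at t within {a..b})"
  have "l \<le> \<bar>m t\<bar>"
  proof (rule tendsto_le[OF at_within_Icc_nontrivial[OF ab] has_real_derivative_abs_quotient[OF d]
        l(1)[unfolded has_metric_deriv_def]])
    show "\<forall>\<^sub>F s in at t within {a..b}. dist (u s) (u t) / \<bar>t - s\<bar> \<le>
        \<bar>integral {a..s} m - integral {a..t} m\<bar> / \<bar>t - s\<bar>"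
      unfolding eventually_at_filter
      by (intro always_eventually allI impI divide_right_mono abs_integral_le_indefinite[OF m _ _ bd])
         (use t in auto)
  qed (use t in auto)
  with l show False by simp
qed

section \<open>The metric derivative on the half-line\<close>

lemma borel_measurable_lebesgue_on_spike:
  assumes f: "f \<in> borel_measurable (lebesgue_on S)" and S: "S \<in> sets lebesgue"
    and N: "negligible N" and eq: "\<And>x. x \<in> S \<Longrightarrow> x \<notin> N \<Longrightarrow> g x = f x"
  shows "g \<in> borel_measurable (lebesgue_on S)"
proof (rule measurableI)
  fix B :: "'b set" assume B: "B \<in> sets borel"
  have 1: "f -` B \<inter> S \<in> sets lebesgue"
    using measurable_sets[OF f B] S by (simp add: sets_restrict_space_iff)
  have 2: "N \<in> sets lebesgue" "g -` B \<inter> S \<inter> N \<in> sets lebesgue"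
    using N by (auto intro!: negligible_imp_sets intro: negligible_subset)
  have 3: "g -` B \<inter> S = (f -` B \<inter> S - N) \<union> (g -` B \<inter> S \<inter> N)"
    using eq by auto
  have "g -` B \<inter> S \<in> sets lebesgue"
    by (subst 3) (intro sets.Un sets.Diff 1 2)
  then show "g -` B \<inter> space (lebesgue_on S) \<in> sets (lebesgue_on S)"
    using S by (simp add: sets_restrict_space_iff)
qed simp

lemma AC2_loc_bound:
  assumes "AC2_loc {0..} u"
  obtains m where "square_integrable (lebesgue_on {0..b}) m"
    "\<And>s t. 0 \<le> s \<Longrightarrow> s \<le> t \<Longrightarrow> t \<le> b \<Longrightarrow> dist (u s) (u t) \<le> integral {s..t} m"
proof -
  have "AC2_on {0..b} u" using assms unfolding AC2_loc_def by force
  then obtain m where m: "square_integrable (lebesgue_on {0..b}) m"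
      "\<And>s t. s \<in> {0..b} \<Longrightarrow> t \<in> {0..b} \<Longrightarrow> s \<le> t \<Longrightarrow> dist (u s) (u t) \<le> (LINT r|lebesgue_on {s..t}. m r)"
    unfolding AC2_on_def square_integrable_def by blast
  show ?thesis
  proof (rule that[OF m(1)])
    fix s t assume "0 \<le> s" "s \<le> t" "t \<le> b"
    with m(2)[of s t] integrable_lebesgue_on_subinterval(3)[OF square_integrable_interval_integrable[OF m(1)], of s t]
    show "dist (u s) (u t) \<le> integral {s..t} m" by simp
  qed
qed

lemma AC2_locI:
  assumes sq: "\<And>b. square_integrable (lebesgue_on {0..b}) m"
    and bd: "\<And>s t. 0 \<le> s \<Longrightarrow> s \<le> t \<Longrightarrow> dist (u s) (u t) \<le> integral {s..t} m"
  shows "AC2_loc {0..} u"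
  unfolding AC2_loc_def
proof (intro allI impI)
  fix a b :: real assume ab: "{a..b} \<subseteq> {0..}"
  show "AC2_on {a..b} u"
  proof (cases "a \<le> b")
    case True
    then have a: "0 \<le> a" using ab by auto
    have "dist (u s) (u t) \<le> (LINT r|lebesgue_on {s..t}. m r)" if "s \<in> {a..b}" "t \<in> {a..b}" "s \<le> t" for s t
      using bd[of s t] that a
        integrable_lebesgue_on_subinterval(3)[OF square_integrable_interval_integrable[OF sq[of b]], of s t] by auto
    then show ?thesis
      unfolding AC2_on_def using square_integrable_subinterval[OF sq[of b] a order_refl]
      by (auto simp: square_integrable_def)
  next
    case False
    then show ?thesis unfolding AC2_on_def by (intro exI[of _ "\<lambda>_. 0"]) auto
  qed
qed

lemma at_within_halfline_nontrivial: "0 \<le> t \<Longrightarrow> at t within {0::real..} \<noteq> bot"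
  using at_within_Icc_nontrivial[of 0 "t + 1" t] at_le[of "{0..t + 1}" "{0..}" t]
  by (auto simp: bot_unique)

lemma metric_deriv_eq:
  assumes "has_metric_deriv {0..} u l t" "0 \<le> t"
  shows "metric_deriv {0..} u t = l"
  unfolding metric_deriv_def
proof (rule the_equality)
  fix l' assume "has_metric_deriv {0..} u l' t"
  then show "l' = l"
    using tendsto_unique[OF at_within_halfline_nontrivial[OF assms(2)]] assms(1)
    unfolding has_metric_deriv_def by blast
qed fact

lemma at_within_halfline:
  assumes "0 < t" "t < b" shows "at t within {0..b::real} = at t within {0..}"
proof -
  have "at t within {0..} = at t"
    by (rule at_within_open_subset[of t "{0<..}"]) (use assms in auto)
  then show ?thesis using assms by (simp add: at_within_Icc_at)
qed

text \<open>
  At an interior point of \<open>{0..n + 1}\<close> the limits within this interval and within the half-line agree, so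
  the derivatives obtained on the intervals fit together up to a null set.
\<close>
theorem metric_deriv_halfline:
  fixes u :: "real \<Rightarrow> 'a::metric_space"
  assumes u: "AC2_loc {0..} u"
  shows AE_has_metric_deriv:
      "AE t in lebesgue_on {0<..}. has_metric_deriv {0..} u (metric_deriv {0..} u t) t \<and> 0 \<le> metric_deriv {0..} u t"
    and metric_deriv_measurable: "metric_deriv {0..} u \<in> borel_measurable (lebesgue_on {0<..})"
    and metric_deriv_square_integrable: "\<And>b. square_integrable (lebesgue_on {0..b}) (metric_deriv {0..} u)"
    and dist_le_integral_metric_deriv:
      "\<And>s t. 0 \<le> s \<Longrightarrow> s \<le> t \<Longrightarrow> dist (u s) (u t) \<le> integral {s..t} (metric_deriv {0..} u)"
proof -
  let ?f = "metric_deriv {0..} u"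
  define R where "R n g \<longleftrightarrow> square_integrable (lebesgue_on {0..real n + 1}) g \<and> (\<forall>x. 0 \<le> g x) \<and>
      (\<forall>s t. 0 \<le> s \<longrightarrow> s \<le> t \<longrightarrow> t \<le> real n + 1 \<longrightarrow> dist (u s) (u t) \<le> integral {s..t} g) \<and>
      negligible {t \<in> {0..real n + 1}. \<not> has_metric_deriv {0..real n + 1} u (g t) t}" for n g
  have "\<exists>g. R n g" for n
  proof -
    obtain m where m: "square_integrable (lebesgue_on {0..real n + 1}) m"
      "\<And>s t. 0 \<le> s \<Longrightarrow> s \<le> t \<Longrightarrow> t \<le> real n + 1 \<Longrightarrow> dist (u s) (u t) \<le> integral {s..t} m"
      by (rule AC2_loc_bound[OF u, of "real n + 1"], rule that)
    obtain g where "square_integrable (lebesgue_on {0..real n + 1}) g" "\<And>x. 0 \<le> g x"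
      "\<And>s t. 0 \<le> s \<Longrightarrow> s \<le> t \<Longrightarrow> t \<le> real n + 1 \<Longrightarrow> dist (u s) (u t) \<le> integral {s..t} g"
      "negligible {t \<in> {0..real n + 1}. \<not> has_metric_deriv {0..real n + 1} u (g t) t}"
      by (rule metric_derivative_interval[OF _ m], simp, assumption, assumption, assumption, rule that)
    then have "R n g" unfolding R_def by blast
    then show ?thesis by blast
  qed
  then obtain g where gR: "\<And>n. R n (g n)" by metis
  have g: "\<And>n. square_integrable (lebesgue_on {0..real n + 1}) (g n)" "\<And>n x. 0 \<le> g n x"
      "\<And>n s t. 0 \<le> s \<Longrightarrow> s \<le> t \<Longrightarrow> t \<le> real n + 1 \<Longrightarrow> dist (u s) (u t) \<le> integral {s..t} (g n)"
      "\<And>n. negligible {t \<in> {0..real n + 1}. \<not> has_metric_deriv {0..real n + 1} u (g n t) t}"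
    using gR unfolding R_def by blast+
  define N where "N = (\<Union>n. {t \<in> {0..real n + 1}. \<not> has_metric_deriv {0..real n + 1} u (g n t) t})"
  have N: "negligible N" unfolding N_def by (rule negligible_Union_nat[OF g(4)])
  have hmd: "has_metric_deriv {0..} u (g n t) t" and eq: "?f t = g n t"
    if "0 < t" "t < real n + 1" "t \<notin> N" for n t
  proof -
    have "has_metric_deriv {0..real n + 1} u (g n t) t" using that by (auto simp: N_def)
    then show 1: "has_metric_deriv {0..} u (g n t) t"
      using at_within_halfline[OF that(1,2)] by (simp add: has_metric_deriv_def)
    show "?f t = g n t" by (rule metric_deriv_eq[OF 1]) (use that in simp)
  qed
  have ex: "\<exists>n. t < real n + 1" for t :: real
    by (meson reals_Archimedean2 less_add_one order_less_trans)
  have "AE t in lebesgue. t \<notin> N"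
    using N by (simp add: negligible_iff_null_sets AE_not_in)
  then have "AE t in lebesgue. t \<in> {0<..} \<longrightarrow> has_metric_deriv {0..} u (?f t) t \<and> 0 \<le> ?f t"
    proof eventually_elim
    case (elim t)
    obtain n where "t < real n + 1" using ex by blast
    then show ?case using elim hmd[of t n] eq[of t n] g(2)[of n t] by auto
  qed
  then show "AE t in lebesgue_on {0<..}. has_metric_deriv {0..} u (?f t) t \<and> 0 \<le> ?f t"
    by (subst AE_restrict_space_iff) auto
  define G where "G t = (if t \<in> {0..real (nat \<lfloor>t\<rfloor>) + 1} then g (nat \<lfloor>t\<rfloor>) t else 0)" for t
  have "(\<lambda>t. if t \<in> {0..real n + 1} then g n t else 0) \<in> borel_measurable lebesgue" for n
    by (rule borel_measurable_if_I) (use g(1) in \<open>auto simp: square_integrable_def\<close>)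
  moreover have "(\<lambda>t::real. nat \<lfloor>t\<rfloor>) \<in> measurable lebesgue (count_space UNIV)"
    by (rule measurable_completion) measurable
  ultimately have "G \<in> borel_measurable lebesgue"
    unfolding G_def[abs_def] by (rule measurable_compose_countable)
  then have "G \<in> borel_measurable (lebesgue_on {0<..})" by (rule measurable_restrict_space1)
  then show "?f \<in> borel_measurable (lebesgue_on {0<..})"
  proof (rule borel_measurable_lebesgue_on_spike[OF _ _ N])
    fix x :: real assume x: "x \<in> {0<..}" "x \<notin> N"
    then have "x < real (nat \<lfloor>x\<rfloor>) + 1" by simp
    with x eq[of x "nat \<lfloor>x\<rfloor>"] show "?f x = G x" by (simp add: G_def)
  qed simp
  have Nn: "negligible (N \<union> {0, real n + 1})" for n
    using N by (simp add: negligible_Un)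
  have eqn: "?f x = g n x" if "x \<in> {0..real n + 1}" "x \<notin> N \<union> {0, real n + 1}" for x n
    by (rule eq) (use that in auto)
  have sq: "square_integrable (lebesgue_on {0..real n + 1}) ?f" for n
  proof -
    have "?f \<in> borel_measurable (lebesgue_on {0..real n + 1})"
      by (rule borel_measurable_lebesgue_on_spike[OF square_integrable_measurable[OF g(1)] _ Nn[of n]])
         (use eqn[of _ n] in auto)
    moreover have "AE x in lebesgue_on {0..real n + 1}. \<bar>?f x\<bar> \<le> \<bar>g n x\<bar>"
    proof (subst AE_restrict_space_iff)
      have "AE t in lebesgue. t \<notin> N \<union> {0, real n + 1}"
        using Nn[of n] unfolding negligible_iff_null_sets by (rule AE_not_in)
      then show "AE x in lebesgue. x \<in> {0..real n + 1} \<longrightarrow> \<bar>?f x\<bar> \<le> \<bar>g n x\<bar>"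
        by eventually_elim (use eqn[of _ n] in auto)
    qed simp
    ultimately show ?thesis by (rule square_integrable_bound[OF g(1)])
  qed
  show "square_integrable (lebesgue_on {0..b}) ?f" for b
  proof -
    obtain n where "b < real n + 1" using ex by blast
    then show ?thesis by (intro square_integrable_subinterval[OF sq[of n]]) auto
  qed
  show "dist (u s) (u t) \<le> integral {s..t} ?f" if st: "0 \<le> s" "s \<le> t" for s t
  proof -
    obtain n where n: "t < real n + 1" using ex by blast
    have "integral {s..t} ?f = integral {s..t} (g n)"
      by (rule integral_spike[OF Nn[of n]]) (use st n eqn[of _ n] in auto)
    with g(3)[OF st, of n] n show ?thesis by simp
  qed
qed

lemma AE_metric_deriv_le:
  fixes u :: "real \<Rightarrow> 'a::metric_space"
  assumes u: "AC2_loc {0..} u"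
    and m: "\<And>b. m integrable_on {0..b}"
    and bd: "\<And>s t. 0 \<le> s \<Longrightarrow> s \<le> t \<Longrightarrow> dist (u s) (u t) \<le> integral {s..t} m"
  shows "AE t in lebesgue_on {0<..}. metric_deriv {0..} u t \<le> \<bar>m t\<bar>"
proof -
  define N where "N = (\<Union>n. {t \<in> {0..real n + 1}. \<exists>l. has_metric_deriv {0..real n + 1} u l t \<and> \<bar>m t\<bar> < l})"
  have N: "negligible N" unfolding N_def
  proof (rule negligible_Union_nat)
    show "negligible {t \<in> {0..real n + 1}. \<exists>l. has_metric_deriv {0..real n + 1} u l t \<and> \<bar>m t\<bar> < l}" for n
      by (intro metric_derivative_minimal m bd) auto
  qed
  have "AE t in lebesgue. t \<notin> N"
    using N unfolding negligible_iff_null_sets by (rule AE_not_in)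
  then have "AE t in lebesgue_on {0<..}. t \<notin> N"
    by (subst AE_restrict_space_iff) auto
  moreover have "AE t in lebesgue_on {0<..}. t \<in> {0<..}"
    by (rule AE_I2) simp
  ultimately show ?thesis using AE_has_metric_deriv[OF u]
  proof eventually_elim
    case (elim t)
    obtain n where n: "t < real n + 1" by (meson reals_Archimedean2 less_add_one order_less_trans)
    have 1: "has_metric_deriv {0..real n + 1} u (metric_deriv {0..} u t) t"
      using elim n at_within_halfline[of t "real n + 1"] by (simp add: has_metric_deriv_def)
    have "t \<in> N" if "\<bar>m t\<bar> < metric_deriv {0..} u t"
      unfolding N_def using that 1 elim n by (intro UN_I[of n] CollectI conjI exI) auto
    with elim(1) have "\<not> \<bar>m t\<bar> < metric_deriv {0..} u t" by metis
    then show ?case by simp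
  qed
qed

lemma AC2_loc_continuous:
  fixes u :: "real \<Rightarrow> 'a::metric_space"
  assumes u: "AC2_loc {0..} u" shows "continuous_on {0..} u"
  unfolding continuous_on_iff
proof (intro ballI allI impI)
  fix x e :: real assume x: "x \<in> {0..}" and e: "e > 0"
  have mi: "metric_deriv {0..} u integrable_on {0..x + 1}"
    using integrable_lebesgue_on_subinterval(2)[OF square_integrable_interval_integrable[OF
        metric_deriv_square_integrable[OF u]], of 0 "x + 1" "x + 1"] by simp
  have "continuous_on {0..x + 1} (\<lambda>t. integral {0..t} (metric_deriv {0..} u))"
    by (rule indefinite_integral_continuous_1[OF mi])
  then obtain d where d: "d > 0" "\<And>y. y \<in> {0..x + 1} \<Longrightarrow> dist y x < d \<Longrightarrow>
       dist (integral {0..y} (metric_deriv {0..} u)) (integral {0..x} (metric_deriv {0..} u)) < e"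
    using x e unfolding continuous_on_iff by (metis atLeastAtMost_iff atLeast_iff le_add_same_cancel1 zero_le_one)
  show "\<exists>d>0. \<forall>y\<in>{0..}. dist y x < d \<longrightarrow> dist (u y) (u x) < e"
  proof (intro exI[of _ "min d 1"] conjI ballI impI)
    fix y assume y: "y \<in> {0::real..}" "dist y x < min d 1"
    then have y': "y \<in> {0..x + 1}" by (auto simp: dist_real_def)
    have "dist (u y) (u x) \<le> \<bar>integral {0..y} (metric_deriv {0..} u) - integral {0..x} (metric_deriv {0..} u)\<bar>"
      by (rule abs_integral_le_indefinite[OF mi y' _ dist_le_integral_metric_deriv[OF u]]) (use x in auto)
    also have "\<dots> < e" using d(2)[OF y'] y by (simp add: dist_real_def)
    finally show "dist (u y) (u x) < e" .
  qed (use d in auto)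
qed


section \<open>The exponential probability measure\<close>

locale wed_weight =
  fixes \<epsilon> :: real
  assumes eps: "0 < \<epsilon>"
begin

abbreviation \<mu> where "\<mu> \<equiv> wed_measure \<epsilon>"

lemma space_wed [simp]: "space \<mu> = {0<..}"
  and sets_wed [measurable_cong]: "sets \<mu> = sets (lebesgue_on {0<..})"
  by (simp_all add: wed_measure_def)

lemma measurable_wed: "measurable \<mu> N = measurable (lebesgue_on {0<..}) N"
  by (rule measurable_cong_sets) (simp_all add: sets_wed)

lemma lebesgue_on_borel_measurable: "f \<in> measurable borel N \<Longrightarrow> f \<in> measurable (lebesgue_on S) N"
  by (intro measurable_restrict_space1 measurable_completion) simp

lemma wed_borel_measurable: "f \<in> measurable borel N \<Longrightarrow> f \<in> measurable \<mu> N"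
  unfolding measurable_wed by (rule lebesgue_on_borel_measurable)

lemma wed_density_measurable: "(\<lambda>t. exp (- t / \<epsilon>) / \<epsilon>) \<in> borel_measurable (lebesgue_on S)"
  by (rule lebesgue_on_borel_measurable) measurable

lemma AE_wed: "(AE x in \<mu>. P x) \<longleftrightarrow> (AE x in lebesgue_on {0<..}. P x)"
  unfolding wed_measure_def
  using wed_density_measurable eps by (subst AE_density) (auto simp: ennreal_less_zero_iff)

lemma nn_integral_wed:
  assumes "f \<in> borel_measurable \<mu>"
  shows "(\<integral>\<^sup>+x. f x \<partial>\<mu>) = (\<integral>\<^sup>+x. ennreal (exp (- x / \<epsilon>) / \<epsilon>) * f x \<partial>lebesgue_on {0<..})"
  using assms wed_density_measurable unfolding measurable_wed
  unfolding wed_measure_def by (intro nn_integral_density) auto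

lemma nn_integral_wed_lborel:
  assumes "f \<in> borel_measurable borel"
  shows "(\<integral>\<^sup>+x. f x \<partial>\<mu>) = (\<integral>\<^sup>+x. ennreal (exp (- x / \<epsilon>) / \<epsilon>) * f x * indicator {0<..} x \<partial>lborel)"
  by (subst nn_integral_wed[OF wed_borel_measurable[OF assms]])
     (simp add: nn_integral_restrict_space nn_integral_completion)

text \<open>
  The case \<open>a = 0\<close> gives the mass of the tails, the case \<open>a = 1 / (2 * \<epsilon>)\<close> the inner integral in
  \<open>nn_integral_hardy\<close>.
\<close>
lemma nn_integral_wed_exp_tail:
  assumes a: "a * \<epsilon> < 1" and s: "0 \<le> s"
  shows "(\<integral>\<^sup>+x. indicator {s<..} x * ennreal (exp (a * x)) \<partial>\<mu>) = ennreal (exp ((a - 1 / \<epsilon>) * s) / (1 - a * \<epsilon>))"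
proof -
  define b where "b = 1 / \<epsilon> - a"
  have b: "0 < b" "b * \<epsilon> = 1 - a * \<epsilon>" using a eps by (auto simp: b_def field_simps)
  have "(\<integral>\<^sup>+x. indicator {s<..} x * ennreal (exp (a * x)) \<partial>\<mu>) =
      (\<integral>\<^sup>+x. ennreal (exp (- x / \<epsilon>) / \<epsilon>) * (indicator {s<..} x * ennreal (exp (a * x))) * indicator {0<..} x \<partial>lborel)"
    by (rule nn_integral_wed_lborel) measurable
  also have "\<dots> = (\<integral>\<^sup>+x. ennreal (exp (- b * x) / \<epsilon>) * indicator {s..} x \<partial>lborel)"
  proof (rule nn_integral_cong_AE)
    have "AE x in lborel. x \<noteq> s" by (rule AE_lborel_singleton)
    then show "AE x in lborel. ennreal (exp (- x / \<epsilon>) / \<epsilon>) * (indicator {s<..} x * ennreal (exp (a * x))) * indicator {0<..} x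
       = ennreal (exp (- b * x) / \<epsilon>) * indicator {s..} x"
    proof eventually_elim
      case (elim x)
      have "exp (- b * x) / \<epsilon> = exp (- x / \<epsilon>) / \<epsilon> * exp (a * x)"
        by (simp add: b_def algebra_simps flip: exp_add)
      with elim s eps show ?case by (auto simp: indicator_def simp flip: ennreal_mult)
    qed
  qed
  also have "\<dots> = ennreal (0 - (- (exp (- b * s) / (b * \<epsilon>))))"
  proof (rule nn_integral_FTC_atLeast)
    show "((\<lambda>x. - (exp (- b * x) / (b * \<epsilon>))) has_real_derivative exp (- b * x) / \<epsilon>) (at x)" for x
      using b eps by (auto intro!: derivative_eq_intros simp: field_simps)
    have "filterlim (\<lambda>x. b * x) at_top at_top"
      using b by (intro filterlim_tendsto_pos_mult_at_top[OF tendsto_const] filterlim_ident) auto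
    then have "((\<lambda>x. exp (- (b * x))) \<longlongrightarrow> 0) at_top"
      by (intro filterlim_compose[OF exp_at_bot]) (simp add: filterlim_uminus_at_bot)
    from tendsto_minus[OF tendsto_divide[OF this tendsto_const[of "b * \<epsilon>"]]] b eps a
    show "((\<lambda>x. - (exp (- b * x) / (b * \<epsilon>))) \<longlongrightarrow> 0) at_top" by simp
  qed (use eps in auto)
  also have "0 - (- (exp (- b * s) / (b * \<epsilon>))) = exp ((a - 1 / \<epsilon>) * s) / (1 - a * \<epsilon>)"
    by (simp add: b(2)) (simp add: b_def algebra_simps)
  finally show ?thesis .
qed

lemma emeasure_wed_tail: "0 \<le> s \<Longrightarrow> emeasure \<mu> {s<..} = ennreal (exp (- s / \<epsilon>))"
proof -
  assume s: "0 \<le> s"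
  have "{s<..} \<in> sets \<mu>" unfolding sets_wed
    using s by (subst sets_restrict_space_iff) auto
  then have "emeasure \<mu> {s<..} = (\<integral>\<^sup>+x. indicator {s<..} x \<partial>\<mu>)" by (simp add: nn_integral_indicator)
  with nn_integral_wed_exp_tail[of 0 s] s show ?thesis by simp
qed

lemma prob_space_wed: "emeasure \<mu> (space \<mu>) = 1"
  using emeasure_wed_tail[of 0] by simp

lemma finite_measure_wed: "finite_measure \<mu>"
  by (rule finite_measureI) (simp add: prob_space_wed del: space_wed)

lemma nn_integral_wed_const: "(\<integral>\<^sup>+x. c \<partial>\<mu>) = c"
  by (simp add: prob_space_wed del: space_wed)

lemma nn_integral_wed_exp_initial:
  assumes t: "0 \<le> t"
  shows "(\<integral>\<^sup>+x. indicator {..<t} x * ennreal (exp (3 * x / (2 * \<epsilon>))) \<partial>\<mu>) \<le> ennreal (2 * exp (t / (2 * \<epsilon>)))"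
proof -
  have "(\<integral>\<^sup>+x. indicator {..<t} x * ennreal (exp (3 * x / (2 * \<epsilon>))) \<partial>\<mu>) =
      (\<integral>\<^sup>+x. ennreal (exp (- x / \<epsilon>) / \<epsilon>) * (indicator {..<t} x * ennreal (exp (3 * x / (2 * \<epsilon>)))) * indicator {0<..} x \<partial>lborel)"
    by (rule nn_integral_wed_lborel) measurable
  also have "\<dots> \<le> (\<integral>\<^sup>+x. ennreal (exp (x / (2 * \<epsilon>)) / \<epsilon>) * indicator {0..t} x \<partial>lborel)"
  proof (rule nn_integral_mono)
    fix x
    have "exp (x / (2 * \<epsilon>)) / \<epsilon> = exp (- x / \<epsilon>) / \<epsilon> * exp (3 * x / (2 * \<epsilon>))"
      using eps by (simp add: field_simps flip: exp_add)
    then show "ennreal (exp (- x / \<epsilon>) / \<epsilon>) * (indicator {..<t} x * ennreal (exp (3 * x / (2 * \<epsilon>)))) * indicator {0<..} x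
        \<le> ennreal (exp (x / (2 * \<epsilon>)) / \<epsilon>) * indicator {0..t} x"
      using eps by (auto simp: indicator_def simp flip: ennreal_mult)
  qed
  also have "\<dots> = ennreal (2 * exp (t / (2 * \<epsilon>)) - 2 * exp (0 / (2 * \<epsilon>)))"
    using t eps by (intro nn_integral_FTC_Icc) (auto intro!: derivative_eq_intros simp: field_simps)
  also have "\<dots> \<le> ennreal (2 * exp (t / (2 * \<epsilon>)))" by (rule ennreal_leI) simp
  finally show ?thesis .
qed

lemma square_integrable_wed_iff:
  "square_integrable \<mu> f \<longleftrightarrow> f \<in> borel_measurable \<mu> \<and> (\<integral>\<^sup>+x. ennreal ((f x)\<^sup>2) \<partial>\<mu>) < \<infinity>"
  by (auto simp: square_integrable_def integrable_iff_bounded)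

lemma square_integrable_wed_interval:
  assumes f: "square_integrable \<mu> f"
  shows "square_integrable (lebesgue_on {0..b}) f"
proof -
  have fm: "f \<in> borel_measurable (lebesgue_on {0<..})"
    using f by (simp add: square_integrable_def measurable_wed)
  have "(\<lambda>x. if x \<in> {0<..} then f x else 0) \<in> borel_measurable lebesgue"
    by (rule borel_measurable_if_I[OF fm]) simp
  then have "(\<lambda>x. if x \<in> {0<..} then f x else 0) \<in> borel_measurable (lebesgue_on {0..b})"
    by (rule measurable_restrict_space1)
  then have meas: "f \<in> borel_measurable (lebesgue_on {0..b})"
    by (rule borel_measurable_lebesgue_on_spike[where N = "{0}"]) auto
  have "AE x in lebesgue. x \<noteq> (0::real)"
    using AE_lborel_singleton[of 0] by (rule AE_completion)
  then have "AE x in lebesgue. ennreal ((f x)\<^sup>2) * indicator {0..b} x \<le>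
      ennreal (\<epsilon> * exp (b / \<epsilon>)) * (ennreal (exp (- x / \<epsilon>) / \<epsilon>) * ennreal ((f x)\<^sup>2)) * indicator {0<..} x"
  proof eventually_elim
    case (elim x)
    have "1 * (f x)\<^sup>2 \<le> exp ((b - x) / \<epsilon>) * (f x)\<^sup>2" if "x \<le> b"
      using that eps by (intro mult_right_mono) auto
    moreover have "exp ((b - x) / \<epsilon>) * (f x)\<^sup>2 = \<epsilon> * exp (b / \<epsilon>) * (exp (- x / \<epsilon>) / \<epsilon> * (f x)\<^sup>2)"
    proof -
      have "exp ((b - x) / \<epsilon>) = exp (b / \<epsilon>) * exp (- x / \<epsilon>)"
        by (simp add: diff_divide_distrib flip: exp_add)
      then show ?thesis using eps by simp
    qed
    ultimately show ?case
      using elim eps by (auto simp: indicator_def ennreal_mult[symmetric] intro!: ennreal_leI)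
  qed
  then have "(\<integral>\<^sup>+x. ennreal ((f x)\<^sup>2) \<partial>lebesgue_on {0..b}) \<le>
     (\<integral>\<^sup>+x. ennreal (\<epsilon> * exp (b / \<epsilon>)) * (ennreal (exp (- x / \<epsilon>) / \<epsilon>) * ennreal ((f x)\<^sup>2)) \<partial>lebesgue_on {0<..})"
    by (simp add: nn_integral_restrict_space nn_integral_mono_AE)
  also have "\<dots> = ennreal (\<epsilon> * exp (b / \<epsilon>)) * (\<integral>\<^sup>+x. ennreal ((f x)\<^sup>2) \<partial>\<mu>)"
  proof -
    have "(\<lambda>x. ennreal (exp (- x / \<epsilon>) / \<epsilon>) * ennreal ((f x)\<^sup>2)) \<in> borel_measurable (lebesgue_on {0<..})"
      using fm wed_density_measurable by measurable
    moreover have "(\<lambda>x. ennreal ((f x)\<^sup>2)) \<in> borel_measurable \<mu>"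
      using fm by (simp add: measurable_wed)
    ultimately show ?thesis by (simp add: nn_integral_cmult nn_integral_wed)
  qed
  also have "\<dots> < \<infinity>"
    using f by (auto simp: square_integrable_wed_iff ennreal_mult_less_top)
  finally show ?thesis
    using meas by (auto simp: square_integrable_def integrable_iff_bounded)
qed

text \<open>
  The factor \<open>\<epsilon> * exp (x / \<epsilon>)\<close> cancels the density of \<open>\<mu>\<close>. Integrals over a compact interval thus are pairings
  in \<open>L\<^sup>2(\<mu>)\<close>, against which weak cluster points can be tested.
\<close>
lemma interval_weight:
  fixes s t :: real
  shows "square_integrable \<mu> (\<lambda>x. indicator {s..t} x * (\<epsilon> * exp (x / \<epsilon>)))"
proof (rule finite_measure.square_integrable_bounded[OF finite_measure_wed])
  show "(\<lambda>x. indicator {s..t} x * (\<epsilon> * exp (x / \<epsilon>))) \<in> borel_measurable \<mu>"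
    by (rule wed_borel_measurable) measurable
  show "\<bar>indicator {s..t} x * (\<epsilon> * exp (x / \<epsilon>))\<bar> \<le> \<epsilon> * exp (t / \<epsilon>)" for x
    using eps by (auto simp: indicator_def divide_right_mono)
qed

lemma integral_interval_wed:
  assumes f: "square_integrable \<mu> f" and s: "0 \<le> s"
  shows "(\<integral>x. f x * (indicator {s..t} x * (\<epsilon> * exp (x / \<epsilon>))) \<partial>\<mu>) = integral {s..t} f"
proof -
  have fm: "f \<in> borel_measurable (lebesgue_on {0<..})"
    using f by (simp add: square_integrable_def measurable_wed)
  have "(\<integral>x. f x * (indicator {s..t} x * (\<epsilon> * exp (x / \<epsilon>))) \<partial>\<mu>) =
     (\<integral>x. (exp (- x / \<epsilon>) / \<epsilon>) *\<^sub>R (f x * (indicator {s..t} x * (\<epsilon> * exp (x / \<epsilon>)))) \<partial>lebesgue_on {0<..})"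
    unfolding wed_measure_def
  proof (rule integral_density)
    have "(\<lambda>x. indicator {s..t} x * (\<epsilon> * exp (x / \<epsilon>))) \<in> borel_measurable (lebesgue_on {0<..})"
      by (rule lebesgue_on_borel_measurable) measurable
    with fm show "(\<lambda>x. f x * (indicator {s..t} x * (\<epsilon> * exp (x / \<epsilon>)))) \<in> borel_measurable (lebesgue_on {0<..})"
      by (rule borel_measurable_times)
  qed (use eps wed_density_measurable in auto)
  also have "\<dots> = (\<integral>x. indicator {s..t} x * f x \<partial>lebesgue_on {0<..})"
    using eps by (intro Bochner_Integration.integral_cong) (auto simp: exp_minus field_simps)
  also have "\<dots> = (\<integral>x. indicator {0<..} x *\<^sub>R (indicator {s..t} x * f x) \<partial>lebesgue)"
    by (rule integral_restrict_space) simp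
  also have "\<dots> = (\<integral>x. indicator {s..t} x *\<^sub>R f x \<partial>lebesgue)"
  proof (rule Bochner_Integration.integral_cong_AE)
    have F: "(\<lambda>x. if x \<in> {0<..} then f x else 0) \<in> borel_measurable lebesgue"
      by (rule borel_measurable_if_I[OF fm]) simp
    have I: "(indicator A :: real \<Rightarrow> real) \<in> borel_measurable lebesgue" if "A \<in> sets lebesgue" for A
      using that by (rule borel_measurable_indicator)
    have "(\<lambda>x. indicator {s..t} x * (if x \<in> {0<..} then f x else 0)) \<in> borel_measurable lebesgue"
      by (intro borel_measurable_times F I) simp
    moreover have "(\<lambda>x. indicator {s..t} x * (if x \<in> {0<..} then f x else 0)) = (\<lambda>x. indicator {0<..} x *\<^sub>R (indicator {s..t} x * f x))"
      by (auto simp: indicator_def)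
    ultimately show 1: "(\<lambda>x. indicator {0<..} x *\<^sub>R (indicator {s..t} x * f x)) \<in> borel_measurable lebesgue" by simp
    have ae: "AE x in lebesgue. x \<noteq> (0::real)"
      using AE_lborel_singleton[of 0] by (rule AE_completion)
    show "AE x in lebesgue. indicator {0<..} x *\<^sub>R (indicator {s..t} x * f x) = indicator {s..t} x *\<^sub>R f x"
      using ae by eventually_elim (use s in \<open>auto simp: indicator_def\<close>)
    have "(\<lambda>x. indicator {0<..} x *\<^sub>R (indicator {s..t} x * f x)) \<in> borel_measurable (lebesgue_on UNIV)"
      using 1 by (simp add: lebesgue_on_UNIV_eq)
    then have "(\<lambda>x. indicator {s..t} x *\<^sub>R f x) \<in> borel_measurable (lebesgue_on UNIV)"
      by (rule borel_measurable_lebesgue_on_spike[where N = "{0}"]) (use s in \<open>auto simp: indicator_def\<close>)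
    then show "(\<lambda>x. indicator {s..t} x *\<^sub>R f x) \<in> borel_measurable lebesgue"
      by (simp add: lebesgue_on_UNIV_eq)
  qed
  also have "\<dots> = (\<integral>x. f x \<partial>lebesgue_on {s..t})"
    by (rule integral_restrict_space[symmetric]) simp
  also have "\<dots> = integral {s..t} f"
    using integrable_lebesgue_on_subinterval(3)[OF square_integrable_interval_integrable[OF square_integrable_wed_interval[OF f]] s]
    by blast
  finally show ?thesis .
qed

section \<open>Lower semicontinuity of weighted actions\<close>

abbreviation md :: "(real \<Rightarrow> 'a::metric_space) \<Rightarrow> real \<Rightarrow> real" where
  "md \<equiv> metric_deriv {0..}"

abbreviation action :: "(real \<Rightarrow> 'a::metric_space) \<Rightarrow> ennreal" where
  "action u \<equiv> \<integral>\<^sup>+t. ennreal ((md u t)\<^sup>2) \<partial>\<mu>"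

lemma md_measurable: "AC2_loc {0..} u \<Longrightarrow> md u \<in> borel_measurable \<mu>"
  using metric_deriv_measurable by (simp add: measurable_wed)

lemma AE_md: "AC2_loc {0..} u \<Longrightarrow> AE t in \<mu>. has_metric_deriv {0..} u (md u t) t \<and> 0 \<le> md u t"
  using AE_has_metric_deriv by (simp add: AE_wed)

lemma md_square_integrable:
  "AC2_loc {0..} u \<Longrightarrow> action u < \<infinity> \<Longrightarrow> square_integrable \<mu> (md u)"
  by (simp add: square_integrable_wed_iff md_measurable)

lemma square_integrable_weighted:
  assumes f: "square_integrable \<mu> f" and w: "w \<in> borel_measurable \<mu>" "\<And>x. 0 \<le> w x \<and> w x \<le> K"
  shows "square_integrable \<mu> (\<lambda>x. w x * f x)"
proof (rule square_integrable_bound[OF square_integrable_cmult[OF f, of K]])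
  show "(\<lambda>x. w x * f x) \<in> borel_measurable \<mu>"
    by (rule borel_measurable_times[OF w(1) square_integrable_measurable[OF f]])
  show "AE x in \<mu>. \<bar>w x * f x\<bar> \<le> \<bar>K * f x\<bar>"
  proof (rule AE_I2)
    fix x show "\<bar>w x * f x\<bar> \<le> \<bar>K * f x\<bar>"
      using w(2)[of x] by (auto simp: abs_mult intro!: mult_right_mono)
  qed
qed

lemma nn_integral_weighted:
  assumes f: "square_integrable \<mu> f" and w: "w \<in> borel_measurable \<mu>" "\<And>x. 0 \<le> w x \<and> w x \<le> K"
  shows "integrable \<mu> (\<lambda>x. w x * (f x)\<^sup>2)"
    "(\<integral>\<^sup>+x. ennreal (w x * (f x)\<^sup>2) \<partial>\<mu>) = ennreal (\<integral>x. w x * (f x)\<^sup>2 \<partial>\<mu>)"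
proof -
  have "integrable \<mu> (\<lambda>x. f x * (w x * f x))"
    by (intro square_integrable_mult f square_integrable_weighted[OF f w])
  then show 1: "integrable \<mu> (\<lambda>x. w x * (f x)\<^sup>2)"
    by (simp add: power2_eq_square mult.left_commute)
  show "(\<integral>\<^sup>+x. ennreal (w x * (f x)\<^sup>2) \<partial>\<mu>) = ennreal (\<integral>x. w x * (f x)\<^sup>2 \<partial>\<mu>)"
    by (rule nn_integral_eq_integral[OF 1]) (use w in auto)
qed

text \<open>
  Let \<open>m\<close> be a weak cluster point of the metric derivatives. Pairing with the weights of intervals gives
  \<open>dist (u s) (u t) \<le> \<integral>m\<close>, so \<open>u\<close> is absolutely continuous and \<open>md u \<le> |m|\<close>. Pairing with \<open>- w * m\<close> and
  \<open>2 * f * m \<le> f\<^sup>2 + m\<^sup>2\<close> gives \<open>W \<le> (c + W) / 2\<close> for \<open>W = \<integral>w * m\<^sup>2\<close>, that is, \<open>W \<le> c\<close>.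
\<close>
lemma limit_curve:
  fixes u :: "real \<Rightarrow> 'a::metric_space"
  assumes v: "\<And>n. AC2_loc {0..} (v n)" and C: "\<And>n. action (v n) \<le> ennreal C"
    and lim: "\<And>s t. 0 \<le> s \<Longrightarrow> s \<le> t \<Longrightarrow>
       ereal (dist (u s) (u t)) \<le> liminf (\<lambda>n. ereal (dist (v n s) (v n t)))"
  obtains "AC2_loc {0..} u"
    "\<And>w K c. w \<in> borel_measurable \<mu> \<Longrightarrow> (\<And>x. 0 \<le> w x \<and> w x \<le> K) \<Longrightarrow> 0 \<le> c \<Longrightarrow>
       \<forall>\<^sub>F n in sequentially. (\<integral>\<^sup>+x. ennreal (w x * (md (v n) x)\<^sup>2) \<partial>\<mu>) \<le> ennreal c \<Longrightarrow>
       (\<integral>\<^sup>+x. ennreal (w x * (md u x)\<^sup>2) \<partial>\<mu>) \<le> ennreal c"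
proof -
  interpret finite_measure \<mu> by (rule finite_measure_wed)
  have sq: "square_integrable \<mu> (md (v n))" for n
    using C[of n] by (intro md_square_integrable v) (auto intro: le_less_trans)
  have bd: "(\<integral>x. (md (v n) x)\<^sup>2 \<partial>\<mu>) \<le> max C 0" for n
  proof -
    have "ennreal (\<integral>x. (md (v n) x)\<^sup>2 \<partial>\<mu>) = action (v n)"
      by (rule nn_integral_eq_integral[symmetric, OF square_integrable_power2[OF sq]]) simp
    also have "\<dots> \<le> ennreal (max C 0)" by (rule order_trans[OF C ennreal_leI]) simp
    finally show ?thesis by (subst (asm) ennreal_le_iff) auto
  qed
  obtain m where m: "square_integrable \<mu> m"
    "\<And>g c. square_integrable \<mu> g \<Longrightarrow> \<forall>\<^sub>F n in sequentially. c \<le> (\<integral>t. md (v n) t * g t \<partial>\<mu>) \<Longrightarrow>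
        c \<le> (\<integral>t. m t * g t \<partial>\<mu>)"
    by (rule square_integrable_weak_cluster[OF sq bd], rule that)
  have dm: "dist (u s) (u t) \<le> integral {s..t} m" if st: "0 \<le> s" "s \<le> t" for s t
  proof (rule field_le_epsilon)
    fix e :: real assume "e > 0"
    then have "ereal (dist (u s) (u t) - e) < liminf (\<lambda>n. ereal (dist (v n s) (v n t)))"
      by (intro less_le_trans[OF _ lim[OF st]]) simp
    then have "\<forall>\<^sub>F n in sequentially. ereal (dist (u s) (u t) - e) < ereal (dist (v n s) (v n t))"
      by (rule less_LiminfD)
    then have "\<forall>\<^sub>F n in sequentially. dist (u s) (u t) - e \<le>
        (\<integral>x. md (v n) x * (indicator {s..t} x * (\<epsilon> * exp (x / \<epsilon>))) \<partial>\<mu>)"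
    proof eventually_elim
      case (elim n)
      with dist_le_integral_metric_deriv[OF v st, of n] show ?case
        by (simp add: integral_interval_wed[OF sq st(1)])
    qed
    from m(2)[OF interval_weight this] show "dist (u s) (u t) \<le> integral {s..t} m + e"
      by (simp add: integral_interval_wed[OF m(1) st(1)])
  qed
  have u: "AC2_loc {0..} u"
    by (rule AC2_locI[OF square_integrable_wed_interval[OF m(1)] dm])
  have mi: "m integrable_on {0..b}" for b
    using integrable_lebesgue_on_subinterval(2)[OF square_integrable_interval_integrable[OF
        square_integrable_wed_interval[OF m(1)]], of 0 b b] by simp
  have le: "AE x in \<mu>. md u x \<le> \<bar>m x\<bar>"
    unfolding AE_wed by (rule AE_metric_deriv_le[OF u mi dm])
  show ?thesis
  proof (rule that[OF u])
    fix w :: "real \<Rightarrow> real" and K c :: real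
    assume w: "w \<in> borel_measurable \<mu>" "\<And>x. 0 \<le> w x \<and> w x \<le> K" and c: "0 \<le> c"
      and ev: "\<forall>\<^sub>F n in sequentially. (\<integral>\<^sup>+x. ennreal (w x * (md (v n) x)\<^sup>2) \<partial>\<mu>) \<le> ennreal c"
    define W where "W = (\<integral>x. w x * (m x)\<^sup>2 \<partial>\<mu>)"
    have "\<forall>\<^sub>F n in sequentially. - (c + W) / 2 \<le> (\<integral>x. md (v n) x * (- 1 * (w x * m x)) \<partial>\<mu>)"
      using ev
    proof eventually_elim
      case (elim n)
      have "(\<integral>x. w x * (md (v n) x)\<^sup>2 \<partial>\<mu>) \<le> c"
        using elim c by (simp add: nn_integral_weighted(2)[OF sq w])
      moreover have "(\<integral>x. md (v n) x * (w x * m x) \<partial>\<mu>) \<le> (\<integral>x. (w x * (md (v n) x)\<^sup>2 + w x * (m x)\<^sup>2) / 2 \<partial>\<mu>)"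
      proof (rule integral_mono)
        show "integrable \<mu> (\<lambda>x. md (v n) x * (w x * m x))"
          by (intro square_integrable_mult sq square_integrable_weighted[OF m(1) w])
        show "integrable \<mu> (\<lambda>x. (w x * (md (v n) x)\<^sup>2 + w x * (m x)\<^sup>2) / 2)"
          using nn_integral_weighted(1)[OF sq w] nn_integral_weighted(1)[OF m(1) w] by simp
        fix x
        have "w x * (2 * (md (v n) x * m x)) \<le> w x * ((md (v n) x)\<^sup>2 + (m x)\<^sup>2)"
          using w(2)[of x] two_mult_le_squares[of "md (v n) x" "m x"] by (intro mult_left_mono) auto
        then show "md (v n) x * (w x * m x) \<le> (w x * (md (v n) x)\<^sup>2 + w x * (m x)\<^sup>2) / 2"
          by (simp add: algebra_simps)
      qed
      moreover have "(\<integral>x. (w x * (md (v n) x)\<^sup>2 + w x * (m x)\<^sup>2) / 2 \<partial>\<mu>) = ((\<integral>x. w x * (md (v n) x)\<^sup>2 \<partial>\<mu>) + W) / 2"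
        using nn_integral_weighted(1)[OF sq w] nn_integral_weighted(1)[OF m(1) w] by (simp add: W_def)
      ultimately show ?case by simp
    qed
    from m(2)[OF square_integrable_cmult[OF square_integrable_weighted[OF m(1) w]] this]
    have "- (c + W) / 2 \<le> - W" by (simp add: W_def power2_eq_square mult.left_commute)
    then have "W \<le> c" by simp
    have "(\<integral>\<^sup>+x. ennreal (w x * (md u x)\<^sup>2) \<partial>\<mu>) \<le> (\<integral>\<^sup>+x. ennreal (w x * (m x)\<^sup>2) \<partial>\<mu>)"
    proof (rule nn_integral_mono_AE)
      show "AE x in \<mu>. ennreal (w x * (md u x)\<^sup>2) \<le> ennreal (w x * (m x)\<^sup>2)"
        using le AE_md[OF u]
      proof eventually_elim
        case (elim x)
        then have "(md u x)\<^sup>2 \<le> (m x)\<^sup>2" by (intro abs_le_square_iff[THEN iffD1]) auto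
        with w(2)[of x] show ?case by (intro ennreal_leI mult_left_mono) auto
      qed
    qed
    also have "\<dots> \<le> ennreal c"
      using \<open>W \<le> c\<close> by (subst nn_integral_weighted(2)[OF m(1) w]) (auto simp: W_def intro: ennreal_leI)
    finally show "(\<integral>\<^sup>+x. ennreal (w x * (md u x)\<^sup>2) \<partial>\<mu>) \<le> ennreal c" .
  qed
qed

text \<open>
  The cluster point depends on the sequence, while the bound on the metric derivative of \<open>u\<close> does not.
  It is therefore legitimate to pass to a subsequence along which the weighted actions stay below a
  value that contradicts the claim.
\<close>
theorem weighted_action_lsc:
  fixes u :: "real \<Rightarrow> 'a::metric_space"
  assumes v: "\<And>n. AC2_loc {0..} (v n)" and C: "\<And>n. action (v n) \<le> ennreal C"
    and lim: "\<And>s t. 0 \<le> s \<Longrightarrow> s \<le> t \<Longrightarrow>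
       ereal (dist (u s) (u t)) \<le> liminf (\<lambda>n. ereal (dist (v n s) (v n t)))"
    and w: "w \<in> borel_measurable \<mu>" "\<And>x. 0 \<le> w x \<and> w x \<le> K"
  shows "(\<integral>\<^sup>+x. ennreal (w x * (md u x)\<^sup>2) \<partial>\<mu>) \<le> liminf (\<lambda>n. \<integral>\<^sup>+x. ennreal (w x * (md (v n) x)\<^sup>2) \<partial>\<mu>)"
    (is "?X \<le> liminf ?Y")
proof (rule ccontr)
  assume "\<not> ?thesis"
  then obtain c where c: "liminf ?Y < c" "c < ?X" by (meson dense not_le)
  then have ctop: "c < top" using top.not_eq_extremum by (metis top_greatest less_le_trans)
  have "\<not> (\<forall>\<^sub>F n in sequentially. c \<le> ?Y n)"
    using Liminf_bounded[of c ?Y sequentially] c(1) by auto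
  from not_eventually_sequentiallyD[OF this]
  obtain r :: "nat \<Rightarrow> nat" where r: "strict_mono r" "\<And>n. \<not> c \<le> ?Y (r n)" by blast
  have lim': "ereal (dist (u s) (u t)) \<le> liminf (\<lambda>n. ereal (dist (v (r n) s) (v (r n) t)))"
    if "0 \<le> s" "s \<le> t" for s t
    using order_trans[OF lim[OF that] liminf_subseq_mono[OF r(1)]] by (simp add: o_def)
  have "?X \<le> ennreal (enn2real c)"
  proof (rule limit_curve[of "\<lambda>n. v (r n)" C u])
    assume "\<And>w K c. w \<in> borel_measurable \<mu> \<Longrightarrow> (\<And>x. 0 \<le> w x \<and> w x \<le> K) \<Longrightarrow> 0 \<le> c \<Longrightarrow>
       \<forall>\<^sub>F n in sequentially. (\<integral>\<^sup>+x. ennreal (w x * (md (v (r n)) x)\<^sup>2) \<partial>\<mu>) \<le> ennreal c \<Longrightarrow>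
       (\<integral>\<^sup>+x. ennreal (w x * (md u x)\<^sup>2) \<partial>\<mu>) \<le> ennreal c"
    from this[OF w, of "enn2real c"] show ?thesis
      using r(2) ctop by (simp add: not_le less_imp_le)
  qed (use v C lim' in auto)
  with c ctop show False by simp
qed

section \<open>A pointwise Hardy inequality and equicontinuity\<close>

text \<open>
  \<open>hardy u t\<close> dominates the squared distance between \<open>u 0\<close> and \<open>u t\<close> and is integrable in \<open>t\<close>. A bound in terms
  of the action over the whole half-line would grow like \<open>exp (t / \<epsilon>)\<close>, which is not \<open>\<mu>\<close>-integrable.
\<close>
definition hardy_weight :: "real \<Rightarrow> real \<Rightarrow> real" where
  "hardy_weight t s = 2 * \<epsilon>\<^sup>2 * exp ((t + s) / (2 * \<epsilon>)) * indicator {..<t} s"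

definition hardy :: "(real \<Rightarrow> 'a::metric_space) \<Rightarrow> real \<Rightarrow> ennreal" where
  "hardy u t = (\<integral>\<^sup>+s. ennreal (hardy_weight t s * (md u s)\<^sup>2) \<partial>\<mu>)"

lemma hardy_weight_bounds: "0 \<le> hardy_weight t s \<and> hardy_weight t s \<le> 2 * \<epsilon>\<^sup>2 * exp (t / \<epsilon>)"
  using eps by (auto simp: hardy_weight_def indicator_def field_simps)

lemma hardy_weight_measurable: "hardy_weight t \<in> borel_measurable \<mu>"
  unfolding hardy_weight_def[abs_def] by (rule wed_borel_measurable) measurable

lemma hardy_pair_measurable:
  assumes u: "AC2_loc {0..} u"
  shows "(\<lambda>(t, s). ennreal (hardy_weight t s * (md u s)\<^sup>2)) \<in> borel_measurable (\<mu> \<Otimes>\<^sub>M \<mu>)"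
proof -
  have [measurable]: "(\<lambda>x. x) \<in> borel_measurable \<mu>" by (rule wed_borel_measurable) simp
  have [measurable]: "md u \<in> borel_measurable \<mu>" by (rule md_measurable[OF u])
  have [measurable]: "fst \<in> borel_measurable (\<mu> \<Otimes>\<^sub>M \<mu>)" "snd \<in> borel_measurable (\<mu> \<Otimes>\<^sub>M \<mu>)"
    using measurable_compose[OF measurable_fst[of \<mu> \<mu>], of "\<lambda>x. x" borel]
      measurable_compose[OF measurable_snd[of \<mu> \<mu>], of "\<lambda>x. x" borel] by simp_all
  have "(\<lambda>p. ennreal (2 * \<epsilon>\<^sup>2 * exp ((fst p + snd p) / (2 * \<epsilon>)) * (if snd p < fst p then 1 else 0) * (md u (snd p))\<^sup>2))
      \<in> borel_measurable (\<mu> \<Otimes>\<^sub>M \<mu>)" by measurable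
  then show ?thesis
    by (rule measurable_cong[THEN iffD1, rotated]) (auto simp: hardy_weight_def indicator_def)
qed

lemma sigma_finite_wed: "sigma_finite_measure \<mu>"
  using finite_measure_wed by (simp add: finite_measure_def)

lemma hardy_measurable: "AC2_loc {0..} u \<Longrightarrow> hardy u \<in> borel_measurable \<mu>"
  unfolding hardy_def[abs_def]
  by (intro sigma_finite_measure.borel_measurable_nn_integral sigma_finite_wed hardy_pair_measurable)

lemma nn_integral_hardy:
  assumes u: "AC2_loc {0..} u"
  shows "(\<integral>\<^sup>+t. hardy u t \<partial>\<mu>) = ennreal (4 * \<epsilon>\<^sup>2) * action u"
proof -
  interpret pair_sigma_finite \<mu> \<mu> by (simp add: pair_sigma_finite_def sigma_finite_wed)
  have "(\<integral>\<^sup>+t. hardy u t \<partial>\<mu>) = (\<integral>\<^sup>+s. \<integral>\<^sup>+t. ennreal (hardy_weight t s * (md u s)\<^sup>2) \<partial>\<mu> \<partial>\<mu>)"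
    unfolding hardy_def by (rule Fubini'[symmetric]) (rule hardy_pair_measurable[OF u])
  also have "\<dots> = (\<integral>\<^sup>+s. ennreal (4 * \<epsilon>\<^sup>2) * ennreal ((md u s)\<^sup>2) \<partial>\<mu>)"
  proof (rule nn_integral_cong)
    fix s assume "s \<in> space \<mu>"
    then have s: "0 < s" by simp
    have "(\<integral>\<^sup>+t. ennreal (hardy_weight t s * (md u s)\<^sup>2) \<partial>\<mu>) =
       (\<integral>\<^sup>+t. ennreal (2 * \<epsilon>\<^sup>2 * exp (s / (2 * \<epsilon>)) * (md u s)\<^sup>2) * (indicator {s<..} t * ennreal (exp (1 / (2 * \<epsilon>) * t))) \<partial>\<mu>)"
      by (intro nn_integral_cong)
         (auto simp: hardy_weight_def indicator_def add_divide_distrib exp_add algebra_simps simp flip: ennreal_mult)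
    also have "\<dots> = ennreal (2 * \<epsilon>\<^sup>2 * exp (s / (2 * \<epsilon>)) * (md u s)\<^sup>2) *
        (\<integral>\<^sup>+t. indicator {s<..} t * ennreal (exp (1 / (2 * \<epsilon>) * t)) \<partial>\<mu>)"
      by (rule nn_integral_cmult, rule wed_borel_measurable) measurable
    also have "(\<integral>\<^sup>+t. indicator {s<..} t * ennreal (exp (1 / (2 * \<epsilon>) * t)) \<partial>\<mu>) =
        ennreal (exp ((1 / (2 * \<epsilon>) - 1 / \<epsilon>) * s) / (1 - 1 / (2 * \<epsilon>) * \<epsilon>))"
      by (rule nn_integral_wed_exp_tail) (use eps s in auto)
    also have "exp ((1 / (2 * \<epsilon>) - 1 / \<epsilon>) * s) / (1 - 1 / (2 * \<epsilon>) * \<epsilon>) = 2 * exp (- (s / (2 * \<epsilon>)))"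
      using eps by (simp add: field_simps)
    finally show "(\<integral>\<^sup>+t. ennreal (hardy_weight t s * (md u s)\<^sup>2) \<partial>\<mu>) = ennreal (4 * \<epsilon>\<^sup>2) * ennreal ((md u s)\<^sup>2)"
      by (simp add: exp_minus field_simps flip: ennreal_mult)
  qed
  also have "\<dots> = ennreal (4 * \<epsilon>\<^sup>2) * action u"
    using md_measurable[OF u] by (intro nn_integral_cmult) auto
  finally show ?thesis .
qed

lemma AE_wed_neq: "AE x in \<mu>. x \<noteq> t"
proof -
  have "AE x in lebesgue. x \<noteq> t" using AE_lborel_singleton[of t] by (rule AE_completion)
  then show ?thesis unfolding AE_wed by (subst AE_restrict_space_iff) auto
qed

text \<open>
  Cauchy-Schwarz for \<open>\<integral>|u'|\<close> over \<open>(0, t)\<close>, with the weight \<open>exp (x / \<epsilon>)\<close> that cancels the density of \<open>\<mu>\<close> divided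
  between the factors \<open>a\<close> and \<open>b\<close> with the exponents 1/4 and 3/4.
\<close>
lemma dist_square_le_hardy:
  assumes u: "AC2_loc {0..} u" "action u < \<infinity>" and t: "0 \<le> t"
  shows "ennreal ((dist (u 0) (u t))\<^sup>2) \<le> hardy u t"
proof -
  note sq = md_square_integrable[OF u]
  have [measurable]: "md u \<in> borel_measurable \<mu>" by (rule md_measurable[OF u(1)])
  define a where "a x = ennreal (indicator {..<t} x * (exp (x / (4 * \<epsilon>)) * \<bar>md u x\<bar>))" for x
  define b where "b x = ennreal (indicator {..<t} x * (\<epsilon> * exp (3 * x / (4 * \<epsilon>))))" for x
  have ind: "(\<lambda>x. indicator {..<t} x * f x) \<in> borel_measurable \<mu>" if "f \<in> borel_measurable \<mu>" for f :: "real \<Rightarrow> real"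
  proof (rule borel_measurable_times[OF _ that])
    show "(indicator {..<t} :: real \<Rightarrow> real) \<in> borel_measurable \<mu>"
      by (rule wed_borel_measurable) measurable
  qed
  have am [measurable]: "a \<in> borel_measurable \<mu>"
  proof -
    have "(\<lambda>x. exp (x / (4 * \<epsilon>))) \<in> borel_measurable \<mu>" by (rule wed_borel_measurable) measurable
    then show ?thesis unfolding a_def[abs_def]
      by (intro measurable_compose[OF _ measurable_ennreal] ind borel_measurable_times) auto
  qed
  have bm [measurable]: "b \<in> borel_measurable \<mu>"
    unfolding b_def[abs_def] by (rule wed_borel_measurable) measurable
  have "dist (u 0) (u t) \<le> (\<integral>x. md u x * (indicator {0..t} x * (\<epsilon> * exp (x / \<epsilon>))) \<partial>\<mu>)"
    using dist_le_integral_metric_deriv[OF u(1), of 0 t] t by (simp add: integral_interval_wed[OF sq])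
  then have "ennreal (dist (u 0) (u t)) \<le> ennreal (\<integral>x. md u x * (indicator {0..t} x * (\<epsilon> * exp (x / \<epsilon>))) \<partial>\<mu>)"
    by (rule ennreal_leI)
  also have "\<dots> \<le> (\<integral>\<^sup>+x. ennreal \<bar>md u x * (indicator {0..t} x * (\<epsilon> * exp (x / \<epsilon>)))\<bar> \<partial>\<mu>)"
  proof -
    have "integrable \<mu> (\<lambda>x. md u x * (indicator {0..t} x * (\<epsilon> * exp (x / \<epsilon>))))"
      by (intro square_integrable_mult sq interval_weight)
    from integral_norm_bound_ennreal[OF this]
    have "ennreal \<bar>\<integral>x. md u x * (indicator {0..t} x * (\<epsilon> * exp (x / \<epsilon>))) \<partial>\<mu>\<bar> \<le>
        (\<integral>\<^sup>+x. ennreal \<bar>md u x * (indicator {0..t} x * (\<epsilon> * exp (x / \<epsilon>)))\<bar> \<partial>\<mu>)" by simp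
    then show ?thesis by (rule order_trans[rotated]) (rule ennreal_leI, simp)
  qed
  also have "\<dots> = (\<integral>\<^sup>+x. a x * b x \<partial>\<mu>)"
  proof (rule nn_integral_cong_AE)
    show "AE x in \<mu>. ennreal \<bar>md u x * (indicator {0..t} x * (\<epsilon> * exp (x / \<epsilon>)))\<bar> = a x * b x"
      using AE_wed_neq[of t] AE_space
    proof eventually_elim
      case (elim x)
      have "exp (x / \<epsilon>) = exp (x / (4 * \<epsilon>)) * exp (3 * x / (4 * \<epsilon>))"
        using eps by (simp add: field_simps flip: exp_add)
      with elim eps show ?case
        by (auto simp: a_def b_def indicator_def abs_mult algebra_simps simp flip: ennreal_mult)
    qed
  qed
  finally have "(ennreal (dist (u 0) (u t)))\<^sup>2 \<le> (\<integral>\<^sup>+x. a x * b x \<partial>\<mu>)\<^sup>2"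
    by (intro power_mono) auto
  also have "\<dots> \<le> (\<integral>\<^sup>+x. (a x)\<^sup>2 \<partial>\<mu>) * (\<integral>\<^sup>+x. (b x)\<^sup>2 \<partial>\<mu>)"
    by (rule Cauchy_Schwarz_nn_integral[OF am bm])
  also have "(\<integral>\<^sup>+x. (b x)\<^sup>2 \<partial>\<mu>) = (\<integral>\<^sup>+x. ennreal (\<epsilon>\<^sup>2) * (indicator {..<t} x * ennreal (exp (3 * x / (2 * \<epsilon>)))) \<partial>\<mu>)"
    using eps by (intro nn_integral_cong)
      (auto simp: b_def indicator_def power_mult_distrib ennreal_power simp flip: ennreal_mult exp_double)
  also have "\<dots> = ennreal (\<epsilon>\<^sup>2) * (\<integral>\<^sup>+x. indicator {..<t} x * ennreal (exp (3 * x / (2 * \<epsilon>))) \<partial>\<mu>)"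
    by (rule nn_integral_cmult, rule wed_borel_measurable) measurable
  also have "(\<integral>\<^sup>+x. (a x)\<^sup>2 \<partial>\<mu>) * \<dots> \<le> (\<integral>\<^sup>+x. (a x)\<^sup>2 \<partial>\<mu>) * (ennreal (\<epsilon>\<^sup>2) * ennreal (2 * exp (t / (2 * \<epsilon>))))"
    by (intro mult_left_mono nn_integral_wed_exp_initial t) auto
  also have "\<dots> = (\<integral>\<^sup>+x. ennreal (\<epsilon>\<^sup>2 * (2 * exp (t / (2 * \<epsilon>)))) * (a x)\<^sup>2 \<partial>\<mu>)"
    by (subst nn_integral_cmult) (auto simp: mult.commute ennreal_mult)
  also have "\<dots> = hardy u t"
    unfolding hardy_def
  proof (rule nn_integral_cong)
    fix x
    have 1: "(exp (x / (4 * \<epsilon>)))\<^sup>2 = exp (x / (2 * \<epsilon>))"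
      using eps by (simp add: field_simps flip: exp_double)
    have "(a x)\<^sup>2 = ennreal ((indicator {..<t} x * (exp (x / (4 * \<epsilon>)) * \<bar>md u x\<bar>))\<^sup>2)"
      by (simp add: a_def ennreal_power)
    also have "(indicator {..<t} x * (exp (x / (4 * \<epsilon>)) * \<bar>md u x\<bar>))\<^sup>2 =
        indicator {..<t} x * (exp (x / (2 * \<epsilon>)) * (md u x)\<^sup>2)"
      by (auto simp: indicator_def power_mult_distrib 1)
    finally show "ennreal (\<epsilon>\<^sup>2 * (2 * exp (t / (2 * \<epsilon>)))) * (a x)\<^sup>2 = ennreal (hardy_weight t x * (md u x)\<^sup>2)"
      by (simp add: hardy_weight_def add_divide_distrib exp_add mult_ac flip: ennreal_mult)
  qed
  finally show ?thesis by (simp add: ennreal_power)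
qed

text \<open>
  Young's inequality with a free parameter \<open>c\<close>: small \<open>c\<close> gives equicontinuity, \<open>c = 1\<close> gives local
  boundedness.
\<close>
lemma dist_modulus:
  fixes v :: "real \<Rightarrow> 'b::metric_space"
  assumes v: "AC2_loc {0..} v" "action v \<le> ennreal C" and C: "0 \<le> C"
    and st: "0 \<le> s" "s \<le> t" and c: "0 < c"
  shows "dist (v s) (v t) \<le> (c * C + (t - s) * (\<epsilon> * exp (t / \<epsilon>)) / c) / 2"
proof -
  have "action v < \<infinity>" using v(2) by (auto intro: le_less_trans)
  note sq = md_square_integrable[OF v(1) this]
  define g where "g x = indicator {s..t} x * (\<epsilon> * exp (x / \<epsilon>))" for x
  have g: "square_integrable \<mu> g" unfolding g_def[abs_def] by (rule interval_weight)
  have "ennreal (\<integral>x. (md v x)\<^sup>2 \<partial>\<mu>) = action v"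
    by (rule nn_integral_eq_integral[symmetric, OF square_integrable_power2[OF sq]]) simp
  with v(2) C have F: "(\<integral>x. (md v x)\<^sup>2 \<partial>\<mu>) \<le> C" by (metis ennreal_le_iff)
  have "(\<integral>x. (g x)\<^sup>2 \<partial>\<mu>) = integral {s..t} g"
    using integral_interval_wed[OF g st(1), of t] by (simp add: power2_eq_square g_def)
  also have "\<dots> \<le> integral {s..t} (\<lambda>_. \<epsilon> * exp (t / \<epsilon>))"
  proof (rule integral_le)
    show "g integrable_on {s..t}"
      using integrable_lebesgue_on_subinterval(2)[OF square_integrable_interval_integrable[OF
          square_integrable_wed_interval[OF g]] st(1) order_refl] .
    show "g x \<le> \<epsilon> * exp (t / \<epsilon>)" if "x \<in> {s..t}" for x
      using that eps by (auto simp: g_def divide_right_mono)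
  qed (rule integrable_const_ivl)
  also have "\<dots> = (t - s) * (\<epsilon> * exp (t / \<epsilon>))" using st by simp
  finally have G: "(\<integral>x. (g x)\<^sup>2 \<partial>\<mu>) \<le> (t - s) * (\<epsilon> * exp (t / \<epsilon>))" .
  have "dist (v s) (v t) \<le> (\<integral>x. md v x * g x \<partial>\<mu>)"
    using dist_le_integral_metric_deriv[OF v(1) st] integral_interval_wed[OF sq st(1), of t] by (simp add: g_def)
  also have "\<dots> \<le> (c * (\<integral>x. (md v x)\<^sup>2 \<partial>\<mu>) + (\<integral>x. (g x)\<^sup>2 \<partial>\<mu>) / c) / 2"
    using integral_mult_le_Young[OF sq g c] by simp
  also have "\<dots> \<le> (c * C + (t - s) * (\<epsilon> * exp (t / \<epsilon>)) / c) / 2"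
    using F G c by (intro divide_right_mono add_mono mult_left_mono) auto
  finally show ?thesis .
qed

lemma equicontinuity:
  assumes C: "0 \<le> C" and \<eta>: "0 < \<eta>"
  obtains \<delta> where "\<delta> > 0"
    "\<And>(v :: real \<Rightarrow> 'b::metric_space) s t. AC2_loc {0..} v \<Longrightarrow> action v \<le> ennreal C \<Longrightarrow>
       s \<in> {0..T} \<Longrightarrow> t \<in> {0..T} \<Longrightarrow> \<bar>s - t\<bar> < \<delta> \<Longrightarrow> dist (v s) (v t) < \<eta>"
proof -
  define c where "c = \<eta> / (C + 1)"
  define K where "K = \<epsilon> * exp (T / \<epsilon>)"
  have c: "0 < c" "c * C < \<eta>" using C \<eta> by (auto simp: c_def field_simps)
  have K: "0 < K" using eps by (simp add: K_def)
  have main: "dist (v s) (v t) < \<eta>"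
    if v: "AC2_loc {0..} v" "action v \<le> ennreal C" and st: "0 \<le> s" "s \<le> t" "t \<le> T" "t - s < \<eta> * c / K"
    for v :: "real \<Rightarrow> 'b" and s t
  proof -
    have "(t - s) * (\<epsilon> * exp (t / \<epsilon>)) \<le> (t - s) * K"
      unfolding K_def using st eps by (intro mult_left_mono) (auto simp: divide_right_mono)
    also have "\<dots> < \<eta> * c" using st(4) K by (simp add: field_simps)
    finally have "(t - s) * (\<epsilon> * exp (t / \<epsilon>)) / c < \<eta>" using c by (simp add: field_simps)
    with dist_modulus[OF v C st(1,2) c(1)] c(2) show ?thesis by simp
  qed
  show ?thesis
  proof (rule that[of "\<eta> * c / K"])
    show "\<eta> * c / K > 0" using \<eta> c K by simp
    fix v :: "real \<Rightarrow> 'b" and s t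
    assume v: "AC2_loc {0..} v" "action v \<le> ennreal C" and st: "s \<in> {0..T}" "t \<in> {0..T}" "\<bar>s - t\<bar> < \<eta> * c / K"
    show "dist (v s) (v t) < \<eta>"
    proof (cases "s \<le> t")
      case True then show ?thesis using st by (intro main v) auto
    next
      case False
      then have "dist (v t) (v s) < \<eta>" using st by (intro main v) auto
      then show ?thesis by (simp add: dist_commute)
    qed
  qed
qed

end

section \<open>Extended real integrals\<close>

lemma ennreal_liminf_add_le:
  fixes f g :: "nat \<Rightarrow> ennreal"
  shows "liminf f + liminf g \<le> liminf (\<lambda>n. f n + g n)"
proof -
  have e: "liminf (\<lambda>n. enn2ereal (h n)) = enn2ereal (liminf h)" for h :: "nat \<Rightarrow> ennreal"
    by (rule Liminf_compose_continuous_mono)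
       (auto simp: mono_def less_eq_ennreal.rep_eq intro: continuous_on_enn2ereal)
  have "liminf (\<lambda>n. enn2ereal (f n)) + liminf (\<lambda>n. enn2ereal (g n)) \<le> liminf (\<lambda>n. enn2ereal (f n) + enn2ereal (g n))"
    by (rule Liminf_add_le) auto
  then show ?thesis
    by (simp add: e less_eq_ennreal.rep_eq plus_ennreal.rep_eq flip: plus_ennreal.rep_eq)
qed

lemma e2ennreal_add_parts:
  fixes x :: ereal and k :: ennreal
  assumes "0 \<le> x + enn2ereal k"
  shows "e2ennreal x + k = e2ennreal (x + enn2ereal k) + e2ennreal (- x)"
proof (cases "0 \<le> x")
  case True
  then have "enn2ereal (e2ennreal x + k) = x + enn2ereal k"
    by (simp add: plus_ennreal.rep_eq enn2ereal_e2ennreal)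
  then have "e2ennreal (x + enn2ereal k) = e2ennreal x + k" by (metis e2ennreal_enn2ereal)
  with True show ?thesis by (simp add: e2ennreal_neg)
next
  case False
  then have x: "x \<le> 0" "0 \<le> - x" by (auto simp: ereal_uminus_le_reorder)
  have "x \<noteq> - \<infinity> \<or> k = top"
    using assms by (cases k) auto
  then have "(x + enn2ereal k) + - x = enn2ereal k"
    using x(1) by (cases x; cases k) (auto simp: enn2ereal_ennreal)
  moreover have "enn2ereal (e2ennreal (x + enn2ereal k) + e2ennreal (- x)) = (x + enn2ereal k) + - x"
    using assms x by (simp add: plus_ennreal.rep_eq enn2ereal_e2ennreal)
  ultimately have "e2ennreal (x + enn2ereal k) + e2ennreal (- x) = k"
    by (metis e2ennreal_enn2ereal)
  with x show ?thesis by (simp add: e2ennreal_neg)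
qed

text \<open>
  A function whose integral is finite and whose sum with \<open>F\<close> is nonnegative dominates the negative part of
  \<open>F\<close>. The integral of \<open>F\<close>, a difference of two integrals, then becomes a single integral of a nonnegative
  function, to which Fatou's lemma applies.
\<close>
lemma ereal_integral_shift:
  assumes F: "F \<in> borel_measurable M" and k: "k \<in> borel_measurable M" "(\<integral>\<^sup>+x. k x \<partial>M) < \<infinity>"
    and pos: "AE x in M. 0 \<le> F x + enn2ereal (k x)"
  shows ereal_integral_well_defined_shift: "ereal_integral_well_defined M F"
    and ereal_integral_add_shift:
      "ereal_integral M F + enn2ereal (\<integral>\<^sup>+x. k x \<partial>M) = enn2ereal (\<integral>\<^sup>+x. e2ennreal (F x + enn2ereal (k x)) \<partial>M)"
proof -
  have m: "(\<lambda>x. e2ennreal (G x)) \<in> borel_measurable M" if "G \<in> borel_measurable M" for G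
    using that by measurable
  let ?P = "\<integral>\<^sup>+x. e2ennreal (F x) \<partial>M" and ?N = "\<integral>\<^sup>+x. e2ennreal (- F x) \<partial>M"
  let ?K = "\<integral>\<^sup>+x. k x \<partial>M" and ?S = "\<integral>\<^sup>+x. e2ennreal (F x + enn2ereal (k x)) \<partial>M"
  have Fk: "(\<lambda>x. e2ennreal (F x + enn2ereal (k x))) \<in> borel_measurable M"
    using F k by measurable
  have "?P + ?K = (\<integral>\<^sup>+x. e2ennreal (F x) + k x \<partial>M)"
    by (rule nn_integral_add[symmetric]) (use F k m in auto)
  also have "\<dots> = (\<integral>\<^sup>+x. e2ennreal (F x + enn2ereal (k x)) + e2ennreal (- F x) \<partial>M)"
    by (rule nn_integral_cong_AE) (use pos in \<open>auto elim!: eventually_mono intro: e2ennreal_add_parts\<close>)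
  also have "\<dots> = ?S + ?N"
    by (rule nn_integral_add) (use F Fk m in auto)
  finally have eq: "?P + ?K = ?S + ?N" .
  have "?N \<le> ?K"
  proof (rule nn_integral_mono_AE)
    show "AE x in M. e2ennreal (- F x) \<le> k x"
      using pos
    proof eventually_elim
      case (elim x)
      then have "- F x \<le> enn2ereal (k x)"
        by (cases "F x"; cases "enn2ereal (k x)") auto
      then show ?case using e2ennreal_mono by fastforce
    qed
  qed
  then have N: "?N < \<infinity>" using k(2) by simp
  then show "ereal_integral_well_defined M F" using F by (simp add: ereal_integral_well_defined_def)
  from eq have "enn2ereal ?P + enn2ereal ?K = enn2ereal ?S + enn2ereal ?N"
    by (metis plus_ennreal.rep_eq)
  then show "ereal_integral M F + enn2ereal ?K = enn2ereal ?S"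
    unfolding ereal_integral_def using N k(2)
    by (cases ?P; cases ?N; cases ?K; cases ?S) (auto simp: enn2ereal_ennreal)
qed

section \<open>The topology and the potential\<close>

locale wed_problem = wed_weight \<epsilon>
  for \<epsilon> :: real and \<sigma> :: "'a::complete_space topology" and \<phi> :: "'a \<Rightarrow> ereal"
    and ustar :: 'a and A B :: real +
  assumes compat: "compatible \<sigma>" and proper_phi: "proper \<phi>" and lscc: "LSCC \<sigma> \<phi> ustar A B"
    and B_le: "B \<le> 1 / (16 * \<epsilon>)"
begin

lemma topspace_sigma: "topspace \<sigma> = UNIV"
  using compat by (simp add: compatible_def)

lemma Hausdorff_sigma: "Hausdorff_space \<sigma>"
  using compat by (simp add: compatible_def)

lemma dist_liminf:
  "limitin \<sigma> u a sequentially \<Longrightarrow> limitin \<sigma> v b sequentially \<Longrightarrow>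
    ereal (dist a b) \<le> liminf (\<lambda>n. ereal (dist (u n) (v n)))"
  using compat by (simp add: compatible_def)

lemma open_absorb:
  assumes "openin \<sigma> U" "x \<in> U"
  obtains V \<delta> where "openin \<sigma> V" "x \<in> V" "\<delta> > 0" "\<And>y z. z \<in> V \<Longrightarrow> dist y z < \<delta> \<Longrightarrow> y \<in> U"
proof -
  obtain V \<delta> where V: "openin \<sigma> V" "x \<in> V" "\<delta> > 0" "\<And>y. infdist y V < \<delta> \<Longrightarrow> y \<in> U"
    using compat assms unfolding compatible_def by blast
  show ?thesis by (rule that[OF V(1-3)]) (use V(4) infdist_le le_less_trans in blast)
qed

text \<open>
  A \<open>\<sigma>\<close>-neighbourhood absorbs a metric ball, so \<open>\<sigma>\<close> is coarser than the topology of the metric.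
\<close>
lemma open_sigma:
  assumes "openin \<sigma> U" shows "open U"
  unfolding open_dist
proof
  fix x assume "x \<in> U"
  then obtain V \<delta> where "x \<in> V" "\<delta> > 0" "\<And>y z. z \<in> V \<Longrightarrow> dist y z < \<delta> \<Longrightarrow> y \<in> U"
    using open_absorb[OF assms] by metis
  then show "\<exists>e>0. \<forall>y. dist y x < e \<longrightarrow> y \<in> U" by blast
qed

lemma limitin_sigma_of_dist:
  assumes "(x \<longlongrightarrow> l) F" shows "limitin \<sigma> x l F"
  unfolding limitin_def using assms open_sigma by (auto simp: topspace_sigma topological_tendstoD)

lemma limitin_sigma_perturb:
  assumes x: "limitin \<sigma> x l F" and d: "((\<lambda>n. dist (y n) (x n)) \<longlongrightarrow> 0) F"
  shows "limitin \<sigma> y l F"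
  unfolding limitin_def
proof (intro conjI allI impI)
  fix U assume "openin \<sigma> U \<and> l \<in> U"
  then obtain V \<delta> where V: "openin \<sigma> V" "l \<in> V" "\<delta> > 0" "\<And>y z. z \<in> V \<Longrightarrow> dist y z < \<delta> \<Longrightarrow> y \<in> U"
    using open_absorb[of U l] by metis
  have "\<forall>\<^sub>F n in F. x n \<in> V" using x V by (simp add: limitin_def)
  moreover have "\<forall>\<^sub>F n in F. dist (y n) (x n) < \<delta>" using d V(3) by (rule order_tendstoD)
  ultimately show "\<forall>\<^sub>F n in F. y n \<in> U" by eventually_elim (rule V(4))
qed (simp add: topspace_sigma)

lemma phi_lsc:
  "bounded (range x) \<Longrightarrow> limitin \<sigma> x l sequentially \<Longrightarrow> \<phi> l \<le> liminf (\<lambda>n. \<phi> (x n))"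
  using lscc by (simp add: LSCC_def)

lemma phi_compact:
  assumes "bounded (range x)" "\<And>n. \<phi> (x n) \<le> ereal M"
  obtains l r where "strict_mono (r :: nat \<Rightarrow> nat)" "limitin \<sigma> (x \<circ> r) l sequentially"
proof -
  have "(SUP n. \<phi> (x n)) \<le> ereal M" by (intro SUP_least assms)
  then have "(SUP n. \<phi> (x n)) < \<infinity>" by auto
  with lscc assms(1) that show ?thesis unfolding LSCC_def by blast
qed

lemma A_nonneg: "0 \<le> A" and B_nonneg: "0 \<le> B"
  using lscc by (auto simp: LSCC_def)

definition Q :: "'a \<Rightarrow> real" where "Q v = B * (dist v ustar)\<^sup>2 + A"

lemma Q_nonneg: "0 \<le> Q v"
  using A_nonneg B_nonneg by (simp add: Q_def)

lemma phi_coercive: "ereal (- B * (dist x y)\<^sup>2 - Q y) \<le> \<phi> x"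
  using lscc by (simp add: LSCC_def Q_def)

lemma phi_not_MInf: "\<phi> x \<noteq> - \<infinity>"
  using proper_phi by (simp add: proper_def)

text \<open>
  What is left of the factor \<open>\<epsilon> / 2\<close> of the action after \<open>4 * B * \<epsilon>\<^sup>2\<close> has been spent on the Hardy term.
\<close>
definition \<kappa> :: real where "\<kappa> = \<epsilon> / 2 - 4 * B * \<epsilon>\<^sup>2"

lemma kappa_pos: "0 < \<kappa>"
proof -
  have "B * (4 * \<epsilon>\<^sup>2) \<le> 1 / (16 * \<epsilon>) * (4 * \<epsilon>\<^sup>2)" by (rule mult_right_mono[OF B_le]) simp
  also have "\<dots> = \<epsilon> / 4" using eps by (simp add: power2_eq_square)
  finally have "\<epsilon> / 4 \<le> \<kappa>" by (simp add: \<kappa>_def)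
  then show ?thesis using eps by linarith
qed

text \<open>
  The sublevel sets are closed in the half-line: \<open>u\<close> is continuous for the metric, hence for \<open>\<sigma>\<close>, and \<open>\<phi>\<close> is
  sequentially lower semicontinuous.
\<close>
lemma phi_measurable:
  assumes u: "AC2_loc {0..} u" shows "(\<lambda>t. \<phi> (u t)) \<in> borel_measurable \<mu>"
proof (rule borel_measurableI_le)
  fix y
  have "closed {t \<in> {0..}. \<phi> (u t) \<le> y}"
    unfolding closed_sequential_limits
  proof (intro allI impI)
    fix x l assume xl: "(\<forall>n. x n \<in> {t \<in> {0..}. \<phi> (u t) \<le> y}) \<and> x \<longlonglongrightarrow> l"
    then have l: "0 \<le> l" by (auto intro: LIMSEQ_le_const)
    have lim: "(\<lambda>n. u (x n)) \<longlonglongrightarrow> u l"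
      using AC2_loc_continuous[OF u] xl l by (auto intro: continuous_on_tendsto_compose)
    have "\<phi> (u l) \<le> liminf (\<lambda>n. \<phi> (u (x n)))"
      by (intro phi_lsc limitin_sigma_of_dist lim convergent_imp_bounded[OF lim])
    also have "\<dots> \<le> y"
      using xl by (intro order_trans[OF Liminf_le_Limsup Limsup_bounded]) auto
    finally show "l \<in> {t \<in> {0..}. \<phi> (u t) \<le> y}" using l by simp
  qed
  then have "{t \<in> {0..}. \<phi> (u t) \<le> y} \<inter> {0<..} \<in> sets lebesgue" by (intro sets.Int) auto
  moreover have "{t \<in> {0..}. \<phi> (u t) \<le> y} \<inter> {0<..} = {t \<in> space \<mu>. \<phi> (u t) \<le> y}" by auto
  ultimately show "{t \<in> space \<mu>. \<phi> (u t) \<le> y} \<in> sets \<mu>"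
    unfolding sets_wed by (subst sets_restrict_space_iff) auto
qed

lemma wed_integrand_measurable:
  assumes u: "AC2_loc {0..} u" shows "wed_integrand \<phi> \<epsilon> u \<in> borel_measurable \<mu>"
proof -
  have [measurable]: "md u \<in> borel_measurable \<mu>" "(\<lambda>t. \<phi> (u t)) \<in> borel_measurable \<mu>"
    using md_measurable[OF u] phi_measurable[OF u] by auto
  show ?thesis unfolding wed_integrand_def[abs_def] by measurable
qed

section \<open>The functional as a nonnegative energy\<close>

text \<open>
  The potential along the curve, compensated by its coercivity bound with base point \<open>u 0\<close>, in which the
  squared distance is replaced by \<open>hardy u t\<close>. For curves of finite action and \<open>t \<ge> 0\<close> the sum is nonnegative by
  \<open>phi_plus_nonneg\<close>, so \<open>e2ennreal\<close> truncates nothing.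
\<close>
definition \<Phi> :: "(real \<Rightarrow> 'a) \<Rightarrow> real \<Rightarrow> ennreal" where
  "\<Phi> u t = e2ennreal (\<phi> (u t) + ereal (Q (u 0)) + enn2ereal (ennreal B * hardy u t))"

lemma phi_plus_nonneg:
  assumes "AC2_loc {0..} u" "action u < \<infinity>" "0 \<le> t"
  shows "0 \<le> \<phi> (u t) + ereal (Q (u 0)) + enn2ereal (ennreal B * hardy u t)"
proof -
  have "ennreal (B * (dist (u 0) (u t))\<^sup>2) \<le> ennreal B * hardy u t"
    using dist_square_le_hardy[OF assms] B_nonneg by (simp add: ennreal_mult mult_left_mono)
  then have "ereal (B * (dist (u 0) (u t))\<^sup>2) \<le> enn2ereal (ennreal B * hardy u t)"
    using B_nonneg by (simp add: less_eq_ennreal.rep_eq enn2ereal_ennreal)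
  moreover have "ereal (- B * (dist (u t) (u 0))\<^sup>2 - Q (u 0)) \<le> \<phi> (u t)" by (rule phi_coercive)
  ultimately show ?thesis
    by (cases "\<phi> (u t)"; cases "enn2ereal (ennreal B * hardy u t)") (auto simp: dist_commute)
qed

definition energy :: "(real \<Rightarrow> 'a) \<Rightarrow> ennreal" where
  "energy u = (\<integral>\<^sup>+t. \<Phi> u t \<partial>\<mu>) + ennreal \<kappa> * action u"

text \<open>
  The compensation in \<open>\<Phi>\<close> has the integral \<open>Q (u 0) + 4 * B * \<epsilon>\<^sup>2 * action u\<close>. Its second part is paid for by the
  dissipation term, and the factor \<open>\<kappa>\<close> of the action remains.
\<close>
theorem wed_eq_energy:
  assumes u: "AC2_loc {0..} u" "action u < \<infinity>"
  shows wed_well_defined: "ereal_integral_well_defined \<mu> (wed_integrand \<phi> \<epsilon> u)"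
    and wed_energy: "wed \<phi> \<epsilon> u + ereal (Q (u 0)) = enn2ereal (energy u)"
proof -
  define k where "k t = ennreal (Q (u 0)) + ennreal B * hardy u t" for t
  have hm [measurable]: "hardy u \<in> borel_measurable \<mu>" by (rule hardy_measurable[OF u(1)])
  have km: "k \<in> borel_measurable \<mu>" unfolding k_def[abs_def] by measurable
  have kint: "(\<integral>\<^sup>+t. k t \<partial>\<mu>) = ennreal (Q (u 0)) + ennreal (4 * B * \<epsilon>\<^sup>2) * action u"
  proof -
    have "(\<integral>\<^sup>+t. k t \<partial>\<mu>) = (\<integral>\<^sup>+t. ennreal (Q (u 0)) \<partial>\<mu>) + (\<integral>\<^sup>+t. ennreal B * hardy u t \<partial>\<mu>)"
      unfolding k_def by (rule nn_integral_add) auto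
    also have "(\<integral>\<^sup>+t. ennreal B * hardy u t \<partial>\<mu>) = ennreal B * (ennreal (4 * \<epsilon>\<^sup>2) * action u)"
      by (subst nn_integral_cmult) (auto simp: nn_integral_hardy[OF u(1)])
    also have "\<dots> = ennreal (4 * B * \<epsilon>\<^sup>2) * action u"
      using B_nonneg by (simp add: mult.assoc[symmetric] flip: ennreal_mult) (simp add: mult_ac)
    finally show ?thesis by (simp only: nn_integral_wed_const)
  qed
  have kfin: "(\<integral>\<^sup>+t. k t \<partial>\<mu>) < \<infinity>"
    using u(2) by (simp add: kint ennreal_mult_less_top)
  have split: "wed_integrand \<phi> \<epsilon> u t + enn2ereal (k t) =
      enn2ereal (ennreal (\<epsilon> / 2) * ennreal ((md u t)\<^sup>2)) + (\<phi> (u t) + ereal (Q (u 0)) + enn2ereal (ennreal B * hardy u t))" for t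
    using eps Q_nonneg by (simp add: wed_integrand_def k_def plus_ennreal.rep_eq enn2ereal_ennreal add_ac flip: ennreal_mult)
  have pos: "AE t in \<mu>. 0 \<le> wed_integrand \<phi> \<epsilon> u t + enn2ereal (k t)"
  proof (rule AE_I2)
    fix t assume "t \<in> space \<mu>"
    then show "0 \<le> wed_integrand \<phi> \<epsilon> u t + enn2ereal (k t)"
      unfolding split by (intro add_nonneg_nonneg[OF _ phi_plus_nonneg[OF u]]) auto
  qed
  note sh = ereal_integral_shift[OF wed_integrand_measurable[OF u(1)] km kfin pos]
  show "ereal_integral_well_defined \<mu> (wed_integrand \<phi> \<epsilon> u)" by (rule sh(1))
  have \<Phi>m: "\<Phi> u \<in> borel_measurable \<mu>"
    unfolding \<Phi>_def[abs_def] using phi_measurable[OF u(1)] by measurable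
  have mdm [measurable]: "md u \<in> borel_measurable \<mu>" by (rule md_measurable[OF u(1)])
  have "(\<integral>\<^sup>+t. e2ennreal (wed_integrand \<phi> \<epsilon> u t + enn2ereal (k t)) \<partial>\<mu>) =
      (\<integral>\<^sup>+t. ennreal (\<epsilon> / 2) * ennreal ((md u t)\<^sup>2) + \<Phi> u t \<partial>\<mu>)"
  proof (rule nn_integral_cong)
    fix t assume "t \<in> space \<mu>"
    then have p: "0 \<le> \<phi> (u t) + ereal (Q (u 0)) + enn2ereal (ennreal B * hardy u t)"
      by (intro phi_plus_nonneg u) simp
    have "enn2ereal (ennreal (\<epsilon> / 2) * ennreal ((md u t)\<^sup>2) + \<Phi> u t) = wed_integrand \<phi> \<epsilon> u t + enn2ereal (k t)"
      unfolding split \<Phi>_def plus_ennreal.rep_eq using p by (simp add: enn2ereal_e2ennreal)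
    then show "e2ennreal (wed_integrand \<phi> \<epsilon> u t + enn2ereal (k t)) = ennreal (\<epsilon> / 2) * ennreal ((md u t)\<^sup>2) + \<Phi> u t"
      by (metis e2ennreal_enn2ereal)
  qed
  also have "\<dots> = ennreal (\<epsilon> / 2) * action u + (\<integral>\<^sup>+t. \<Phi> u t \<partial>\<mu>)"
    by (subst nn_integral_add) (use \<Phi>m in \<open>auto simp: nn_integral_cmult\<close>)
  also have "ennreal (\<epsilon> / 2) = ennreal \<kappa> + ennreal (4 * B * \<epsilon>\<^sup>2)"
    using kappa_pos B_nonneg by (subst ennreal_plus[symmetric]) (auto simp: \<kappa>_def)
  finally have S: "(\<integral>\<^sup>+t. e2ennreal (wed_integrand \<phi> \<epsilon> u t + enn2ereal (k t)) \<partial>\<mu>) =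
      energy u + ennreal (4 * B * \<epsilon>\<^sup>2) * action u"
    by (simp add: energy_def distrib_right add_ac)
  have "wed \<phi> \<epsilon> u + enn2ereal (ennreal (Q (u 0)) + ennreal (4 * B * \<epsilon>\<^sup>2) * action u) =
      enn2ereal (energy u + ennreal (4 * B * \<epsilon>\<^sup>2) * action u)"
    using sh(2) unfolding S kint wed_def .
  moreover obtain c where "0 \<le> c" "ennreal (4 * B * \<epsilon>\<^sup>2) * action u = ennreal c"
    using kfin unfolding kint by (cases "ennreal (4 * B * \<epsilon>\<^sup>2) * action u") auto
  ultimately show "wed \<phi> \<epsilon> u + ereal (Q (u 0)) = enn2ereal (energy u)"
    using Q_nonneg[of "u 0"]
    by (cases "wed \<phi> \<epsilon> u"; cases "energy u") (auto simp: plus_ennreal.rep_eq enn2ereal_ennreal simp flip: ennreal_plus)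
qed

lemma Phi_measurable: "AC2_loc {0..} u \<Longrightarrow> \<Phi> u \<in> borel_measurable \<mu>"
  unfolding \<Phi>_def[abs_def] using phi_measurable hardy_measurable by measurable

text \<open>
  At each time both parts of \<open>\<Phi>\<close> are lower semicontinuous: \<open>\<phi>\<close> along bounded \<open>\<sigma>\<close>-convergent sequences, and
  \<open>hardy _ t\<close> as a weighted action. Fatou's lemma and the lower semicontinuity of the action conclude.
\<close>
theorem energy_lsc:
  assumes v: "\<And>n. AC2_loc {0..} (v n)" and C: "\<And>n. action (v n) \<le> ennreal C"
    and v0: "\<And>n. v n 0 = u 0" and u: "AC2_loc {0..} u"
    and lim: "\<And>t. 0 \<le> t \<Longrightarrow> limitin \<sigma> (\<lambda>n. v n t) (u t) sequentially"
    and bd: "\<And>t. 0 \<le> t \<Longrightarrow> bounded (range (\<lambda>n. v n t))"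
  shows "energy u \<le> liminf (\<lambda>n. energy (v n))"
proof -
  have d: "ereal (dist (u s) (u t)) \<le> liminf (\<lambda>n. ereal (dist (v n s) (v n t)))" if "0 \<le> s" "s \<le> t" for s t
    using that by (intro dist_liminf lim) auto
  have "\<Phi> u t \<le> liminf (\<lambda>n. \<Phi> (v n) t)" if t: "0 \<le> t" for t
  proof -
    have BH: "ennreal B * hardy w t = (\<integral>\<^sup>+s. ennreal ((B * hardy_weight t s) * (md w s)\<^sup>2) \<partial>\<mu>)"
      if "AC2_loc {0..} w" for w :: "real \<Rightarrow> 'a"
    proof -
      have "(\<lambda>s. ennreal (hardy_weight t s * (md w s)\<^sup>2)) \<in> borel_measurable \<mu>"
        using hardy_weight_measurable[of t] md_measurable[OF that] by measurable
      then show ?thesis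
        unfolding hardy_def using B_nonneg hardy_weight_bounds[of t]
        by (subst nn_integral_cmult[symmetric]) (auto simp: mult.assoc simp flip: ennreal_mult)
    qed
    have "ennreal B * hardy u t \<le> liminf (\<lambda>n. ennreal B * hardy (v n) t)"
      unfolding BH[OF u] BH[OF v]
    proof (rule weighted_action_lsc[OF v C d])
      show "(\<lambda>s. B * hardy_weight t s) \<in> borel_measurable \<mu>"
        by (intro borel_measurable_times hardy_weight_measurable) simp
      show "0 \<le> B * hardy_weight t x \<and> B * hardy_weight t x \<le> B * (2 * \<epsilon>\<^sup>2 * exp (t / \<epsilon>))" for x
        using hardy_weight_bounds[of t x] B_nonneg by (auto intro: mult_left_mono)
    qed
    then have "enn2ereal (ennreal B * hardy u t) \<le> enn2ereal (liminf (\<lambda>n. ennreal B * hardy (v n) t))"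
      by (simp add: less_eq_ennreal.rep_eq)
    also have "\<dots> = liminf (\<lambda>n. enn2ereal (ennreal B * hardy (v n) t))"
      by (rule Liminf_compose_continuous_mono[symmetric])
         (auto simp: mono_def less_eq_ennreal.rep_eq intro: continuous_on_enn2ereal)
    finally have 1: "enn2ereal (ennreal B * hardy u t) \<le> liminf (\<lambda>n. enn2ereal (ennreal B * hardy (v n) t))" .
    have 2: "\<phi> (u t) + ereal (Q (u 0)) \<le> liminf (\<lambda>n. \<phi> (v n t) + ereal (Q (v n 0)))"
      using phi_lsc[OF bd lim, OF t t] by (simp add: v0 Liminf_add_ereal_right add_right_mono)
    have "\<phi> (u t) + ereal (Q (u 0)) + enn2ereal (ennreal B * hardy u t) \<le>
        liminf (\<lambda>n. \<phi> (v n t) + ereal (Q (v n 0))) + liminf (\<lambda>n. enn2ereal (ennreal B * hardy (v n) t))"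
      by (rule add_mono[OF 2 1])
    also have "\<dots> \<le> liminf (\<lambda>n. \<phi> (v n t) + ereal (Q (v n 0)) + enn2ereal (ennreal B * hardy (v n) t))"
    proof (rule ereal_liminf_add_mono)
      have "0 \<le> liminf (\<lambda>n. enn2ereal (ennreal B * hardy (v n) t))" by (rule Liminf_bounded) simp
      moreover have "liminf (\<lambda>n. \<phi> (v n t) + ereal (Q (v n 0))) \<noteq> - \<infinity>"
        using 2 phi_not_MInf[of "u t"] by (cases "\<phi> (u t)") auto
      ultimately show "\<not> (liminf (\<lambda>n. \<phi> (v n t) + ereal (Q (v n 0))) = \<infinity> \<and>
            liminf (\<lambda>n. enn2ereal (ennreal B * hardy (v n) t)) = - \<infinity> \<or>
         liminf (\<lambda>n. \<phi> (v n t) + ereal (Q (v n 0))) = - \<infinity> \<and>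
            liminf (\<lambda>n. enn2ereal (ennreal B * hardy (v n) t)) = \<infinity>)" by auto
    qed
    finally have "\<Phi> u t \<le> e2ennreal (liminf (\<lambda>n. \<phi> (v n t) + ereal (Q (v n 0)) + enn2ereal (ennreal B * hardy (v n) t)))"
      unfolding \<Phi>_def by (rule e2ennreal_mono)
    also have "\<dots> = liminf (\<lambda>n. \<Phi> (v n) t)"
      unfolding \<Phi>_def
      by (rule Liminf_compose_continuous_mono[symmetric])
         (auto simp: mono_def intro: continuous_on_e2ennreal e2ennreal_mono)
    finally show ?thesis .
  qed
  then have "(\<integral>\<^sup>+t. \<Phi> u t \<partial>\<mu>) \<le> (\<integral>\<^sup>+t. liminf (\<lambda>n. \<Phi> (v n) t) \<partial>\<mu>)"
    by (intro nn_integral_mono) simp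
  also have "\<dots> \<le> liminf (\<lambda>n. \<integral>\<^sup>+t. \<Phi> (v n) t \<partial>\<mu>)"
    by (intro nn_integral_liminf Phi_measurable v)
  finally have 1: "(\<integral>\<^sup>+t. \<Phi> u t \<partial>\<mu>) \<le> liminf (\<lambda>n. \<integral>\<^sup>+t. \<Phi> (v n) t \<partial>\<mu>)" .
  have K: "ennreal \<kappa> * action w = (\<integral>\<^sup>+s. ennreal (\<kappa> * (md w s)\<^sup>2) \<partial>\<mu>)"
    if "AC2_loc {0..} w" for w :: "real \<Rightarrow> 'a"
    using md_measurable[OF that] kappa_pos
    by (subst nn_integral_cmult[symmetric]) (auto simp flip: ennreal_mult)
  have 2: "ennreal \<kappa> * action u \<le> liminf (\<lambda>n. ennreal \<kappa> * action (v n))"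
    unfolding K[OF u] K[OF v]
    by (rule weighted_action_lsc[OF v C d, where K = \<kappa>]) (use kappa_pos in auto)
  have "energy u \<le> liminf (\<lambda>n. \<integral>\<^sup>+t. \<Phi> (v n) t \<partial>\<mu>) + liminf (\<lambda>n. ennreal \<kappa> * action (v n))"
    unfolding energy_def by (rule add_mono[OF 1 2])
  also have "\<dots> \<le> liminf (\<lambda>n. energy (v n))"
    unfolding energy_def by (rule ennreal_liminf_add_le)
  finally show ?thesis .
qed


section \<open>Compactness of curves with bounded energy\<close>

lemma phi_le_Phi: "e2ennreal (\<phi> (u t)) \<le> \<Phi> u t"
  unfolding \<Phi>_def
proof (rule e2ennreal_mono)
  have "0 \<le> enn2ereal (ennreal B * hardy u t)" by simp
  then show "\<phi> (u t) \<le> \<phi> (u t) + ereal (Q (u 0)) + enn2ereal (ennreal B * hardy u t)"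
    using Q_nonneg[of "u 0"] by (simp add: add_increasing2 add.assoc)
qed

text \<open>
  Markov's inequality: the denominator is the \<open>\<mu>\<close>-mass of the interval. The bound depends on the interval
  and on \<open>m\<close> only, which matters for sequences of curves.
\<close>
lemma good_time:
  assumes le: "(\<integral>\<^sup>+t. \<Phi> u t \<partial>\<mu>) \<le> ennreal m" and ab: "0 \<le> a" "a < b"
  shows "\<exists>t\<in>{a..b}. \<phi> (u t) \<le> ereal ((\<bar>m\<bar> + 1) / (exp (- a / \<epsilon>) - exp (- b / \<epsilon>)))"
proof (rule ccontr)
  define p where "p = exp (- a / \<epsilon>) - exp (- b / \<epsilon>)"
  define M where "M = (\<bar>m\<bar> + 1) / p"
  have p: "0 < p" using ab eps by (simp add: p_def divide_strict_right_mono)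
  have M: "0 \<le> M" "M * p = \<bar>m\<bar> + 1" using p by (auto simp: M_def)
  assume "\<not> ?thesis"
  then have big: "ereal M < \<phi> (u t)" if "t \<in> {a..b}" for t
    using that unfolding M_def p_def by (auto simp: not_le)
  have S: "{s<..} \<in> sets \<mu>" if "0 \<le> s" for s
    unfolding sets_wed using that by (subst sets_restrict_space_iff) auto
  have "{a<..b} = {a<..} - {b<..}" using ab by auto
  then have em: "{a<..b} \<in> sets \<mu>" "emeasure \<mu> {a<..b} = ennreal p"
    using S[of a] S[of b] ab eps
    by (auto simp: emeasure_Diff emeasure_wed_tail p_def ennreal_minus)
  have "ennreal (\<bar>m\<bar> + 1) = ennreal M * emeasure \<mu> {a<..b}"
    using M p by (simp add: em(2) flip: ennreal_mult)
  also have "\<dots> = (\<integral>\<^sup>+t. ennreal M * indicator {a<..b} t \<partial>\<mu>)"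
    using em(1) by (simp add: nn_integral_cmult_indicator)
  also have "\<dots> \<le> (\<integral>\<^sup>+t. \<Phi> u t \<partial>\<mu>)"
  proof (rule nn_integral_mono)
    fix t
    have "ennreal M \<le> \<Phi> u t" if "t \<in> {a<..b}"
    proof -
      have "e2ennreal (ereal M) \<le> e2ennreal (\<phi> (u t))"
        using big[of t] that by (intro e2ennreal_mono) auto
      also have "\<dots> \<le> \<Phi> u t" by (rule phi_le_Phi)
      finally show ?thesis by simp
    qed
    then show "ennreal M * indicator {a<..b} t \<le> \<Phi> u t" by (auto simp: indicator_def)
  qed
  also have "\<dots> \<le> ennreal m" by (rule le)
  finally have "\<bar>m\<bar> + 1 \<le> m \<or> m < 0 \<and> \<bar>m\<bar> + 1 \<le> 0"
    by (cases "0 \<le> m") (auto simp: ennreal_neg)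
  then show False by linarith
qed

lemma curvesD:
  assumes "u \<in> curves \<epsilon> u\<^sub>0"
  shows "AC2_loc {0..} u" "action u < \<infinity>" "u 0 = u\<^sub>0" "u \<in> extensional {0..}"
  using assms by (auto simp: curves_def)

text \<open>
  Each interval \<open>J i\<close> with rational endpoints contains times \<open>\<tau> n i\<close> at which \<open>\<phi> (v n _)\<close> is bounded in \<open>n\<close>. Along a
  diagonal subsequence \<open>r\<close>, the times converge to some \<open>S i\<close> and the points to some \<open>L i\<close> in \<open>\<sigma>\<close>.
  Equicontinuity replaces the moving times by \<open>S i\<close>, because \<open>\<sigma>\<close>-limits do not see perturbations that
  vanish in the metric. The times \<open>S i\<close> are dense. If \<open>S (i k)\<close> tends to \<open>t\<close> then \<open>L (i k)\<close> is a Cauchy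
  sequence for the metric, as distances are lower semicontinuous under \<open>\<sigma>\<close>-limits, and its limit is the
  \<open>\<sigma>\<close>-limit of \<open>v (r n) t\<close>.
\<close>
theorem curve_compactness:
  assumes v: "\<And>n. v n \<in> curves \<epsilon> u\<^sub>0" and le: "\<And>n. energy (v n) \<le> ennreal m"
  obtains r u where "strict_mono (r :: nat \<Rightarrow> nat)" "u \<in> curves \<epsilon> u\<^sub>0"
    "\<And>t. 0 \<le> t \<Longrightarrow> limitin \<sigma> (\<lambda>n. v (r n) t) (u t) sequentially"
    "energy u \<le> liminf (\<lambda>n. energy (v (r n)))"
    "\<And>t U. 0 \<le> t \<Longrightarrow> openin \<sigma> U \<Longrightarrow> u t \<in> U \<Longrightarrow>
       \<exists>\<delta>>0. \<forall>\<^sub>F n in sequentially. \<forall>s\<ge>0. \<bar>s - t\<bar> < \<delta> \<longrightarrow> v (r n) s \<in> U"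
proof -
  note AC = curvesD(1)[OF v] and act = curvesD(2)[OF v] and v0 = curvesD(3)[OF v]
  define C where "C = \<bar>m\<bar> / \<kappa>"
  have C: "0 \<le> C" using kappa_pos by (simp add: C_def)
  have actC: "action (v n) \<le> ennreal C" for n
  proof -
    obtain a where a: "0 \<le> a" "action (v n) = ennreal a"
      using act[of n] by (cases "action (v n)") auto
    have "ennreal \<kappa> * action (v n) \<le> energy (v n)" by (simp add: energy_def)
    also have "\<dots> \<le> ennreal \<bar>m\<bar>" by (rule order_trans[OF le ennreal_leI]) simp
    finally have "\<kappa> * a \<le> \<bar>m\<bar>" using a kappa_pos by (simp flip: ennreal_mult)
    then show ?thesis using a kappa_pos by (auto simp: C_def field_simps intro!: ennreal_leI)
  qed
  have Phi_le: "(\<integral>\<^sup>+t. \<Phi> (v n) t \<partial>\<mu>) \<le> ennreal m" for n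
    by (rule order_trans[OF _ le[of n]]) (simp add: energy_def)
  have bdd: "dist (v n t) u\<^sub>0 \<le> (C + T * (\<epsilon> * exp (T / \<epsilon>))) / 2" if t: "0 \<le> t" "t \<le> T" for n t T
  proof -
    have "dist (v n 0) (v n t) \<le> (1 * C + (t - 0) * (\<epsilon> * exp (t / \<epsilon>)) / 1) / 2"
      by (rule dist_modulus[OF AC actC C]) (use t in auto)
    moreover have "t * (\<epsilon> * exp (t / \<epsilon>)) \<le> T * (\<epsilon> * exp (T / \<epsilon>))"
      using t eps by (intro mult_mono) (auto simp: divide_right_mono)
    ultimately show ?thesis by (simp add: v0 dist_commute)
  qed
  have bounded_range: "bounded (range (\<lambda>n. v (f n) (g n)))"
    if "\<And>n. 0 \<le> g n \<and> g n \<le> T" for f :: "nat \<Rightarrow> nat" and g T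
    unfolding bounded_any_center[of _ u\<^sub>0]
  proof (rule exI[of _ "(C + T * (\<epsilon> * exp (T / \<epsilon>))) / 2"], rule ballI)
    fix y assume "y \<in> range (\<lambda>n. v (f n) (g n))"
    then obtain n where "y = v (f n) (g n)" by auto
    with bdd[of "g n" T "f n"] that[of n]
    show "dist u\<^sub>0 y \<le> (C + T * (\<epsilon> * exp (T / \<epsilon>))) / 2" by (simp add: dist_commute)
  qed

  define D where "D = {(a, b). a \<in> \<rat> \<and> b \<in> \<rat> \<and> 0 \<le> a \<and> a < (b::real)}"
  have "D \<subseteq> \<rat> \<times> \<rat>" by (auto simp: D_def)
  then have Dc: "countable D" by (rule countable_subset) (intro countable_SIGMA countable_rat)
  have "(0, 1) \<in> D" by (simp add: D_def)
  then have Dne: "D \<noteq> {}" by blast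
  define J where "J = from_nat_into D"
  have JD: "J i \<in> D" for i unfolding J_def by (rule from_nat_into[OF Dne])
  have Jab: "0 \<le> fst (J i)" "fst (J i) < snd (J i)" for i using JD[of i] by (auto simp: D_def)
  have Jall: "\<exists>i. t \<le> fst (J i) \<and> snd (J i) \<le> t + \<delta>" if t\<delta>: "0 \<le> t" "0 < \<delta>" for t \<delta>
  proof -
    obtain a where a: "a \<in> \<rat>" "t < a" "a < t + \<delta>" using Rats_dense_in_real[of t "t + \<delta>"] t\<delta> by auto
    obtain b where b: "b \<in> \<rat>" "a < b" "b < t + \<delta>" using Rats_dense_in_real[of a "t + \<delta>"] a by auto
    have "(a, b) \<in> D" using a b t\<delta> by (simp add: D_def)
    then obtain i where "J i = (a, b)" unfolding J_def using from_nat_into_surj[OF Dc] by metis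
    with a b show ?thesis by (intro exI[of _ i]) auto
  qed
  define Mi where "Mi i = (\<bar>m\<bar> + 1) / (exp (- fst (J i) / \<epsilon>) - exp (- snd (J i) / \<epsilon>))" for i
  define \<tau> where "\<tau> n i = (SOME t. t \<in> {fst (J i)..snd (J i)} \<and> \<phi> (v n t) \<le> ereal (Mi i))" for n i
  have "\<exists>t. t \<in> {fst (J i)..snd (J i)} \<and> \<phi> (v n t) \<le> ereal (Mi i)" for n i
    using good_time[OF Phi_le[of n] Jab[of i]] unfolding Mi_def by blast
  then have "\<tau> n i \<in> {fst (J i)..snd (J i)} \<and> \<phi> (v n (\<tau> n i)) \<le> ereal (Mi i)" for n i
    unfolding \<tau>_def by (rule someI_ex)
  then have \<tau>: "\<And>n i. \<tau> n i \<in> {fst (J i)..snd (J i)}" "\<And>n i. \<phi> (v n (\<tau> n i)) \<le> ereal (Mi i)"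
    by blast+
  have \<tau>0: "0 \<le> \<tau> n i \<and> \<tau> n i \<le> snd (J i)" for n i using \<tau>(1)[of n i] Jab(1)[of i] by auto
  define P where "P i r \<longleftrightarrow> (\<exists>s l. (\<lambda>n. \<tau> (r n) i) \<longlonglongrightarrow> s \<and> limitin \<sigma> (\<lambda>n. v (r n) (\<tau> (r n) i)) l sequentially)"
    for i and r :: "nat \<Rightarrow> nat"
  interpret subseqs P
  proof
    fix i and s :: "nat \<Rightarrow> nat" assume "strict_mono s"
    have sc: "seq_compact {fst (J i)..snd (J i)}" by (simp add: compact_imp_seq_compact)
    have in_J: "\<forall>n. \<tau> (s n) i \<in> {fst (J i)..snd (J i)}" using \<tau>(1) by blast
    then obtain x r1 where r1: "strict_mono (r1 :: nat \<Rightarrow> nat)" "((\<lambda>n. \<tau> (s n) i) \<circ> r1) \<longlonglongrightarrow> x"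
      using seq_compactE[OF sc in_J] by metis
    obtain l r2 where r2: "strict_mono r2"
      "limitin \<sigma> ((\<lambda>n. v (s (r1 n)) (\<tau> (s (r1 n)) i)) \<circ> r2) l sequentially"
      by (rule phi_compact[OF bounded_range[of "\<lambda>n. \<tau> (s (r1 n)) i" _ "\<lambda>n. s (r1 n)"] \<tau>(2)]) (use \<tau>0 in auto)
    have "P i (s \<circ> (r1 \<circ> r2))"
      unfolding P_def using LIMSEQ_subseq_LIMSEQ[OF r1(2) r2(1)] r2(2) by (auto simp: o_def)
    then show "\<exists>r'. strict_mono r' \<and> P i (s \<circ> r')"
      using strict_mono_o[OF r1(1) r2(1)] by blast
  qed
  define r where "r = diagseq"
  have r: "strict_mono r" unfolding r_def by (rule subseq_diagseq)
  have PS: "P i (r \<circ> (+) (Suc i))" for i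
    unfolding r_def
  proof (rule diagseq_holds)
    fix r' s :: "nat \<Rightarrow> nat" and i assume "strict_mono r'" "P i s"
    then show "P i (s \<circ> r')"
      unfolding P_def using LIMSEQ_subseq_LIMSEQ[of _ _ r'] limitin_subsequence[of r'] by (fastforce simp: o_def)
  qed
  have "P i r" for i
  proof -
    have "(+) (Suc i) = (\<lambda>n. n + Suc i)" by (simp add: fun_eq_iff)
    with PS[of i] have "P i (\<lambda>n. r (n + Suc i))" by (simp add: o_def)
    then obtain s l where sl: "(\<lambda>n. \<tau> (r (n + Suc i)) i) \<longlonglongrightarrow> s"
      "limitin \<sigma> (\<lambda>n. v (r (n + Suc i)) (\<tau> (r (n + Suc i)) i)) l sequentially"
      unfolding P_def by blast
    from LIMSEQ_offset[of "\<lambda>n. \<tau> (r n) i", OF sl(1)]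
      limitin_sequentially_offset_rev[of \<sigma> "\<lambda>n. v (r n) (\<tau> (r n) i)", OF sl(2)]
    show ?thesis unfolding P_def by blast
  qed
  then have ex: "\<exists>s. (\<lambda>n. \<tau> (r n) i) \<longlonglongrightarrow> s" "\<exists>l. limitin \<sigma> (\<lambda>n. v (r n) (\<tau> (r n) i)) l sequentially" for i
    unfolding P_def by blast+
  define S where "S i = (SOME s. (\<lambda>n. \<tau> (r n) i) \<longlonglongrightarrow> s)" for i
  define L where "L i = (SOME l. limitin \<sigma> (\<lambda>n. v (r n) (\<tau> (r n) i)) l sequentially)" for i
  have SL: "(\<lambda>n. \<tau> (r n) i) \<longlonglongrightarrow> S i" "limitin \<sigma> (\<lambda>n. v (r n) (\<tau> (r n) i)) (L i) sequentially" for i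
    unfolding S_def L_def by (rule someI_ex, rule ex)+
  have Sab: "S i \<in> {fst (J i)..snd (J i)}" for i
    by (rule closed_sequentially[OF _ _ SL(1)]) (use \<tau>(1) in auto)
  have S0: "0 \<le> S i" for i using Sab[of i] Jab(1)[of i] by auto
  \<comment> \<open>The times may now be replaced by their limits.\<close>
  have SLim: "limitin \<sigma> (\<lambda>n. v (r n) (S i)) (L i) sequentially" for i
  proof (rule limitin_sigma_perturb[OF SL(2)], rule LIMSEQ_I)
    fix \<eta> :: real assume "\<eta> > 0"
    obtain \<delta> where \<delta>: "\<delta> > 0" "\<And>(v :: real \<Rightarrow> 'a) s t. AC2_loc {0..} v \<Longrightarrow> action v \<le> ennreal C \<Longrightarrow>
       s \<in> {0..snd (J i)} \<Longrightarrow> t \<in> {0..snd (J i)} \<Longrightarrow> \<bar>s - t\<bar> < \<delta> \<Longrightarrow> dist (v s) (v t) < \<eta>"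
      by (rule equicontinuity[OF C \<open>\<eta> > 0\<close>, of "snd (J i)"], rule that)
    obtain N where N: "\<And>n. n \<ge> N \<Longrightarrow> \<bar>\<tau> (r n) i - S i\<bar> < \<delta>"
      using LIMSEQ_D[OF SL(1) \<delta>(1)] by auto
    have "dist (v (r n) (S i)) (v (r n) (\<tau> (r n) i)) < \<eta>" if "n \<ge> N" for n
      by (rule \<delta>(2)[OF AC actC]) (use N[OF that] Sab[of i] S0[of i] \<tau>0[of "r n" i] in \<open>auto simp: abs_minus_commute\<close>)
    then show "\<exists>N. \<forall>n\<ge>N. norm (dist (v (r n) (S i)) (v (r n) (\<tau> (r n) i)) - 0) < \<eta>" by auto
  qed
  have Snear: "\<exists>i. t \<le> S i \<and> S i \<le> t + \<delta>" if "0 \<le> t" "0 < \<delta>" for t \<delta>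
    using Jall[OF that] Sab by (meson atLeastAtMost_iff order_trans)

  have conv: "\<exists>x. limitin \<sigma> (\<lambda>n. v (r n) t) x sequentially" if t: "0 \<le> t" for t
  proof -
    have "\<exists>i. t \<le> S i \<and> S i \<le> t + 1 / Suc k" for k by (rule Snear[OF t]) simp
    then obtain i where i: "\<And>k. t \<le> S (i k)" "\<And>k. S (i k) \<le> t + 1 / Suc k" by metis
    have iT: "S (i k) \<in> {0..t + 1}" for k
      using i(1)[of k] i(2)[of k] t by (auto intro: order_trans[of _ "t + 1 / Suc k"] simp: field_simps)
    have small: "\<exists>K. \<forall>k\<ge>K. \<forall>s. t \<le> s \<longrightarrow> s \<le> t + 1 / Suc K \<longrightarrow> \<bar>S (i k) - s\<bar> < \<delta>" if \<delta>: "\<delta> > 0" for \<delta>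
    proof -
      obtain K where K: "1 / real (Suc K) < \<delta>" using nat_approx_posE[OF \<delta>] by blast
      have "\<bar>S (i k) - s\<bar> < \<delta>" if "k \<ge> K" "t \<le> s" "s \<le> t + 1 / Suc K" for k s
      proof -
        have "1 / real (Suc k) \<le> 1 / Suc K" using that(1) by (simp add: frac_le)
        then show ?thesis using i(1)[of k] i(2)[of k] that K by linarith
      qed
      then show ?thesis by blast
    qed
    have "Cauchy (\<lambda>k. L (i k))"
      unfolding Cauchy_altdef2
    proof (intro allI impI)
      fix \<eta> :: real assume "\<eta> > 0"
      then have "\<eta> / 2 > 0" by simp
      obtain \<delta> where \<delta>: "\<delta> > 0" "\<And>(v :: real \<Rightarrow> 'a) s t'. AC2_loc {0..} v \<Longrightarrow> action v \<le> ennreal C \<Longrightarrow>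
         s \<in> {0..t + 1} \<Longrightarrow> t' \<in> {0..t + 1} \<Longrightarrow> \<bar>s - t'\<bar> < \<delta> \<Longrightarrow> dist (v s) (v t') < \<eta> / 2"
        by (rule equicontinuity[OF C \<open>\<eta> / 2 > 0\<close>, of "t + 1"], rule that)
      obtain K where K: "\<And>k s. k \<ge> K \<Longrightarrow> t \<le> s \<Longrightarrow> s \<le> t + 1 / Suc K \<Longrightarrow> \<bar>S (i k) - s\<bar> < \<delta>"
        using small[OF \<delta>(1)] by blast
      have "dist (L (i k)) (L (i K)) < \<eta>" if "k \<ge> K" for k
      proof -
        have "ereal (dist (L (i k)) (L (i K))) \<le> liminf (\<lambda>n. ereal (dist (v (r n) (S (i k))) (v (r n) (S (i K)))))"
          by (rule dist_liminf[OF SLim SLim])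
        also have "\<dots> \<le> ereal (\<eta> / 2)"
        proof (rule order_trans[OF Liminf_le_Limsup Limsup_bounded])
          show "\<forall>\<^sub>F n in sequentially. ereal (dist (v (r n) (S (i k))) (v (r n) (S (i K)))) \<le> ereal (\<eta> / 2)"
            using \<delta>(2)[OF AC actC iT iT K[OF that i(1) i(2)]] less_imp_le
            by (intro always_eventually allI ereal_less_eq(3)[THEN iffD2]) blast
        qed simp
        finally show ?thesis using \<open>\<eta> > 0\<close> by simp
      qed
      then show "\<exists>N. \<forall>n\<ge>N. dist (L (i n)) (L (i N)) < \<eta>" by blast
    qed
    then obtain x where x: "(\<lambda>k. L (i k)) \<longlonglongrightarrow> x" using Cauchy_convergent_iff convergent_def by blast
    have "limitin \<sigma> (\<lambda>n. v (r n) t) x sequentially"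
      unfolding limitin_def
    proof (intro conjI allI impI)
      fix U assume "openin \<sigma> U \<and> x \<in> U"
      then obtain V \<eta> where V: "openin \<sigma> V" "x \<in> V" "\<eta> > 0" "\<And>y z. z \<in> V \<Longrightarrow> dist y z < \<eta> \<Longrightarrow> y \<in> U"
        using open_absorb[of U x] by metis
      obtain \<delta> where \<delta>: "\<delta> > 0" "\<And>(v :: real \<Rightarrow> 'a) s t'. AC2_loc {0..} v \<Longrightarrow> action v \<le> ennreal C \<Longrightarrow>
         s \<in> {0..t + 1} \<Longrightarrow> t' \<in> {0..t + 1} \<Longrightarrow> \<bar>s - t'\<bar> < \<delta> \<Longrightarrow> dist (v s) (v t') < \<eta>"
        by (rule equicontinuity[OF C V(3), of "t + 1"], rule that)
      obtain K where K: "\<And>k s. k \<ge> K \<Longrightarrow> t \<le> s \<Longrightarrow> s \<le> t + 1 / Suc K \<Longrightarrow> \<bar>S (i k) - s\<bar> < \<delta>"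
        using small[OF \<delta>(1)] by blast
      have "\<forall>\<^sub>F k in sequentially. L (i k) \<in> V"
        using x open_sigma[OF V(1)] V(2) by (rule topological_tendstoD)
      from eventually_conj[OF eventually_ge_at_top[of K] this]
      obtain k where k: "k \<ge> K" "L (i k) \<in> V" by (auto dest: eventually_happens)
      have "\<forall>\<^sub>F n in sequentially. v (r n) (S (i k)) \<in> V"
        using SLim[of "i k"] V(1) k(2) by (simp add: limitin_def)
      then show "\<forall>\<^sub>F n in sequentially. v (r n) t \<in> U"
      proof eventually_elim
        case (elim n)
        have "dist (v (r n) t) (v (r n) (S (i k))) < \<eta>"
          by (rule \<delta>(2)[OF AC actC _ iT]) (use K[OF k(1), of t] t in \<open>auto simp: abs_minus_commute\<close>)
        with elim show ?case by (rule V(4))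
      qed
    qed (simp add: topspace_sigma)
    then show ?thesis by blast
  qed
  define w where "w t = (SOME x. limitin \<sigma> (\<lambda>n. v (r n) t) x sequentially)" for t
  have w: "limitin \<sigma> (\<lambda>n. v (r n) t) (w t) sequentially" if t: "0 \<le> t" for t
    unfolding w_def by (rule someI_ex, rule conv[OF t])
  define u where "u t = (if 0 \<le> t then w t else undefined)" for t
  have lim: "limitin \<sigma> (\<lambda>n. v (r n) t) (u t) sequentially" if "0 \<le> t" for t
    using w[OF that] that by (simp add: u_def)
  have d: "ereal (dist (u s) (u t)) \<le> liminf (\<lambda>n. ereal (dist (v (r n) s) (v (r n) t)))" if "0 \<le> s" "s \<le> t" for s t
    using that by (intro dist_liminf lim) auto
  have uAC: "AC2_loc {0..} u"
    by (rule limit_curve[of "\<lambda>n. v (r n)" C u, OF AC actC d])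
  have "action u \<le> liminf (\<lambda>n. action (v (r n)))"
    using weighted_action_lsc[OF AC actC d, where w = "\<lambda>_. 1" and K = 1] by simp
  also have "\<dots> \<le> ennreal C"
    by (rule order_trans[OF Liminf_le_Limsup Limsup_bounded]) (use actC in auto)
  finally have uact: "action u < \<infinity>" by (auto intro: le_less_trans)
  have u0: "u 0 = u\<^sub>0"
  proof (rule limitin_Hausdorff_unique[OF lim _ _ Hausdorff_sigma])
    show "limitin \<sigma> (\<lambda>n. v (r n) 0) u\<^sub>0 sequentially" by (simp add: v0 topspace_sigma)
  qed auto
  have uc: "u \<in> curves \<epsilon> u\<^sub>0"
    using uAC uact u0 by (auto simp: curves_def u_def extensional_def)
  show ?thesis
  proof (rule that[OF r uc lim])
    show "energy u \<le> liminf (\<lambda>n. energy (v (r n)))"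
      by (rule energy_lsc[OF AC actC _ uAC lim]) (auto simp: v0 u0 intro!: bounded_range)
    fix t U assume t: "0 \<le> t" and U: "openin \<sigma> U" "u t \<in> U"
    obtain V \<eta> where V: "openin \<sigma> V" "u t \<in> V" "\<eta> > 0" "\<And>y z. z \<in> V \<Longrightarrow> dist y z < \<eta> \<Longrightarrow> y \<in> U"
      using open_absorb[OF U] by metis
    obtain \<delta> where \<delta>: "\<delta> > 0" "\<And>(v :: real \<Rightarrow> 'a) s t'. AC2_loc {0..} v \<Longrightarrow> action v \<le> ennreal C \<Longrightarrow>
       s \<in> {0..t + 1} \<Longrightarrow> t' \<in> {0..t + 1} \<Longrightarrow> \<bar>s - t'\<bar> < \<delta> \<Longrightarrow> dist (v s) (v t') < \<eta>"
      by (rule equicontinuity[OF C V(3), of "t + 1"], rule that)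
    have "\<forall>\<^sub>F n in sequentially. v (r n) t \<in> V"
      using lim[OF t] V by (simp add: limitin_def)
    then have "\<forall>\<^sub>F n in sequentially. \<forall>s\<ge>0. \<bar>s - t\<bar> < min \<delta> 1 \<longrightarrow> v (r n) s \<in> U"
    proof eventually_elim
      case (elim n)
      show ?case
      proof (intro allI impI)
        fix s assume s: "0 \<le> s" "\<bar>s - t\<bar> < min \<delta> 1"
        have "dist (v (r n) s) (v (r n) t) < \<eta>"
          by (rule \<delta>(2)[OF AC actC]) (use s t in auto)
        with elim show "v (r n) s \<in> U" by (rule V(4))
      qed
    qed
    with \<delta>(1) show "\<exists>\<delta>>0. \<forall>\<^sub>F n in sequentially. \<forall>s\<ge>0. \<bar>s - t\<bar> < \<delta> \<longrightarrow> v (r n) s \<in> U"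
      by (intro exI[of _ "min \<delta> 1"]) auto
  qed
qed

end

section \<open>Convergence in the compact-open topology\<close>

text \<open>
  Finitely many of the neighbourhoods of times given by local uniformity cover a compact set of times.
\<close>
lemma limitin_compact_openI:
  fixes f :: "nat \<Rightarrow> real \<Rightarrow> 'a"
  assumes S: "\<And>n. f n \<in> S" "u \<in> S"
    and C: "\<And>g. g \<in> S \<Longrightarrow> g \<in> extensional {0..} \<and> continuous_map (top_of_set {0..}) \<sigma> g"
    and loc: "\<And>t U. 0 \<le> t \<Longrightarrow> openin \<sigma> U \<Longrightarrow> u t \<in> U \<Longrightarrow>
       \<exists>\<delta>>0. \<forall>\<^sub>F n in sequentially. \<forall>s\<ge>0. \<bar>s - t\<bar> < \<delta> \<longrightarrow> f n s \<in> U"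
  shows "limitin (subtopology (compact_open_topology (top_of_set {0..}) \<sigma>) S) f u sequentially"
proof -
  let ?B = "{{f. f ` K \<subseteq> U} | K U. compactin (top_of_set {0::real..}) K \<and> openin \<sigma> U}"
  have basis: "\<forall>\<^sub>F n in sequentially. f n ` K \<subseteq> U"
    if K: "compactin (top_of_set {0::real..}) K" and U: "openin \<sigma> U" and uK: "u ` K \<subseteq> U" for K U
  proof -
    have Kc: "compact K" "K \<subseteq> {0..}" using K by (auto simp: compactin_subtopology)
    define d where "d t = (SOME \<delta>. \<delta> > 0 \<and> (\<forall>\<^sub>F n in sequentially. \<forall>s\<ge>0. \<bar>s - t\<bar> < \<delta> \<longrightarrow> f n s \<in> U))" for t
    have d: "d t > 0 \<and> (\<forall>\<^sub>F n in sequentially. \<forall>s\<ge>0. \<bar>s - t\<bar> < d t \<longrightarrow> f n s \<in> U)" if "t \<in> K" for t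
      unfolding d_def by (rule someI_ex, rule loc) (use that Kc uK U in auto)
    obtain F where F: "F \<subseteq> K" "finite F" "K \<subseteq> (\<Union>t\<in>F. ball t (d t))"
      by (rule compactE_image[OF Kc(1), of K "\<lambda>t. ball t (d t)"]) (use d in auto)
    have "\<forall>\<^sub>F n in sequentially. \<forall>t\<in>F. \<forall>s\<ge>0. \<bar>s - t\<bar> < d t \<longrightarrow> f n s \<in> U"
      using F d by (intro eventually_ball_finite) auto
    then show ?thesis
    proof eventually_elim
      case (elim n)
      show ?case
      proof
        fix y assume "y \<in> f n ` K"
        then obtain s where s: "s \<in> K" "y = f n s" by blast
        then obtain t where "t \<in> F" "s \<in> ball t (d t)" using F(3) by blast
        with elim s Kc(2) show "y \<in> U" by (auto simp: dist_real_def abs_minus_commute)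
      qed
    qed
  qed
  have gen: "u \<in> W \<longrightarrow> (\<forall>\<^sub>F n in sequentially. f n \<in> W)" if "generate_topology_on ?B W" for W
    using that
  proof induction
    case (Int a b) then show ?case by (auto intro: eventually_conj)
  next
    case (UN K)
    show ?case
    proof
      assume "u \<in> \<Union>K"
      then obtain k where "k \<in> K" "u \<in> k" by blast
      with UN have "\<forall>\<^sub>F n in sequentially. f n \<in> k" by blast
      then show "\<forall>\<^sub>F n in sequentially. f n \<in> \<Union>K" by eventually_elim (use \<open>k \<in> K\<close> in blast)
    qed
  next
    case (Basis W)
    then obtain K U where "W = {f. f ` K \<subseteq> U}" "compactin (top_of_set {0::real..}) K" "openin \<sigma> U" by blast
    with basis show ?case by auto
  qed simp
  have "{f. f ` {} \<subseteq> {}} \<in> ?B" by blast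
  then have "\<Union>?B = UNIV" by blast
  then have lim: "limitin (topology_generated_by ?B) f u sequentially"
    unfolding limitin_def using gen by (simp add: openin_topology_generated_by_iff)
  have mem: "g \<in> {f \<in> extensional (topspace (top_of_set {0..})). continuous_map (top_of_set {0..}) \<sigma> f}"
    if "g \<in> S" for g
    using C[OF that] by simp
  show ?thesis
    unfolding compact_open_topology_def limitin_subtopology
    by (intro conjI always_eventually allI S lim mem)
qed

section \<open>Curves that stop, and finiteness of the energy\<close>

lemma curves_upto_real_iff:
  "u \<in> curves_upto \<epsilon> (ereal b) u\<^sub>0 \<longleftrightarrow>
    u \<in> extensional {0..} \<and> AC2_loc {0..} u \<and> u 0 = u\<^sub>0 \<and> (\<forall>t. b \<le> t \<longrightarrow> u t = u b)"
  by (simp add: curves_upto_def)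

context wed_weight
begin

text \<open>
  After the stopping time the metric derivative vanishes, and before it the density of \<open>\<mu>\<close> is bounded.
\<close>
lemma curves_upto_subset:
  fixes u\<^sub>0 :: "'b::metric_space"
  assumes T: "0 < T" shows "curves_upto \<epsilon> T u\<^sub>0 \<subseteq> curves \<epsilon> u\<^sub>0"
proof (cases "T = \<infinity>")
  case True then show ?thesis by (simp add: curves_upto_def)
next
  case False
  then obtain b where b: "T = ereal b" "0 < b" using T by (cases T) auto
  show ?thesis
  proof
    fix u :: "real \<Rightarrow> 'b" assume "u \<in> curves_upto \<epsilon> T u\<^sub>0"
    then have u: "u \<in> extensional {0..}" "AC2_loc {0..} u" "u 0 = u\<^sub>0" "\<And>t. b \<le> t \<Longrightarrow> u t = u b"
      unfolding b(1) curves_upto_real_iff by blast+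
    have zero: "md u t = 0" if t: "b < t" for t
    proof (rule metric_deriv_eq)
      have "\<forall>\<^sub>F s in at t within {0..}. b < s"
        by (rule order_tendstoD(1)[OF tendsto_ident_at t])
      then have "\<forall>\<^sub>F s in at t within {0..}. dist (u s) (u t) / \<bar>t - s\<bar> = 0"
      proof eventually_elim
        case (elim s)
        have "u s = u b" "u t = u b" by (rule u(4), use elim t in simp)+
        then show ?case by simp
      qed
      then show "has_metric_deriv {0..} u 0 t"
        unfolding has_metric_deriv_def by (rule tendsto_eventually)
    qed (use t b in simp)
    have "action u = (\<integral>\<^sup>+t. ennreal (exp (- t / \<epsilon>) / \<epsilon>) * ennreal ((md u t)\<^sup>2) \<partial>lebesgue_on {0<..})"
      using md_measurable[OF u(2)] by (intro nn_integral_wed) auto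
    also have "\<dots> = (\<integral>\<^sup>+t. ennreal (exp (- t / \<epsilon>) / \<epsilon>) * ennreal ((md u t)\<^sup>2) * indicator {0<..} t \<partial>lebesgue)"
      by (rule nn_integral_restrict_space) simp
    also have "\<dots> \<le> (\<integral>\<^sup>+t. ennreal ((md u t)\<^sup>2 / \<epsilon>) * indicator {0..b} t \<partial>lebesgue)"
    proof (rule nn_integral_mono)
      fix t
      have "exp (- t / \<epsilon>) / \<epsilon> * (md u t)\<^sup>2 \<le> 1 / \<epsilon> * (md u t)\<^sup>2" if "0 < t"
        using that eps by (intro mult_right_mono divide_right_mono) auto
      then show "ennreal (exp (- t / \<epsilon>) / \<epsilon>) * ennreal ((md u t)\<^sup>2) * indicator {0<..} t
          \<le> ennreal ((md u t)\<^sup>2 / \<epsilon>) * indicator {0..b} t"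
        using zero[of t] eps by (auto simp: indicator_def not_le intro!: ennreal_leI simp flip: ennreal_mult)
    qed
    also have "\<dots> = (\<integral>\<^sup>+t. ennreal ((md u t)\<^sup>2 / \<epsilon>) \<partial>lebesgue_on {0..b})"
      by (rule nn_integral_restrict_space[symmetric]) simp
    also have "\<dots> < \<infinity>"
    proof -
      have "integrable (lebesgue_on {0..b}) (\<lambda>t. (md u t)\<^sup>2 / \<epsilon>)"
        using square_integrable_power2[OF metric_deriv_square_integrable[OF u(2)]] by simp
      then show ?thesis using eps by (simp add: integrable_iff_bounded)
    qed
    finally show "u \<in> curves \<epsilon> u\<^sub>0" using u(1-3) by (simp add: curves_def)
  qed
qed

lemma stopped_curve:
  fixes u :: "real \<Rightarrow> 'b::metric_space"
  assumes u: "u \<in> curves \<epsilon> u\<^sub>0" and t\<^sub>0: "0 \<le> t\<^sub>0" "ereal t\<^sub>0 \<le> T" and T: "T \<noteq> \<infinity>"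
  shows "(\<lambda>t. if 0 \<le> t then u (min t t\<^sub>0) else undefined) \<in> curves_upto \<epsilon> T u\<^sub>0" (is "?v \<in> _")
proof -
  have uAC: "AC2_loc {0..} u" using u by (simp add: curves_def)
  obtain b where b: "T = ereal b" "t\<^sub>0 \<le> b" using t\<^sub>0 T by (cases T) auto
  have sq: "square_integrable (lebesgue_on {0..c}) (\<lambda>t. \<bar>md u t\<bar>)" for c
    using metric_deriv_square_integrable[OF uAC, of c] by (auto simp: square_integrable_def)
  have int: "(\<lambda>t. \<bar>md u t\<bar>) integrable_on {s..t}" "md u integrable_on {s..t}" if "0 \<le> s" for s t
    using integrable_lebesgue_on_subinterval(2)[OF square_integrable_interval_integrable[OF sq[of t]], of s t]
      integrable_lebesgue_on_subinterval(2)[OF square_integrable_interval_integrable[OF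
        metric_deriv_square_integrable[OF uAC, of t]], of s t] that by auto
  have "AC2_loc {0..} ?v"
  proof (rule AC2_locI[OF sq])
    fix s t :: real assume st: "0 \<le> s" "s \<le> t"
    have le: "0 \<le> min s t\<^sub>0" "min s t\<^sub>0 \<le> min t t\<^sub>0" using st t\<^sub>0 by auto
    show "dist (?v s) (?v t) \<le> integral {s..t} (\<lambda>t. \<bar>md u t\<bar>)"
    proof (cases "s \<le> t\<^sub>0")
      case True
      have "dist (u s) (u (min t t\<^sub>0)) \<le> integral {s..min t t\<^sub>0} (md u)"
        using True st by (intro dist_le_integral_metric_deriv[OF uAC]) auto
      also have "\<dots> \<le> integral {s..min t t\<^sub>0} (\<lambda>t. \<bar>md u t\<bar>)"
        by (intro integral_le int st) auto
      also have "\<dots> \<le> integral {s..t} (\<lambda>t. \<bar>md u t\<bar>)"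
        by (intro integral_subset_le int st) auto
      finally show ?thesis using True st by simp
    next
      case False
      have "0 \<le> integral {s..t} (\<lambda>t. \<bar>md u t\<bar>)"
        by (intro Henstock_Kurzweil_Integration.integral_nonneg int st) auto
      with False st show ?thesis by simp
    qed
  qed
  moreover have "?v 0 = u\<^sub>0" using u t\<^sub>0 by (simp add: curves_def)
  moreover have "?v t = ?v b" if "b \<le> t" for t using that b(2) t\<^sub>0(1) by simp
  moreover have "?v \<in> extensional {0..}" by (simp add: extensional_def)
  ultimately show ?thesis
    unfolding b(1) curves_upto_real_iff by blast
qed

end

context wed_problem
begin

lemma curves_continuous_map:
  assumes "u \<in> curves \<epsilon> u\<^sub>0" shows "continuous_map (top_of_set {0..}) \<sigma> u"
proof -
  have "continuous_on {0..} u" by (rule AC2_loc_continuous[OF curvesD(1)[OF assms]])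
  then have "openin (top_of_set {0..}) ({0..} \<inter> u -` U)" if "openin \<sigma> U" for U
    using open_sigma[OF that] by (rule continuous_openin_preimage_gen)
  moreover have "{0..} \<inter> u -` U = {x \<in> {0..}. u x \<in> U}" for U by auto
  ultimately show ?thesis
    unfolding continuous_map_def by (simp add: topspace_sigma)
qed

lemma wed_le_iff:
  assumes "u \<in> curves \<epsilon> u\<^sub>0" "v \<in> curves \<epsilon> u\<^sub>0"
  shows "wed \<phi> \<epsilon> u \<le> wed \<phi> \<epsilon> v \<longleftrightarrow> energy u \<le> energy v"
  using wed_energy[OF curvesD(1,2)[OF assms(1)]] wed_energy[OF curvesD(1,2)[OF assms(2)]]
    curvesD(3)[OF assms(1)] curvesD(3)[OF assms(2)]
  by (cases "wed \<phi> \<epsilon> u"; cases "wed \<phi> \<epsilon> v") (auto simp: less_eq_ennreal.rep_eq dest!: sym[of _ "enn2ereal _"])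

lemma wed_finite_iff:
  assumes "u \<in> curves \<epsilon> u\<^sub>0"
  shows "wed \<phi> \<epsilon> u < \<infinity> \<longleftrightarrow> energy u < \<infinity>"
  using wed_energy[OF curvesD(1,2)[OF assms]]
  by (cases "wed \<phi> \<epsilon> u"; cases "energy u") (auto simp: enn2ereal_ennreal)

text \<open>
  The compensation terms of \<open>\<Phi>\<close> are integrable along every admissible curve, so the positive part of \<open>\<phi>\<close>
  decides.
\<close>
lemma energy_finite:
  assumes u: "u \<in> curves \<epsilon> u\<^sub>0" and fin: "(\<integral>\<^sup>+t. e2ennreal (\<phi> (u t)) \<partial>\<mu>) < \<infinity>"
  shows "energy u < \<infinity>"
proof -
  note AC = curvesD(1)[OF u] and act = curvesD(2)[OF u]
  have hm [measurable]: "hardy u \<in> borel_measurable \<mu>" by (rule hardy_measurable[OF AC])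
  have pm [measurable]: "(\<lambda>t. \<phi> (u t)) \<in> borel_measurable \<mu>" by (rule phi_measurable[OF AC])
  have "\<Phi> u t \<le> e2ennreal (\<phi> (u t)) + (ennreal (Q (u 0)) + ennreal B * hardy u t)" for t
  proof -
    have "\<phi> (u t) \<le> enn2ereal (e2ennreal (\<phi> (u t)))"
      by (cases "0 \<le> \<phi> (u t)") (auto simp: enn2ereal_e2ennreal intro: order_trans[of _ 0])
    then have "\<phi> (u t) + ereal (Q (u 0)) + enn2ereal (ennreal B * hardy u t) \<le>
        enn2ereal (e2ennreal (\<phi> (u t)) + (ennreal (Q (u 0)) + ennreal B * hardy u t))"
      using Q_nonneg by (simp add: plus_ennreal.rep_eq enn2ereal_ennreal add_mono add.assoc)
    then show ?thesis unfolding \<Phi>_def using e2ennreal_mono by fastforce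
  qed
  then have "(\<integral>\<^sup>+t. \<Phi> u t \<partial>\<mu>) \<le> (\<integral>\<^sup>+t. e2ennreal (\<phi> (u t)) + (ennreal (Q (u 0)) + ennreal B * hardy u t) \<partial>\<mu>)"
    by (intro nn_integral_mono)
  also have "\<dots> = (\<integral>\<^sup>+t. e2ennreal (\<phi> (u t)) \<partial>\<mu>) + (\<integral>\<^sup>+t. ennreal (Q (u 0)) + ennreal B * hardy u t \<partial>\<mu>)"
    by (rule nn_integral_add) measurable
  also have "(\<integral>\<^sup>+t. ennreal (Q (u 0)) + ennreal B * hardy u t \<partial>\<mu>) =
      (\<integral>\<^sup>+t. ennreal (Q (u 0)) \<partial>\<mu>) + (\<integral>\<^sup>+t. ennreal B * hardy u t \<partial>\<mu>)"
    by (rule nn_integral_add) measurable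
  also have "(\<integral>\<^sup>+t. ennreal B * hardy u t \<partial>\<mu>) = ennreal B * (ennreal (4 * \<epsilon>\<^sup>2) * action u)"
    by (subst nn_integral_cmult) (auto simp: nn_integral_hardy[OF AC])
  also have "(\<integral>\<^sup>+t. ennreal (Q (u 0)) \<partial>\<mu>) = ennreal (Q (u 0))" by (rule nn_integral_wed_const)
  finally have "(\<integral>\<^sup>+t. \<Phi> u t \<partial>\<mu>) < \<infinity>"
    by (rule le_less_trans) (use fin act in \<open>auto simp: ennreal_mult_less_top\<close>)
  then show ?thesis using act by (simp add: energy_def ennreal_mult_less_top)
qed

lemma constant_curve:
  shows "(\<lambda>t. if 0 \<le> t then x else undefined) \<in> curves \<epsilon> x" (is "?c \<in> _")
    and "x \<in> eff_dom \<phi> \<Longrightarrow> wed \<phi> \<epsilon> (\<lambda>t. if 0 \<le> t then x else undefined) < \<infinity>"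
proof -
  have "AC2_loc {0..} ?c"
    by (rule AC2_locI[of "\<lambda>_. 0"]) (auto simp: square_integrable_def)
  then have "?c \<in> curves_upto \<epsilon> (ereal 1) x" by (simp add: curves_upto_real_iff extensional_def)
  then show c: "?c \<in> curves \<epsilon> x" using curves_upto_subset[of "ereal 1" x] by auto
  assume "x \<in> eff_dom \<phi>"
  then have "e2ennreal (\<phi> x) < \<infinity>"
    by (cases "\<phi> x") (auto simp: eff_dom_def e2ennreal_neg)
  moreover have "(\<integral>\<^sup>+t. e2ennreal (\<phi> (?c t)) \<partial>\<mu>) = (\<integral>\<^sup>+t. e2ennreal (\<phi> x) \<partial>\<mu>)"
    by (rule nn_integral_cong) simp
  ultimately show "wed \<phi> \<epsilon> ?c < \<infinity>"
    unfolding wed_finite_iff[OF c] by (intro energy_finite[OF c]) (simp only: nn_integral_wed_const)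
qed

text \<open>
  The curve \<open>u\<close> is stopped no later than \<open>T\<close>, at a time at which \<open>\<phi>\<close> is finite; such a time exists by
  \<open>good_time\<close>, whatever the value of \<open>\<phi>\<close> at the initial point.
\<close>
lemma feasible_upto:
  assumes u: "u \<in> curves \<epsilon> u\<^sub>0" and fin: "energy u < \<infinity>" and T: "0 < T"
  obtains v where "v \<in> curves_upto \<epsilon> T u\<^sub>0" "energy v < \<infinity>"
proof (cases "T = \<infinity>")
  case True then show ?thesis using u fin that by (simp add: curves_upto_def)
next
  case False
  then obtain b where b: "T = ereal b" "0 < b" using T by (cases T) auto
  have Phi_fin: "(\<integral>\<^sup>+t. \<Phi> u t \<partial>\<mu>) < \<infinity>" using fin by (simp add: energy_def)
  then obtain m where "(\<integral>\<^sup>+t. \<Phi> u t \<partial>\<mu>) \<le> ennreal m"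
    by (cases "\<integral>\<^sup>+t. \<Phi> u t \<partial>\<mu>") auto
  from good_time[OF this, of "b / 2" b] b
  obtain t\<^sub>0 where "t\<^sub>0 \<in> {b / 2..b}"
    "\<phi> (u t\<^sub>0) \<le> ereal ((\<bar>m\<bar> + 1) / (exp (- (b / 2) / \<epsilon>) - exp (- b / \<epsilon>)))" by auto
  then have t\<^sub>0: "0 \<le> t\<^sub>0" "t\<^sub>0 \<le> b" "\<phi> (u t\<^sub>0) < \<infinity>"
    using b by (auto intro: le_less_trans)
  define v where "v t = (if 0 \<le> t then u (min t t\<^sub>0) else undefined)" for t
  have v: "v \<in> curves_upto \<epsilon> T u\<^sub>0"
    unfolding v_def[abs_def] by (rule stopped_curve[OF u]) (use t\<^sub>0 b in auto)
  have "(\<integral>\<^sup>+t. e2ennreal (\<phi> (v t)) \<partial>\<mu>) \<le> (\<integral>\<^sup>+t. \<Phi> u t + e2ennreal (\<phi> (u t\<^sub>0)) \<partial>\<mu>)"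
  proof (rule nn_integral_mono)
    fix t assume "t \<in> space \<mu>"
    then show "e2ennreal (\<phi> (v t)) \<le> \<Phi> u t + e2ennreal (\<phi> (u t\<^sub>0))"
      using phi_le_Phi[of u t] by (auto simp: v_def min_def intro: add_increasing add_increasing2)
  qed
  also have "\<dots> = (\<integral>\<^sup>+t. \<Phi> u t \<partial>\<mu>) + (\<integral>\<^sup>+t. e2ennreal (\<phi> (u t\<^sub>0)) \<partial>\<mu>)"
    by (rule nn_integral_add) (use Phi_measurable[OF curvesD(1)[OF u]] in auto)
  also have "(\<integral>\<^sup>+t. e2ennreal (\<phi> (u t\<^sub>0)) \<partial>\<mu>) = e2ennreal (\<phi> (u t\<^sub>0))" by (rule nn_integral_wed_const)
  also have "(\<integral>\<^sup>+t. \<Phi> u t \<partial>\<mu>) + e2ennreal (\<phi> (u t\<^sub>0)) < \<infinity>"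
    using Phi_fin t\<^sub>0(3) by (cases "\<phi> (u t\<^sub>0)") (auto simp: e2ennreal_neg)
  finally have "energy v < \<infinity>"
    using v curves_upto_subset[OF T] by (intro energy_finite[of v u\<^sub>0]) auto
  with v show ?thesis by (rule that)
qed

lemma curves_upto_closed:
  assumes v: "\<And>n. v n \<in> curves_upto \<epsilon> T u\<^sub>0" and u: "u \<in> curves \<epsilon> u\<^sub>0" and T: "0 < T"
    and lim: "\<And>t. 0 \<le> t \<Longrightarrow> limitin \<sigma> (\<lambda>n. v n t) (u t) sequentially"
  shows "u \<in> curves_upto \<epsilon> T u\<^sub>0"
proof (cases "T = \<infinity>")
  case True then show ?thesis using u by (simp add: curves_upto_def)
next
  case False
  then obtain b where b: "T = ereal b" "0 < b" using T by (cases T) auto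
  have "u t = u b" if "b \<le> t" for t
  proof (rule limitin_Hausdorff_unique[OF _ lim _ Hausdorff_sigma])
    have "v n t = v n b" for n using v[of n] that unfolding b(1) curves_upto_real_iff by blast
    then have eq: "(\<lambda>n. v n t) = (\<lambda>n. v n b)" by (rule ext)
    have "0 \<le> t" using that b by simp
    from lim[OF this] show "limitin \<sigma> (\<lambda>n. v n b) (u t) sequentially" unfolding eq .
  qed (use b in auto)
  then show ?thesis using curvesD[OF u] unfolding b(1) curves_upto_real_iff by blast
qed

section \<open>Minimizers\<close>

lemma wed_minimizers_iff:
  assumes T: "0 < T"
  shows "u \<in> wed_minimizers \<phi> \<epsilon> T u\<^sub>0 \<longleftrightarrow>
    u \<in> curves_upto \<epsilon> T u\<^sub>0 \<and> (\<forall>v\<in>curves_upto \<epsilon> T u\<^sub>0. energy u \<le> energy v)"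
proof -
  have "wed \<phi> \<epsilon> u \<le> wed \<phi> \<epsilon> v \<longleftrightarrow> energy u \<le> energy v"
    if "u \<in> curves_upto \<epsilon> T u\<^sub>0" "v \<in> curves_upto \<epsilon> T u\<^sub>0" for u v
    using that curves_upto_subset[OF T] by (intro wed_le_iff) auto
  then show ?thesis unfolding wed_minimizers_def by blast
qed

theorem minimizer_exists:
  assumes w: "w \<in> curves \<epsilon> u\<^sub>0" "energy w < \<infinity>"
  shows "wed_minimizers \<phi> \<epsilon> \<infinity> u\<^sub>0 \<noteq> {}"
proof -
  define I where "I = (INF v\<in>curves \<epsilon> u\<^sub>0. energy v)"
  have "I \<le> energy w" unfolding I_def using w(1) by (rule INF_lower)
  then have Ifin: "I < \<infinity>" using w(2) by simp
  then obtain i where i: "I = ennreal i" "0 \<le> i" by (cases I) auto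
  have "\<exists>v\<in>curves \<epsilon> u\<^sub>0. energy v < I + ennreal (1 / Suc n)" for n
  proof -
    have "I < I + ennreal (1 / Suc n)" using i by (simp add: ennreal_less_iff flip: ennreal_plus)
    then show ?thesis unfolding I_def by (simp add: INF_less_iff)
  qed
  then obtain v where v: "\<And>n. v n \<in> curves \<epsilon> u\<^sub>0" "\<And>n. energy (v n) < I + ennreal (1 / Suc n)"
    by metis
  have le: "energy (v n) \<le> ennreal (i + 1)" for n
  proof -
    have "energy (v n) \<le> ennreal (i + 1 / Suc n)" using v(2)[of n] i by (simp flip: ennreal_plus)
    also have "\<dots> \<le> ennreal (i + 1)" by (rule ennreal_leI) simp
    finally show ?thesis .
  qed
  obtain r u where ru: "strict_mono (r :: nat \<Rightarrow> nat)" "u \<in> curves \<epsilon> u\<^sub>0"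
    "energy u \<le> liminf (\<lambda>n. energy (v (r n)))"
    by (rule curve_compactness[OF v(1) le], rule that)
  have "energy u \<le> liminf (\<lambda>n. ennreal (i + 1 / Suc (r n)))"
  proof (rule order_trans[OF ru(3) Liminf_mono], rule always_eventually, rule allI)
    show "energy (v (r n)) \<le> ennreal (i + 1 / Suc (r n))" for n
      using less_imp_le[OF v(2)[of "r n"]] i by (simp flip: ennreal_plus)
  qed
  also have "\<dots> = ennreal i"
  proof (rule lim_imp_Liminf)
    have "(\<lambda>n. i + 1 / Suc n) \<longlonglongrightarrow> i + 0" by (intro tendsto_intros LIMSEQ_Suc[OF lim_const_over_n])
    then have "((\<lambda>n. i + 1 / Suc n) \<circ> r) \<longlonglongrightarrow> i"
      using LIMSEQ_subseq_LIMSEQ[OF _ ru(1)] by fastforce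
    then show "(\<lambda>n. ennreal (i + 1 / Suc (r n))) \<longlonglongrightarrow> ennreal i"
      by (intro tendsto_ennrealI) (simp add: o_def)
  qed simp
  finally have "energy u \<le> I" by (simp add: i)
  then have "\<forall>v\<in>curves \<epsilon> u\<^sub>0. energy u \<le> energy v"
    unfolding I_def by (meson INF_lower order_trans)
  then have "u \<in> wed_minimizers \<phi> \<epsilon> \<infinity> u\<^sub>0"
    using ru(2) by (simp add: wed_minimizers_iff) (simp add: curves_upto_def)
  then show ?thesis by blast
qed

text \<open>
  The energies of minimizers are bounded by that of one competitor of finite energy. A limit curve
  belongs to the same class, and its energy is at most the minimal one by lower semicontinuity.
\<close>
theorem minimizers_compact:
  assumes w: "w \<in> curves \<epsilon> u\<^sub>0" "energy w < \<infinity>" and T: "0 < T"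
  shows "sequentially_compactin
    (subtopology (compact_open_topology (top_of_set {0..}) \<sigma>) (curves \<epsilon> u\<^sub>0)) (wed_minimizers \<phi> \<epsilon> T u\<^sub>0)"
  unfolding sequentially_compactin_def
proof (intro conjI allI impI)
  let ?X = "subtopology (compact_open_topology (top_of_set {0..}) \<sigma>) (curves \<epsilon> u\<^sub>0)"
  have cont: "g \<in> extensional {0..} \<and> continuous_map (top_of_set {0..}) \<sigma> g" if "g \<in> curves \<epsilon> u\<^sub>0" for g
    using curves_continuous_map[OF that] curvesD(4)[OF that] by simp
  have const: "limitin ?X (\<lambda>_. g) g sequentially" if g: "g \<in> curves \<epsilon> u\<^sub>0" for g
  proof (rule limitin_compact_openI[OF g g cont])
    fix t U assume t: "0 \<le> t" and U: "openin \<sigma> U" "g t \<in> U"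
    have "continuous_on {0..} g" by (rule AC2_loc_continuous[OF curvesD(1)[OF g]])
    then have "\<forall>\<^sub>F s in at t within {0..}. g s \<in> U"
      using t U open_sigma[OF U(1)] by (auto simp: continuous_on_def intro: topological_tendstoD)
    then obtain \<delta> where "\<delta> > 0" "\<forall>s\<in>{0..}. s \<noteq> t \<and> dist s t < \<delta> \<longrightarrow> g s \<in> U"
      by (auto simp: eventually_at)
    then show "\<exists>\<delta>>0. \<forall>\<^sub>F n in sequentially. \<forall>s\<ge>0. \<bar>s - t\<bar> < \<delta> \<longrightarrow> g s \<in> U"
      using U(2) by (intro exI[of _ \<delta>]) (auto simp: dist_real_def)
  qed
  show "wed_minimizers \<phi> \<epsilon> T u\<^sub>0 \<subseteq> topspace ?X"
  proof
    fix g assume "g \<in> wed_minimizers \<phi> \<epsilon> T u\<^sub>0"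
    then have "g \<in> curves \<epsilon> u\<^sub>0" using curves_upto_subset[OF T] by (auto simp: wed_minimizers_def)
    from limitin_topspace[OF const[OF this]] show "g \<in> topspace ?X" .
  qed
  fix f :: "nat \<Rightarrow> real \<Rightarrow> 'a" assume f: "range f \<subseteq> wed_minimizers \<phi> \<epsilon> T u\<^sub>0"
  then have fK: "f n \<in> curves_upto \<epsilon> T u\<^sub>0" and fmin: "v \<in> curves_upto \<epsilon> T u\<^sub>0 \<Longrightarrow> energy (f n) \<le> energy v" for n v
    using wed_minimizers_iff[OF T] by blast+
  have fc: "f n \<in> curves \<epsilon> u\<^sub>0" for n using fK curves_upto_subset[OF T] by blast
  obtain w' where w': "w' \<in> curves_upto \<epsilon> T u\<^sub>0" "energy w' < \<infinity>"
    by (rule feasible_upto[OF w T])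
  then obtain m where "energy w' = ennreal m" by (cases "energy w'") auto
  then have le: "energy (f n) \<le> ennreal m" for n using fmin[OF w'(1)] by simp
  obtain r u where ru: "strict_mono (r :: nat \<Rightarrow> nat)" "u \<in> curves \<epsilon> u\<^sub>0"
    "\<And>t. 0 \<le> t \<Longrightarrow> limitin \<sigma> (\<lambda>n. f (r n) t) (u t) sequentially"
    "energy u \<le> liminf (\<lambda>n. energy (f (r n)))"
    "\<And>t U. 0 \<le> t \<Longrightarrow> openin \<sigma> U \<Longrightarrow> u t \<in> U \<Longrightarrow>
       \<exists>\<delta>>0. \<forall>\<^sub>F n in sequentially. \<forall>s\<ge>0. \<bar>s - t\<bar> < \<delta> \<longrightarrow> f (r n) s \<in> U"
    by (rule curve_compactness[OF fc le], rule that)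
  have uK: "u \<in> curves_upto \<epsilon> T u\<^sub>0"
    by (rule curves_upto_closed[OF fK ru(2) T ru(3)])
  have "energy u \<le> energy v" if "v \<in> curves_upto \<epsilon> T u\<^sub>0" for v
    by (rule order_trans[OF ru(4) order_trans[OF Liminf_le_Limsup Limsup_bounded]]) (use fmin[OF that] in auto)
  with uK have "u \<in> wed_minimizers \<phi> \<epsilon> T u\<^sub>0" by (simp add: wed_minimizers_iff[OF T])
  moreover have "limitin ?X (f \<circ> r) u sequentially"
    unfolding o_def by (rule limitin_compact_openI[OF fc ru(2) cont ru(5)])
  ultimately show "\<exists>l\<in>wed_minimizers \<phi> \<epsilon> T u\<^sub>0. \<exists>r. strict_mono r \<and> limitin ?X (f \<circ> r) l sequentially"
    using ru(1) by blast
qed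

end

theorem theorem3p2:
  fixes \<sigma> :: "'a::complete_space topology"
    and \<phi> :: "'a \<Rightarrow> ereal"
    and ustar :: 'a
    and A B \<epsilon> :: real
  assumes "compatible \<sigma>"
    and "proper \<phi>"
    and "LSCC \<sigma> \<phi> ustar A B"
    and "\<epsilon> > 0"
    and "1 / (16 * \<epsilon>) \<ge> B"
  shows "(\<forall>u\<^sub>0. \<forall>u\<in>curves \<epsilon> u\<^sub>0.
            (AE t in wed_measure \<epsilon>. \<exists>l. has_metric_deriv {0..} u l t) \<and>
            ereal_integral_well_defined (wed_measure \<epsilon>) (wed_integrand \<phi> \<epsilon> u))
       \<and> (\<forall>u\<^sub>0\<in>eff_dom \<phi>. \<exists>u\<in>curves \<epsilon> u\<^sub>0. wed \<phi> \<epsilon> u < \<infinity>)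
       \<and> (\<forall>u\<^sub>0. (\<exists>u\<in>curves \<epsilon> u\<^sub>0. wed \<phi> \<epsilon> u < \<infinity>) \<longrightarrow>
            wed_minimizers \<phi> \<epsilon> \<infinity> u\<^sub>0 \<noteq> {} \<and>
            (\<forall>T>0. sequentially_compactin
                      (subtopology (compact_open_topology (top_of_set {0..}) \<sigma>) (curves \<epsilon> u\<^sub>0))
                      (wed_minimizers \<phi> \<epsilon> T u\<^sub>0)))"
proof -
  interpret wed_problem \<epsilon> \<sigma> \<phi> ustar A B
    using assms by unfold_locales auto
  show ?thesis
  proof (intro conjI allI ballI impI)
    fix u\<^sub>0 :: 'a and u assume u: "u \<in> curves \<epsilon> u\<^sub>0"
    show "AE t in wed_measure \<epsilon>. \<exists>l. has_metric_deriv {0..} u l t"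
      using AE_md[OF curvesD(1)[OF u]] by eventually_elim blast
    show "ereal_integral_well_defined (wed_measure \<epsilon>) (wed_integrand \<phi> \<epsilon> u)"
      by (rule wed_well_defined[OF curvesD(1,2)[OF u]])
  next
    fix u\<^sub>0 assume "u\<^sub>0 \<in> eff_dom \<phi>"
    with constant_curve[of u\<^sub>0] show "\<exists>u\<in>curves \<epsilon> u\<^sub>0. wed \<phi> \<epsilon> u < \<infinity>" by blast
  next
    fix u\<^sub>0 :: 'a assume "\<exists>u\<in>curves \<epsilon> u\<^sub>0. wed \<phi> \<epsilon> u < \<infinity>"
    then obtain w where w: "w \<in> curves \<epsilon> u\<^sub>0" "energy w < \<infinity>" using wed_finite_iff by blast
    show "wed_minimizers \<phi> \<epsilon> \<infinity> u\<^sub>0 \<noteq> {}" by (rule minimizer_exists[OF w])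
    show "sequentially_compactin
            (subtopology (compact_open_topology (top_of_set {0..}) \<sigma>) (curves \<epsilon> u\<^sub>0))
            (wed_minimizers \<phi> \<epsilon> T u\<^sub>0)" if "0 < T" for T
      by (rule minimizers_compact[OF w that])
  qed
qed

end
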